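(* Let $\alpha>0$, let $m\geq 1$ be an integer, and let $u^{in}\in H^m(\mathbb T^3)\cap V$. Then there exists a unique solution $u$ of the Euler-Voigt equation $$(I+\alpha^2A)\frac{du}{dt}+B(u,u)=0,\qquad u(0)=u^{in},$$ with $u\in C^1((-\infty,\infty),H^m(\mathbb T^3)\cap V)$. Moreover, for all $t\in(-\infty,\infty)$, $$\|u(t)\|_{H^m(\mathbb T^3)}\leq C(\alpha,\|u^{in}\|_{H^m})\,(1+|t|)^{p(m)},$$ where $C(\alpha,\|u^{in}\|_{H^m})$ is a constant (for the given $m$) depending only on $\alpha$ and $\|u^{in}\|_{H^m(\mathbb T^3)}$, and $p(1)=1$, $p(2)=2$, and $p(m)=5\left(\frac32\right)^{m-3}-1$ for $m\geq 3$.
   Context: $\mathbb T^3=[0,1]^3$ is the periodic unit torus. $L^p$ and $H^m$ are the usual Lebesgue and Sobolev spaces on $\mathbb T^3$ (of $\mathbb R^3$-valued functions where appropriate). $\mathcal V$ is the set of $\mathbb R^3$-valued trigonometric polynomials $\varphi$ on $\mathbb T^3$ with $\nabla\cdot\varphi=0$ and $\int_{\mathbb T^3}\varphi\,dx=0$. $H$ and $V$ are the closures of $\mathcal V$ in $L^2$ and $H^1$, respectively, and $V'$ is the dual of $V$. $P_\sigma:L^2\to H$ is the Leray-Helmholtz (orthogonal) projection, and $A=-P_\sigma\triangle$ is the Stokes operator, with domain $H^2\cap V$ (here $A=-\triangle$ because of periodicity); it extends to a bounded operator $V\to V'$. $B(w_1,w_2)=P_\sigma((w_1\cdot\nabla)w_2)$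 for $w_1,w_2\in\mathcal V$, extended to a continuous bilinear map $B:V\times V\to V'$. A function $u\in C^1((T_1,T_2),V)$, $T_1\le 0<T_2$, is a solution of the equation on $(T_1,T_2)$ if it satisfies $(I+\alpha^2A)\frac{du}{dt}+B(u,u)=0$ in the sense of $V'$ and $u(0)=u^{in}$. This is the functional form of the Euler-Voigt system $-\alpha^2\partial_t\triangle u+\partial_t u+(u\cdot\nabla)u+\nabla p=0$, $\nabla\cdot u=0$, with periodic boundary conditions and zero forcing. *)

theory Defs
  imports "HOL-Analysis.Analysis"
begin

(* An element of a space of functions on the torus is represented by a function on R^3 of which
   only the restriction to the unit cube matters, up to null sets; it need not itself be
   periodic.  Periodicity enters through the test functions of weak derivatives and through the
   trigonometric polynomials, which are honest 1-periodic functions on R^3. *)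

type_synonym vfield = "real^3 \<Rightarrow> real^3"

definition torus :: "(real^3) measure" where
  "torus = lebesgue_on (cbox 0 1)"


section \<open>Smooth periodic functions\<close>

definition pdiff :: "3 \<Rightarrow> (real^3 \<Rightarrow> 'a::real_normed_vector) \<Rightarrow> real^3 \<Rightarrow> 'a" where
  "pdiff i f x = vector_derivative (\<lambda>s. f (x + s *\<^sub>R axis i 1)) (at 0)"

text \<open>All iterated partial derivatives, in every order, exist and are totally differentiable
  (hence continuous).\<close>

definition smooth_periodic :: "(real^3 \<Rightarrow> real) \<Rightarrow> bool" where
  "smooth_periodic \<phi> \<longleftrightarrow>
     (\<forall>is :: 3 list. \<forall>x. foldr pdiff is \<phi> differentiable (at x)) \<and>
     (\<forall>i x. \<phi> (x + axis i 1) = \<phi> x)"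

definition multi_order :: "nat^3 \<Rightarrow> nat" where
  "multi_order \<beta> = (\<Sum>i\<in>UNIV. \<beta> $ i)"

definition mdiff :: "nat^3 \<Rightarrow> (real^3 \<Rightarrow> real) \<Rightarrow> real^3 \<Rightarrow> real" where
  "mdiff \<beta> \<phi> = (pdiff 1 ^^ (\<beta> $ 1)) ((pdiff 2 ^^ (\<beta> $ 2)) ((pdiff 3 ^^ (\<beta> $ 3)) \<phi>))"


section \<open>Lebesgue and Sobolev spaces of vector fields on the torus\<close>

definition L2 :: "vfield set" where
  "L2 = {f. f \<in> borel_measurable torus \<and> integrable torus (\<lambda>x. (norm (f x))\<^sup>2)}"

definition L2_inner :: "vfield \<Rightarrow> vfield \<Rightarrow> real" where
  "L2_inner f g = (LINT x|torus. f x \<bullet> g x)"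

definition L2_norm :: "vfield \<Rightarrow> real" where
  "L2_norm f = sqrt (LINT x|torus. (norm (f x))\<^sup>2)"

definition is_weak_deriv :: "nat^3 \<Rightarrow> vfield \<Rightarrow> vfield \<Rightarrow> bool" where
  "is_weak_deriv \<beta> u g \<longleftrightarrow>
     (\<forall>\<phi>. smooth_periodic \<phi> \<longrightarrow>
        (LINT x|torus. mdiff \<beta> \<phi> x *\<^sub>R u x) = (-1) ^ multi_order \<beta> *\<^sub>R (LINT x|torus. \<phi> x *\<^sub>R g x))"

definition weak_deriv :: "nat^3 \<Rightarrow> vfield \<Rightarrow> vfield" where
  "weak_deriv \<beta> u = (SOME g. g \<in> L2 \<and> is_weak_deriv \<beta> u g)"

definition sobolev :: "nat \<Rightarrow> vfield set" where
  "sobolev m = {u \<in> L2. \<forall>\<beta>. multi_order \<beta> \<le> m \<longrightarrow> (\<exists>g\<in>L2. is_weak_deriv \<beta> u g)}"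

definition sobolev_norm :: "nat \<Rightarrow> vfield \<Rightarrow> real" where
  "sobolev_norm m u = sqrt (\<Sum>\<beta> | multi_order \<beta> \<le> m. (L2_norm (weak_deriv \<beta> u))\<^sup>2)"


section \<open>Solenoidal fields\<close>

definition trig_poly :: "vfield \<Rightarrow> bool" where
  "trig_poly \<phi> \<longleftrightarrow>
     (\<exists>(K :: (int^3) set) a b. finite K \<and>
        \<phi> = (\<lambda>x. \<Sum>k\<in>K. cos (2 * pi * (\<Sum>i\<in>UNIV. real_of_int (k $ i) * x $ i)) *\<^sub>R a k
                      + sin (2 * pi * (\<Sum>i\<in>UNIV. real_of_int (k $ i) * x $ i)) *\<^sub>R b k))"

definition divergence :: "vfield \<Rightarrow> real^3 \<Rightarrow> real" where
  "divergence \<phi> x = (\<Sum>i\<in>UNIV. pdiff i \<phi> x $ i)"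

definition solenoidal_trig :: "vfield set" where
  "solenoidal_trig =
     {\<phi>. trig_poly \<phi> \<and> (\<forall>x. divergence \<phi> x = 0) \<and> (LINT x|torus. \<phi> x) = 0}"

definition space_H :: "vfield set" where
  "space_H = {w \<in> L2. \<forall>e>0. \<exists>\<phi>\<in>solenoidal_trig. L2_norm (\<lambda>x. w x - \<phi> x) < e}"

definition space_V :: "vfield set" where
  "space_V = {w \<in> sobolev 1. \<forall>e>0. \<exists>\<phi>\<in>solenoidal_trig. sobolev_norm 1 (\<lambda>x. w x - \<phi> x) < e}"


section \<open>The operators $P_\sigma$, $A$ and $B$\<close>

definition leray :: "vfield \<Rightarrow> vfield" where
  "leray f = (SOME h. h \<in> space_H \<and> (\<forall>v\<in>space_H. L2_inner (\<lambda>x. f x - h x) v = 0))"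

definition laplacian :: "vfield \<Rightarrow> vfield" where
  "laplacian w = (\<lambda>x. \<Sum>i\<in>UNIV. weak_deriv (axis i 2) w x)"

definition stokes :: "vfield \<Rightarrow> vfield" where
  "stokes w = leray (\<lambda>x. - laplacian w x)"

definition stokes_domain :: "vfield set" where
  "stokes_domain = sobolev 2 \<inter> space_V"

definition advection :: "vfield \<Rightarrow> vfield \<Rightarrow> vfield" where
  "advection w1 w2 = leray (\<lambda>x. \<Sum>i\<in>UNIV. w1 x $ i *\<^sub>R pdiff i w2 x)"

text \<open>An element of \<open>V'\<close> is represented by its values on \<open>space_V\<close>, and \<open>f \<in> L2\<close> is
  identified with the functional \<open>L2_inner f\<close>.  The filter below describes convergence to \<open>w\<close> in
  the norm of \<open>V\<close> through elements of \<open>D\<close>; the extensions by continuity of \<open>stokes\<close> to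
  \<open>V \<rightarrow> V'\<close> and of \<open>advection\<close> to \<open>V \<times> V \<rightarrow> V'\<close> are limits along it.\<close>

definition V_approx :: "vfield set \<Rightarrow> vfield \<Rightarrow> vfield filter" where
  "V_approx D w = inf (filtercomap (\<lambda>\<phi>. sobolev_norm 1 (\<lambda>x. \<phi> x - w x)) (nhds 0)) (principal D)"

definition stokes_ext :: "vfield \<Rightarrow> vfield \<Rightarrow> real" where
  "stokes_ext w v = Lim (V_approx stokes_domain w) (\<lambda>\<phi>. L2_inner (stokes \<phi>) v)"

definition advection_ext :: "vfield \<Rightarrow> vfield \<Rightarrow> vfield \<Rightarrow> real" where
  "advection_ext w1 w2 v =
     Lim (V_approx solenoidal_trig w1 \<times>\<^sub>F V_approx solenoidal_trig w2)
       (\<lambda>(\<phi>, \<psi>). L2_inner (advection \<phi> \<psi>) v)"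


section \<open>The Euler-Voigt equation\<close>

definition C1_with_deriv ::
  "real set \<Rightarrow> vfield set \<Rightarrow> (vfield \<Rightarrow> real) \<Rightarrow> (real \<Rightarrow> vfield) \<Rightarrow> (real \<Rightarrow> vfield) \<Rightarrow> bool" where
  "C1_with_deriv I X N u u' \<longleftrightarrow>
     (\<forall>t\<in>I. u t \<in> X \<and> u' t \<in> X \<and>
        ((\<lambda>s. N (\<lambda>x. (1 / (s - t)) *\<^sub>R (u s x - u t x) - u' t x)) \<longlongrightarrow> 0) (at t within I) \<and>
        ((\<lambda>s. N (\<lambda>x. u' s x - u' t x)) \<longlongrightarrow> 0) (at t within I))"

definition C1_Hm_V :: "nat \<Rightarrow> real set \<Rightarrow> (real \<Rightarrow> vfield) \<Rightarrow> bool" where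
  "C1_Hm_V m I u \<longleftrightarrow> (\<exists>u'. C1_with_deriv I (sobolev m \<inter> space_V) (sobolev_norm m) u u')"

definition euler_voigt_solution ::
  "real \<Rightarrow> ereal \<Rightarrow> ereal \<Rightarrow> vfield \<Rightarrow> (real \<Rightarrow> vfield) \<Rightarrow> bool" where
  "euler_voigt_solution \<alpha> T1 T2 uin u \<longleftrightarrow>
     T1 \<le> 0 \<and> 0 < T2 \<and>
     (\<exists>u'. C1_with_deriv (einterval T1 T2) space_V (sobolev_norm 1) u u' \<and>
        (\<forall>t\<in>einterval T1 T2. \<forall>v\<in>space_V.
           L2_inner (u' t) v + \<alpha>\<^sup>2 * stokes_ext (u' t) v + advection_ext (u t) (u t) v = 0)) \<and>
     (AE x in torus. u 0 x = uin x)"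

definition growth_exponent :: "nat \<Rightarrow> real" where
  "growth_exponent m = (if m = 1 then 1 else if m = 2 then 2 else 5 * (3/2) ^ (m - 3) - 1)"

end

theory Submission
  imports Defs
begin

text \<open>The Euler-Voigt equation is an ordinary differential equation with a quadratic right-hand side in
the energy space: \<open>(I + \<alpha>\<^sup>2 A)\<^sup>-\<^sup>1\<close> gains the two derivatives that make
\<open>B(u,u)\<close>, which is a derivative of the products \<open>u\<^sub>i u\<close>, bounded on \<open>V\<close>. Everything happens in Fourier
coefficients with respect to the real orthonormal basis \<open>cas (2 \<pi> k \<cdot> x)\<close>, \<open>cas = cos + sin\<close>, whose
coefficients are arbitrary real vectors; differentiation maps the basis function of \<open>k\<close> to a multiple of
that of \<open>-k\<close>. The state is the family of coefficients multiplied by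
\<open>(1 + 4 \<pi>\<^sup>2 \<alpha>\<^sup>2 |k|\<^sup>2)\<^sup>1\<^sup>/\<^sup>2\<close>, so that the conserved energy
\<open>|u|\<^sup>2 + \<alpha>\<^sup>2 |\<nabla>u|\<^sup>2\<close> is the squared norm of \<open>ell2\<close> and the weak equation becomes
\<open>z' = voigt \<alpha> z z\<close> (\<open>weak_form_eq\<close>, \<open>weak_form_imp_ode\<close>).

Global existence and uniqueness follow from boundedness of the bilinear map \<open>voigt\<close> and from
\<open>\<langle>voigt z z, z\<rangle> = 0\<close>: composing the vector field with the retraction onto the ball of the initial energy
makes it globally Lipschitz without changing the solution (\<open>quadratic_ode_global\<close>, \<open>quadratic_ode_unique\<close>).

Regularity and growth rest on one convolution estimate (\<open>l2_le_conv\<close>). For every \<open>R \<ge> 1\<close> the product of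
two functions satisfies \<open>|p q|\<^sup>2 \<le> C R (|p|\<^sup>2 + R\<^sup>-\<^sup>2 |p|\<^sub>1\<^sup>2) |q|\<^sub>1\<^sup>2\<close>, where the index 1 marks
the norm of \<open>H\<^sup>1\<close>, because the lattice sum of \<open>1/((1 + |k|\<^sup>2)(1 + |k|\<^sup>2/R\<^sup>2))\<close>
is of order \<open>R\<close> in dimension three. Applied with \<open>m - 1\<close> derivatives on \<open>p\<close> and with the best \<open>R\<close>, it bounds the
time derivative of the norm \<open>y\<^sub>m\<close> of \<open>H\<^sup>m\<close> by a multiple of
\<open>(y\<^sub>m y\<^sub>m\<^sub>-\<^sub>1)\<^sup>1\<^sup>/\<^sup>2\<close>, since \<open>y\<^sub>1\<close> is controlled by the energy. Hence each further derivative costs at most a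
factor \<open>(1 + |t|)\<^sup>2\<close> and \<open>y\<^sub>m\<close> grows at most like \<open>(1 + |t|)\<^sup>2\<^sup>(\<^sup>m\<^sup>-\<^sup>1\<^sup>)\<close>, whose exponent does not exceed
\<open>growth_exponent m\<close>. The estimate is carried out with weights truncated at a frequency \<open>N\<close>,
for which all norms are finite on \<open>ell2\<close>, with constants independent of \<open>N\<close>; so it proves
the persistence of regularity at the same time (\<open>growth_step\<close>, \<open>polynomial_growth\<close>).

The remaining work connects the function spaces with coefficients: completeness of the basis and the
theorems of Riesz-Fischer and Parseval, weak derivatives as multipliers, the description of \<open>V\<close> by
\<open>k \<cdot> a\<^sub>k = 0\<close>, and the identification of the extended operators \<open>stokes_ext\<close> and \<open>advection_ext\<close>.\<close>

section \<open>Square summable coefficient families\<close>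

text \<open>A bound on all finite partial sums expresses square summability and a bound of the sum in one
predicate, so estimates can be chained without separate summability conditions.\<close>

definition l2_le :: "('i \<Rightarrow> 'a::real_normed_vector) \<Rightarrow> real \<Rightarrow> bool" where
  "l2_le f B \<longleftrightarrow> (\<forall>F. finite F \<longrightarrow> (\<Sum>k\<in>F. (norm (f k))\<^sup>2) \<le> B)"

lemma l2_leD: "l2_le f B \<Longrightarrow> finite F \<Longrightarrow> (\<Sum>k\<in>F. (norm (f k))\<^sup>2) \<le> B"
  by (simp add: l2_le_def)

lemma l2_leI: "(\<And>F. finite F \<Longrightarrow> (\<Sum>k\<in>F. (norm (f k))\<^sup>2) \<le> B) \<Longrightarrow> l2_le f B"
  by (simp add: l2_le_def)

lemma l2_le_nonneg: "l2_le f B \<Longrightarrow> 0 \<le> B"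
  using l2_leD[of f B "{}"] by simp

lemma l2_le_summable:
  assumes "l2_le f B"
  shows "(\<lambda>k. (norm (f k))\<^sup>2) summable_on UNIV" "(\<Sum>\<^sub>\<infinity>k. (norm (f k))\<^sup>2) \<le> B"
proof -
  show "(\<lambda>k. (norm (f k))\<^sup>2) summable_on UNIV"
    by (rule nonneg_bdd_above_summable_on) (auto intro!: bdd_aboveI[where M = B] l2_leD[OF assms])
  then show "(\<Sum>\<^sub>\<infinity>k. (norm (f k))\<^sup>2) \<le> B"
    by (rule infsum_le_finite_sums) (use l2_leD[OF assms] in auto)
qed

lemma l2_le_iff: "l2_le f B \<longleftrightarrow> (\<lambda>k. (norm (f k))\<^sup>2) summable_on UNIV \<and> (\<Sum>\<^sub>\<infinity>k. (norm (f k))\<^sup>2) \<le> B"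
proof
  assume *: "(\<lambda>k. (norm (f k))\<^sup>2) summable_on UNIV \<and> (\<Sum>\<^sub>\<infinity>k. (norm (f k))\<^sup>2) \<le> B"
  show "l2_le f B"
  proof (rule l2_leI)
    fix F :: "'a set" assume "finite F"
    then have "(\<Sum>k\<in>F. (norm (f k))\<^sup>2) \<le> (\<Sum>\<^sub>\<infinity>k. (norm (f k))\<^sup>2)"
      using * by (intro finite_sum_le_infsum) auto
    then show "(\<Sum>k\<in>F. (norm (f k))\<^sup>2) \<le> B" using * by linarith
  qed
qed (auto dest: l2_le_summable)

lemma l2_le_mono: "l2_le f B \<Longrightarrow> B \<le> C \<Longrightarrow> l2_le f C"
  unfolding l2_le_def by (meson order_trans)

lemma l2_le_dom:
  assumes "l2_le g B" "\<And>k. norm (f k) \<le> c * norm (g k)"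
  shows "l2_le f (c\<^sup>2 * B)"
proof (rule l2_leI)
  fix F :: "'a set" assume F: "finite F"
  have "(\<Sum>k\<in>F. (norm (f k))\<^sup>2) \<le> (\<Sum>k\<in>F. c\<^sup>2 * (norm (g k))\<^sup>2)"
    by (intro sum_mono) (use assms(2) in \<open>auto simp flip: power_mult_distrib intro!: power_mono\<close>)
  also have "\<dots> \<le> c\<^sup>2 * B"
    using l2_leD[OF assms(1) F] by (simp flip: sum_distrib_left add: mult_left_mono)
  finally show "(\<Sum>k\<in>F. (norm (f k))\<^sup>2) \<le> c\<^sup>2 * B" .
qed

lemma l2_le_dom1:
  assumes "l2_le g B" "\<And>k. norm (f k) \<le> norm (g k)"
  shows "l2_le f B"
  using l2_le_dom[OF assms(1), of f 1] assms(2) by simp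

lemma l2_le_cmult: "l2_le f B \<Longrightarrow> l2_le (\<lambda>k. c *\<^sub>R f k) (c\<^sup>2 * B)"
  using l2_le_dom[of f B "\<lambda>k. c *\<^sub>R f k" "\<bar>c\<bar>"] by simp

lemma l2_le_reindex:
  assumes "l2_le f B" "inj h"
  shows "l2_le (\<lambda>k. f (h k)) B"
proof (rule l2_leI)
  fix F :: "'c set" assume "finite F"
  then have "(\<Sum>k\<in>h ` F. (norm (f k))\<^sup>2) \<le> B" using l2_leD[OF assms(1)] by blast
  then show "(\<Sum>k\<in>F. (norm (f (h k)))\<^sup>2) \<le> B"
    using assms(2) by (simp add: sum.reindex inj_on_def)
qed

lemma sq_sum_le2: "(x + y)\<^sup>2 \<le> 2 * x\<^sup>2 + 2 * y\<^sup>2" for x y :: real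
  using sum_squares_ge_zero[of "x - y" 0] by (simp add: power2_eq_square algebra_simps)

lemma l2_le_add:
  assumes "l2_le f B" "l2_le g C"
  shows "l2_le (\<lambda>k. f k + g k) (2 * B + 2 * C)"
proof (rule l2_leI)
  fix F :: "'a set" assume F: "finite F"
  have "(\<Sum>k\<in>F. (norm (f k + g k))\<^sup>2) \<le> (\<Sum>k\<in>F. 2 * (norm (f k))\<^sup>2 + 2 * (norm (g k))\<^sup>2)"
    by (intro sum_mono order_trans[OF _ sq_sum_le2] power_mono norm_triangle_ineq) auto
  also have "\<dots> \<le> 2 * B + 2 * C"
    using l2_leD[OF assms(1) F] l2_leD[OF assms(2) F]
    by (simp flip: sum_distrib_left add: sum.distrib)
  finally show "(\<Sum>k\<in>F. (norm (f k + g k))\<^sup>2) \<le> 2 * B + 2 * C" .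
qed

lemma l2_le_diff:
  assumes "l2_le f B" "l2_le g C"
  shows "l2_le (\<lambda>k. f k - g k) (2 * B + 2 * C)"
  using l2_le_add[OF assms(1) l2_le_cmult[OF assms(2), of "-1"]] by simp

lemma l2_le_inner:
  fixes f g :: "'i \<Rightarrow> 'a::real_inner"
  assumes "l2_le f B" "l2_le g C"
  shows "(\<lambda>k. f k \<bullet> g k) summable_on UNIV"
proof -
  have "(\<lambda>k. (norm (f k))\<^sup>2 + (norm (g k))\<^sup>2) summable_on UNIV"
    using assms[THEN l2_le_summable(1)] by (rule summable_on_add)
  moreover have "norm (f k \<bullet> g k) \<le> (norm (f k))\<^sup>2 + (norm (g k))\<^sup>2" for k
  proof -
    have "norm (f k \<bullet> g k) \<le> norm (f k) * norm (g k)" by (simp add: Cauchy_Schwarz_ineq2)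
    also have "\<dots> \<le> (norm (f k))\<^sup>2 + (norm (g k))\<^sup>2"
      using sum_squares_ge_zero[of "norm (f k) - norm (g k)" 0]
      by (simp add: power2_eq_square algebra_simps)
         (smt (verit) mult_nonneg_nonneg norm_ge_zero)
    finally show ?thesis .
  qed
  ultimately have "(\<lambda>k. norm (f k \<bullet> g k)) summable_on UNIV"
    by (rule Infinite_Sum.abs_summable_on_comparison_test')
  then show ?thesis by (rule abs_summable_summable)
qed

lemma l2_le_component:
  assumes "l2_le f B" shows "(norm (f k))\<^sup>2 \<le> B"
  using l2_leD[OF assms, of "{k}"] by simp

text \<open>The state space of the differential equation.\<close>

typedef ell2 = "{a :: int^3 \<Rightarrow> real^3. \<exists>B. l2_le a B}"
  morphisms coef Abs_ell2
proof
  show "(\<lambda>_. 0) \<in> {a :: int^3 \<Rightarrow> real^3. \<exists>B. l2_le a B}"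
    by (auto simp: l2_le_def)
qed

setup_lifting type_definition_ell2

lemma coef_l2: "\<exists>B. l2_le (coef z) B"
  using coef by auto

lemma coef_eqI: "(\<And>k. coef z k = coef y k) \<Longrightarrow> z = y"
  by (metis coef_inject ext)

lemma coef_Abs: "l2_le a B \<Longrightarrow> coef (Abs_ell2 a) = a"
  by (auto intro!: Abs_ell2_inverse)

instantiation ell2 :: real_inner
begin

lift_definition zero_ell2 :: ell2 is "\<lambda>_. 0"
  by (auto simp: l2_le_def)

lift_definition plus_ell2 :: "ell2 \<Rightarrow> ell2 \<Rightarrow> ell2" is "\<lambda>a b k. a k + b k"
  by (auto intro: l2_le_add)

lift_definition minus_ell2 :: "ell2 \<Rightarrow> ell2 \<Rightarrow> ell2" is "\<lambda>a b k. a k - b k"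
  by (auto intro: l2_le_diff)

lift_definition uminus_ell2 :: "ell2 \<Rightarrow> ell2" is "\<lambda>a k. - a k"
  by (auto simp: l2_le_def)

lift_definition scaleR_ell2 :: "real \<Rightarrow> ell2 \<Rightarrow> ell2" is "\<lambda>c a k. c *\<^sub>R a k"
  by (auto intro: l2_le_cmult)

lift_definition inner_ell2 :: "ell2 \<Rightarrow> ell2 \<Rightarrow> real" is "\<lambda>a b. \<Sum>\<^sub>\<infinity>k. a k \<bullet> b k" .

definition norm_ell2 :: "ell2 \<Rightarrow> real" where "norm_ell2 z = sqrt (z \<bullet> z)"
definition dist_ell2 :: "ell2 \<Rightarrow> ell2 \<Rightarrow> real" where "dist_ell2 z y = norm (z - y)"
definition sgn_ell2 :: "ell2 \<Rightarrow> ell2" where "sgn_ell2 z = inverse (norm z) *\<^sub>R z"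
definition uniformity_ell2 :: "(ell2 \<times> ell2) filter" where
  "uniformity_ell2 = (INF e\<in>{0<..}. principal {(x, y). dist x y < e})"
definition open_ell2 :: "ell2 set \<Rightarrow> bool" where
  "open_ell2 U \<longleftrightarrow> (\<forall>x\<in>U. eventually (\<lambda>(x', y). x' = x \<longrightarrow> y \<in> U) uniformity)"

instance
proof
  fix x y z :: ell2 and c d :: real
  show "x + y + z = x + (y + z)" "x + y = y + x" "0 + x = x" "- x + x = 0" "x - y = x + - y"
    "c *\<^sub>R (x + y) = c *\<^sub>R x + c *\<^sub>R y" "(c + d) *\<^sub>R x = c *\<^sub>R x + d *\<^sub>R x" "c *\<^sub>R d *\<^sub>R x = (c * d) *\<^sub>R x" "1 *\<^sub>R x = x"
    by (transfer; auto simp: fun_eq_iff algebra_simps)+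
  show "x \<bullet> y = y \<bullet> x" by transfer (simp add: inner_commute)
  have s: "(\<lambda>k. coef x k \<bullet> coef y k) summable_on UNIV" for x y
    using coef_l2[of x] coef_l2[of y] by (auto intro: l2_le_inner)
  show "(x + y) \<bullet> z = x \<bullet> z + y \<bullet> z"
    unfolding inner_ell2.rep_eq plus_ell2.rep_eq inner_add_left
    by (rule infsum_add[OF s s])
  show "c *\<^sub>R x \<bullet> y = c * (x \<bullet> y)"
    unfolding inner_ell2.rep_eq scaleR_ell2.rep_eq inner_scaleR_left
    by (rule infsum_cmult_right')
  show "0 \<le> x \<bullet> x"
    unfolding inner_ell2.rep_eq by (rule infsum_nonneg) auto
  show "x \<bullet> x = 0 \<longleftrightarrow> x = 0"
  proof
    assume *: "x \<bullet> x = 0"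
    have "coef x k = 0" for k
      using nonneg_infsum_le_0D[of "\<lambda>k. coef x k \<bullet> coef x k" UNIV k] * s[of x x]
      by (auto simp: inner_ell2.rep_eq)
    then show "x = 0" by (intro coef_eqI) (simp add: zero_ell2.rep_eq)
  qed (simp add: inner_ell2.rep_eq zero_ell2.rep_eq)
qed (simp_all add: norm_ell2_def dist_ell2_def sgn_ell2_def uniformity_ell2_def open_ell2_def)

end

lemmas coef_simps = zero_ell2.rep_eq plus_ell2.rep_eq minus_ell2.rep_eq uminus_ell2.rep_eq scaleR_ell2.rep_eq

lemma norm_ell2_sq: "(norm z)\<^sup>2 = (\<Sum>\<^sub>\<infinity>k. (norm (coef z k))\<^sup>2)" for z :: ell2
  by (simp only: power2_norm_eq_inner inner_ell2.rep_eq)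

lemma l2_le_coef_iff: "l2_le (coef z) B \<longleftrightarrow> (norm z)\<^sup>2 \<le> B"
  unfolding l2_le_iff norm_ell2_sq using coef_l2[of z] by (auto simp: l2_le_iff)

lemma l2_le_coef: "l2_le (coef z) ((norm z)\<^sup>2)"
  by (simp add: l2_le_coef_iff)

lemma norm_ell2_le:
  assumes "l2_le (coef z) (c\<^sup>2)" "0 \<le> c" shows "norm z \<le> c"
  using assms by (simp add: l2_le_coef_iff power2_le_iff_abs_le)

lemma norm_coef_le: "norm (coef z k) \<le> norm z"
  using l2_le_component[OF l2_le_coef, of z k] by (simp add: power2_le_iff_abs_le)

lemma bounded_linear_coef: "bounded_linear (\<lambda>z. coef z k)"
  by (rule bounded_linear_intro[where K = 1]) (auto simp: coef_simps norm_coef_le)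

instance ell2 :: complete_space
proof
  fix X :: "nat \<Rightarrow> ell2" assume X: "Cauchy X"
  have "Cauchy (\<lambda>n. coef (X n) k)" for k
    using bounded_linear.Cauchy[OF bounded_linear_coef X] .
  then have "\<exists>l. (\<lambda>n. coef (X n) k) \<longlonglongrightarrow> l" for k
    by (simp add: Cauchy_convergent_iff convergent_def)
  then obtain a where a: "\<And>k. (\<lambda>n. coef (X n) k) \<longlonglongrightarrow> a k" by metis
  have close: "\<exists>N. \<forall>n\<ge>N. l2_le (\<lambda>k. coef (X n) k - a k) (e\<^sup>2)" if "e > 0" for e
  proof -
    obtain N where N: "\<And>m n. m \<ge> N \<Longrightarrow> n \<ge> N \<Longrightarrow> norm (X m - X n) < e"
      using CauchyD[OF X \<open>e > 0\<close>] by (metis (no_types))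
    have "l2_le (\<lambda>k. coef (X n) k - a k) (e\<^sup>2)" if "n \<ge> N" for n
    proof (rule l2_leI)
      fix F :: "(int^3) set" assume F: "finite F"
      have "(\<Sum>k\<in>F. (norm (coef (X n) k - coef (X m) k))\<^sup>2) \<le> e\<^sup>2" if "m \<ge> N" for m
      proof -
        have "(norm (X n - X m))\<^sup>2 \<le> e\<^sup>2"
          using N[OF \<open>n \<ge> N\<close> \<open>m \<ge> N\<close>] by (intro power_mono) auto
        then have "l2_le (coef (X n - X m)) (e\<^sup>2)" by (simp add: l2_le_coef_iff)
        from l2_leD[OF this F] show ?thesis by (simp add: coef_simps)
      qed
      moreover have "(\<lambda>m. \<Sum>k\<in>F. (norm (coef (X n) k - coef (X m) k))\<^sup>2)
          \<longlonglongrightarrow> (\<Sum>k\<in>F. (norm (coef (X n) k - a k))\<^sup>2)"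
        by (intro tendsto_intros a)
      ultimately show "(\<Sum>k\<in>F. (norm (coef (X n) k - a k))\<^sup>2) \<le> e\<^sup>2"
        by (intro LIMSEQ_le_const2) auto
    qed
    then show ?thesis by blast
  qed
  obtain N where N: "l2_le (\<lambda>k. coef (X N) k - a k) 1"
    using close[of 1] by auto
  have "l2_le (\<lambda>k. coef (X N) k - (coef (X N) k - a k)) (2 * (norm (X N))\<^sup>2 + 2 * 1)"
    by (intro l2_le_diff l2_le_coef N)
  then have Y: "coef (Abs_ell2 a) = a"
    by (intro coef_Abs) simp
  have "X \<longlonglongrightarrow> Abs_ell2 a"
  proof (rule LIMSEQ_I)
    fix r :: real assume "r > 0"
    then obtain N where N: "\<And>n. n \<ge> N \<Longrightarrow> l2_le (\<lambda>k. coef (X n) k - a k) ((r/2)\<^sup>2)"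
      using close[of "r/2"] by auto
    have "norm (X n - Abs_ell2 a) < r" if "n \<ge> N" for n
    proof -
      have "norm (X n - Abs_ell2 a) \<le> r/2"
        by (rule norm_ell2_le) (use N[OF that] \<open>r > 0\<close> in \<open>auto simp: coef_simps Y\<close>)
      then show ?thesis using \<open>r > 0\<close> by simp
    qed
    then show "\<exists>no. \<forall>n\<ge>no. norm (X n - Abs_ell2 a) < r" by blast
  qed
  then show "convergent X" by (auto simp: convergent_def)
qed

instance ell2 :: banach ..

definition weighted :: "(int^3 \<Rightarrow> real) \<Rightarrow> ell2 \<Rightarrow> ell2" where
  "weighted w z = Abs_ell2 (\<lambda>k. w k *\<^sub>R coef z k)"

lemma coef_weighted_l2:
  assumes "l2_le (\<lambda>k. w k *\<^sub>R coef z k) B"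
  shows "coef (weighted w z) k = w k *\<^sub>R coef z k"
  unfolding weighted_def by (simp add: coef_Abs[OF assms])

lemma coef_weighted:
  assumes "\<And>k. \<bar>w k\<bar> \<le> c"
  shows "coef (weighted w z) k = w k *\<^sub>R coef z k"
  by (rule coef_weighted_l2, rule l2_le_dom[OF l2_le_coef[of z], where c = c])
     (use assms in \<open>auto intro: mult_right_mono\<close>)

lemma bounded_linear_weighted:
  assumes "\<And>k. \<bar>w k\<bar> \<le> c"
  shows "bounded_linear (weighted w)"
proof (rule bounded_linear_intro)
  have c: "0 \<le> c" using assms[of 0] by linarith
  show "norm (weighted w z) \<le> norm z * c" for z
  proof (rule norm_ell2_le)
    show "l2_le (coef (weighted w z)) ((norm z * c)\<^sup>2)"
      using l2_le_dom[OF l2_le_coef[of z], where c = c and f = "coef (weighted w z)"] assms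
      by (simp add: coef_weighted[OF assms] mult_right_mono power_mult_distrib mult.commute)
  qed (use c in auto)
qed (auto intro!: coef_eqI simp: coef_weighted[OF assms] coef_simps algebra_simps)

section \<open>Quadratic differential equations in Hilbert space\<close>

lemma has_antiderivative:
  fixes f :: "real \<Rightarrow> 'a::banach"
  assumes f: "continuous_on UNIV f"
  shows "\<exists>F. F 0 = 0 \<and> (\<forall>t. (F has_vector_derivative f t) (at t))"
proof -
  define F where "F t = (if 0 \<le> t then integral {0..t} f else - integral {t..0} f)" for t
  have int: "f integrable_on {a..b}" for a b
    by (rule integrable_continuous_real) (rule continuous_on_subset[OF f], simp)
  have eq: "F t = integral {-n..t} f - integral {-n..0} f" if "-n \<le> t" "0 \<le> n" for n t
  proof (cases "0 \<le> t")
    case True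
    then show ?thesis
      using Henstock_Kurzweil_Integration.integral_combine[OF _ True int, of "-n"] that by (simp add: F_def algebra_simps)
  next
    case False
    then show ?thesis
      using Henstock_Kurzweil_Integration.integral_combine[OF that(1) _ int, of 0] by (simp add: F_def algebra_simps)
  qed
  have "(F has_vector_derivative f t) (at t)" for t
  proof -
    define n where "n = \<bar>t\<bar> + 1"
    have t: "t \<in> {-n<..<n}" by (auto simp: n_def)
    have "((\<lambda>u. integral {-n..u} f) has_vector_derivative f t) (at t within {-n..n})"
      by (rule integral_has_vector_derivative) (use t in \<open>auto intro: continuous_on_subset[OF f]\<close>)
    then have "((\<lambda>u. integral {-n..u} f) has_vector_derivative f t) (at t within {-n<..<n})"
      by (rule has_vector_derivative_within_subset) auto
    then have "((\<lambda>u. integral {-n..u} f) has_vector_derivative f t) (at t)"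
      using t by (simp add: at_within_open[OF t])
    then have "((\<lambda>u. integral {-n..u} f - integral {-n..0} f) has_vector_derivative f t) (at t)"
      by (auto intro!: derivative_eq_intros)
    then show ?thesis
      by (rule has_vector_derivative_transform_within_open[OF _ open_greaterThanLessThan t])
         (use t in \<open>auto simp: eq[of n]\<close>)
  qed
  then show ?thesis by (intro exI[of _ F]) (auto simp: F_def)
qed

lemma has_vector_derivative_reflect:
  assumes "(F has_vector_derivative f) (at (- s))"
  shows "((\<lambda>s. F (- s)) has_vector_derivative - f) (at s)"
proof -
  have "((\<lambda>s::real. - s) has_vector_derivative - 1) (at s)"
    by (auto intro!: derivative_eq_intros)
  from vector_diff_chain_at[OF this, of F f] assms show ?thesis by (simp add: o_def)
qed

lemma norm_increment_le:
  fixes F :: "real \<Rightarrow> 'a::banach"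
  assumes F: "\<And>s. (F has_vector_derivative f s) (at s)"
    and g: "\<And>s. (g has_vector_derivative g' s) (at s)"
    and le: "\<And>s. a \<le> s \<Longrightarrow> s \<le> b \<Longrightarrow> norm (f s) \<le> g' s" and "a \<le> b"
  shows "norm (F b - F a) \<le> g b - g a"
proof (cases "a = b")
  case False
  show ?thesis
  proof (rule differentiable_bound_general)
    show "a < b" using False assms(4) by simp
    show "continuous_on {a..b} F" "continuous_on {a..b} g"
      using F g by (auto intro!: continuous_at_imp_continuous_on intro: has_vector_derivative_continuous)
  qed (use F g le in \<open>auto\<close>)
qed simp

text \<open>Negative times follow from positive ones by reflecting the path.\<close>

lemma norm_increment_exp_le:
  fixes F :: "real \<Rightarrow> 'a::banach"
  assumes F: "\<And>s. (F has_vector_derivative f s) (at s)"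
    and le: "\<And>s. norm (f s) \<le> K * exp (c * \<bar>s\<bar>)" and "c > 0" "K \<ge> 0"
  shows "norm (F t - F 0) \<le> K / c * exp (c * \<bar>t\<bar>)"
proof -
  have pos: "norm (F t - F 0) \<le> K / c * exp (c * t)"
    if F: "\<And>s. (F has_vector_derivative f s) (at s)"
    and le: "\<And>s. norm (f s) \<le> K * exp (c * \<bar>s\<bar>)" and "t \<ge> 0" for t F and f :: "real \<Rightarrow> 'a"
  proof -
    have "norm (F t - F 0) \<le> K / c * exp (c * t) - K / c * exp (c * 0)"
    proof (rule norm_increment_le[OF F])
      show "((\<lambda>s. K / c * exp (c * s)) has_vector_derivative K * exp (c * s)) (at s)" for s
        unfolding has_real_derivative_iff_has_vector_derivative[symmetric] using \<open>c > 0\<close>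
        by (auto intro!: derivative_eq_intros)
    qed (use le that in auto, metis abs_of_nonneg)
    also have "\<dots> \<le> K / c * exp (c * t)" using assms(3,4) by simp
    finally show ?thesis .
  qed
  show ?thesis
  proof (cases "t \<ge> 0")
    case True then show ?thesis using pos[OF F le True] by simp
  next
    case False
    have "((\<lambda>s. F (- s)) has_vector_derivative - f (- s)) (at s)" for s
      by (rule has_vector_derivative_reflect[OF F])
    from pos[OF this, of "- t"] le[of "- _"] False show ?thesis by simp
  qed
qed

text \<open>The Picard operator is a contraction for the weighted supremum norm
  \<open>sup e\<^sup>-\<^sup>2\<^sup>L\<^sup>|\<^sup>t\<^sup>| |z t|\<close>, so one fixed point argument gives the solution for all times.\<close>

lemma lipschitz_ode_global:
  fixes G :: "'a::banach \<Rightarrow> 'a"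
  assumes lip: "\<And>x y. norm (G x - G y) \<le> L * norm (x - y)" and L: "L > 0"
  shows "\<exists>z. z 0 = z0 \<and> (\<forall>t. (z has_vector_derivative G (z t)) (at t))"
proof -
  define c where "c = 2 * L"
  have c: "c > 0" using L by (simp add: c_def)
  have contG: "continuous_on UNIV G"
    by (rule lipschitz_on_continuous_on[of L]) (use lip L in \<open>auto simp: lipschitz_on_def dist_norm\<close>)
  \<comment> \<open>The unknown of the fixed point equation is the bounded function \<open>z t / E t\<close>.\<close>
  define E where "E t = exp (c * \<bar>t\<bar>)" for t :: real
  have E1: "E t \<ge> 1" for t using c by (simp add: E_def)
  have E0: "E t > 0" for t by (simp add: E_def)
  have contE: "continuous_on UNIV E" unfolding E_def by (intro continuous_intros)
  define rhs where "rhs y s = G (E s *\<^sub>R apply_bcontfun y s)" for y :: "real \<Rightarrow>\<^sub>C 'a" and s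
  have cy: "continuous_on UNIV (apply_bcontfun y)" for y :: "real \<Rightarrow>\<^sub>C 'a"
    by (simp add: continuous_on_apply_bcontfun)
  have cont_rhs: "continuous_on UNIV (rhs y)" for y
    unfolding rhs_def
    by (rule continuous_on_compose2[OF contG]) (auto intro!: continuous_intros cy contE)
  have "\<exists>F. F 0 = 0 \<and> (\<forall>t. (F has_vector_derivative rhs y t) (at t))" for y
    by (rule has_antiderivative[OF cont_rhs])
  then obtain P where P0: "\<And>y. P y 0 = 0"
    and P: "\<And>y t. (P y has_vector_derivative rhs y t) (at t)" by metis
  have contP: "continuous_on UNIV (P y)" for y
    using P by (auto intro!: continuous_at_imp_continuous_on intro: has_vector_derivative_continuous)
  have Gle: "norm (G x) \<le> norm (G 0) + L * norm x" for x
    using lip[of x 0] norm_triangle_sub[of "G x" "G 0"] by simp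
  have rhs_le: "norm (rhs y s) \<le> (norm (G 0) + L * norm y) * exp (c * \<bar>s\<bar>)" for y s
  proof -
    have "norm (rhs y s) \<le> norm (G 0) + L * (E s * norm (apply_bcontfun y s))"
      using Gle[of "E s *\<^sub>R apply_bcontfun y s"] E0[of s] by (simp add: rhs_def)
    also have "\<dots> \<le> norm (G 0) * E s + L * (E s * norm y)"
      using norm_bounded[of y s] E1[of s] E0[of s] L
      by (intro add_mono mult_left_mono) (auto simp: mult_le_cancel_left1)
    finally show ?thesis by (simp add: E_def algebra_simps)
  qed
  have P_le: "norm (P y t) \<le> (norm (G 0) + L * norm y) / c * E t" for y t
    using norm_increment_exp_le[OF P rhs_le c, of y t] L by (simp add: P0 E_def)
  define \<Phi> where "\<Phi> y t = (1 / E t) *\<^sub>R (z0 + P y t)" for y t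
  have \<Phi>: "\<Phi> y \<in> bcontfun" for y
  proof (rule bcontfun_normI)
    show "continuous_on UNIV (\<Phi> y)" unfolding \<Phi>_def
      using E0 by (intro continuous_intros contP contE) (metis less_irrefl)
    fix t
    have "norm (\<Phi> y t) \<le> (1 / E t) * (norm z0 + norm (P y t))"
      using E0[of t] by (simp add: \<Phi>_def divide_right_mono norm_triangle_ineq)
    also have "\<dots> \<le> (1 / E t) * (norm z0 * E t + (norm (G 0) + L * norm y) / c * E t)"
      using E1[of t] E0[of t] P_le[of y t]
      by (intro mult_left_mono add_mono) (auto simp: mult_le_cancel_left1)
    also have "\<dots> = norm z0 + (norm (G 0) + L * norm y) / c"
      using E0[of t] by (simp add: field_simps)
    finally show "norm (\<Phi> y t) \<le> norm z0 + (norm (G 0) + L * norm y) / c" .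
  qed
  have contr: "dist (Bcontfun (\<Phi> x)) (Bcontfun (\<Phi> y)) \<le> 1/2 * dist x y" for x y
  proof (rule dist_bound)
    fix t
    have D: "((\<lambda>s. P x s - P y s) has_vector_derivative (rhs x s - rhs y s)) (at s)" for s
      by (intro derivative_intros P)
    have Dle: "norm (rhs x s - rhs y s) \<le> (L * dist x y) * exp (c * \<bar>s\<bar>)" for s
    proof -
      have "norm (rhs x s - rhs y s) \<le> L * (E s * norm (apply_bcontfun x s - apply_bcontfun y s))"
        using lip[of "E s *\<^sub>R apply_bcontfun x s" "E s *\<^sub>R apply_bcontfun y s"] E0[of s]
        by (simp add: rhs_def flip: scaleR_diff_right)
      also have "\<dots> \<le> L * (E s * dist x y)"
        using dist_bounded[of x s y] E0[of s] L by (intro mult_left_mono) (auto simp: dist_norm)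
      finally show ?thesis by (simp add: E_def algebra_simps)
    qed
    have "norm (P x t - P y t) \<le> (L * dist x y) / c * E t"
      using norm_increment_exp_le[OF D Dle c, of t] L by (simp add: P0 E_def)
    also have "\<dots> = E t * (1/2 * dist x y)" using L by (simp add: c_def field_simps)
    finally have "(1 / E t) * norm (P x t - P y t) \<le> 1/2 * dist x y"
      using E0[of t] by (simp add: field_simps)
    moreover have "\<Phi> x t - \<Phi> y t = (1 / E t) *\<^sub>R (P x t - P y t)"
      by (simp add: \<Phi>_def algebra_simps)
    ultimately show "dist (apply_bcontfun (Bcontfun (\<Phi> x)) t) (apply_bcontfun (Bcontfun (\<Phi> y)) t) \<le> 1/2 * dist x y"
      using E0[of t] by (simp add: Bcontfun_inverse \<Phi> dist_norm)
  qed
  have "\<exists>!y\<in>UNIV. Bcontfun (\<Phi> y) = y"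
    by (rule Banach_fix[OF complete_UNIV UNIV_not_empty, of "1/2"]) (use contr in auto)
  then obtain y where y: "Bcontfun (\<Phi> y) = y" by auto
  define z where "z t = z0 + P y t" for t
  have "apply_bcontfun y t = (1 / E t) *\<^sub>R z t" for t
    using Bcontfun_inverse[OF \<Phi>[of y]] unfolding y by (simp add: \<Phi>_def z_def)
  then have "rhs y t = G (z t)" for t
    using E0[of t] by (simp add: rhs_def)
  moreover have "(z has_vector_derivative rhs y t) (at t)" for t
    unfolding z_def by (auto intro!: derivative_eq_intros P)
  ultimately show ?thesis
    by (intro exI[of _ z]) (auto simp: z_def P0)
qed

lemma has_real_derivative_norm_sq:
  fixes d :: "real \<Rightarrow> 'a::real_inner"
  assumes "(d has_vector_derivative d') (at t)"
  shows "((\<lambda>s. (norm (d s))\<^sup>2) has_real_derivative 2 * (d t \<bullet> d')) (at t)"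
proof -
  have "((\<lambda>s. d s \<bullet> d s) has_derivative (\<lambda>h. d t \<bullet> (h *\<^sub>R d') + (h *\<^sub>R d') \<bullet> d t)) (at t)"
    by (rule has_derivative_inner) (use assms in \<open>auto simp: has_vector_derivative_def\<close>)
  then show ?thesis
    unfolding has_field_derivative_def power2_norm_eq_inner
    by (rule has_derivative_eq_rhs) (auto simp: inner_commute algebra_simps)
qed

text \<open>Forward in time \<open>|z - y|\<^sup>2 e\<^sup>-\<^sup>2\<^sup>L\<^sup>t\<close> is nonincreasing and starts at zero; backward in time the
same argument applies to the reflected paths.\<close>

lemma lipschitz_ode_unique:
  fixes z y :: "real \<Rightarrow> 'a::real_inner"
  assumes z: "\<And>t. (z has_vector_derivative G (z t)) (at t)"
    and y: "\<And>t. (y has_vector_derivative G (y t)) (at t)"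
    and lip: "\<And>t. norm (G (z t) - G (y t)) \<le> L * norm (z t - y t)"
    and 0: "z 0 = y 0"
  shows "z t = y t"
proof -
  have forward: "d t = 0"
    if d: "\<And>t. (d has_vector_derivative d' t) (at t)"
      and le: "\<And>t. norm (d' t) \<le> L * norm (d t)" and "d 0 = 0" "t \<ge> 0"
    for d d' :: "real \<Rightarrow> 'a" and t
  proof -
    define g where "g s = (norm (d s))\<^sup>2 * exp (- 2 * L * s)" for s
    have "g t \<le> g 0"
    proof (rule DERIV_nonpos_imp_nonincreasing[OF \<open>t \<ge> 0\<close>])
      fix s
      have D: "(g has_real_derivative
          (2 * (d s \<bullet> d' s) * exp (- 2 * L * s) + (norm (d s))\<^sup>2 * (exp (- 2 * L * s) * (- 2 * L)))) (at s)"
        unfolding g_def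
        by (rule derivative_eq_intros has_real_derivative_norm_sq[OF d] refl | simp)+
      have "d s \<bullet> d' s \<le> norm (d s) * norm (d' s)" by (rule norm_cauchy_schwarz)
      also have "\<dots> \<le> norm (d s) * (L * norm (d s))" using le by (intro mult_left_mono) auto
      finally have "d s \<bullet> d' s - L * (norm (d s))\<^sup>2 \<le> 0" by (simp add: power2_eq_square algebra_simps)
      then have "2 * exp (- 2 * L * s) * (d s \<bullet> d' s - L * (norm (d s))\<^sup>2) \<le> 0"
        by (intro mult_nonneg_nonpos) auto
      then show "\<exists>y. (g has_real_derivative y) (at s) \<and> y \<le> 0"
        using D by (intro exI conjI) (auto simp: algebra_simps)
    qed
    then have "(norm (d t))\<^sup>2 * exp (- 2 * L * t) \<le> 0" using \<open>d 0 = 0\<close> by (simp add: g_def)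
    then show "d t = 0" by (simp add: mult_le_0_iff)
  qed
  define d where "d t = z t - y t" for t
  have d: "(d has_vector_derivative (G (z t) - G (y t))) (at t)" for t
    unfolding d_def by (intro derivative_intros z y)
  have "d t = 0"
  proof (cases "t \<ge> 0")
    case True
    then show ?thesis using forward[OF d, of t] lip 0 by (auto simp: d_def)
  next
    case False
    have "((\<lambda>s. d (- s)) has_vector_derivative - (G (z (- s)) - G (y (- s)))) (at s)" for s
      by (rule has_vector_derivative_reflect[OF d])
    from forward[OF this, of "- t"] lip 0 False show ?thesis by (auto simp: d_def norm_minus_commute)
  qed
  then show ?thesis by (simp add: d_def)
qed

definition ball_retract :: "real \<Rightarrow> 'a::real_normed_vector \<Rightarrow> 'a" where
  "ball_retract r z = (if norm z \<le> r then z else (r / norm z) *\<^sub>R z)"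

lemma norm_ball_retract: "0 \<le> r \<Longrightarrow> norm (ball_retract r z) \<le> r"
  by (auto simp: ball_retract_def)

text \<open>For \<open>|y| \<le> |z|\<close>, replacing the scaling factor of \<open>y\<close> by that of \<open>z\<close> costs at most
\<open>|z| - |y|\<close>; this second contribution makes the constant 2.\<close>

lemma ball_retract_lipschitz:
  assumes r: "0 \<le> r"
  shows "norm (ball_retract r z - ball_retract r y) \<le> 2 * norm (z - y)"
proof -
  have *: "norm (ball_retract r z - ball_retract r y) \<le> 2 * norm (z - y)" if le: "norm y \<le> norm z" for z y :: 'a
  proof (cases "norm z \<le> r")
    case True
    then show ?thesis using le by (simp add: ball_retract_def)
  next
    case False
    define c where "c = r / norm z"
    have c: "0 \<le> c" "c \<le> 1" using False r by (auto simp: c_def divide_le_eq_1)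
    define d where "d = (if norm y \<le> r then 1 else r / norm y)"
    have dy: "ball_retract r y = d *\<^sub>R y" by (simp add: ball_retract_def d_def)
    have nz: "norm z > 0" using False r by linarith
    have "\<bar>c - d\<bar> * norm y \<le> norm z - norm y"
    proof (cases "norm y \<le> r")
      case True
      have "\<bar>c - d\<bar> * norm y = (1 - c) * norm y" using c True by (simp add: d_def)
      also have "\<dots> \<le> (1 - c) * r" using c True by (intro mult_left_mono) auto
      also have "\<dots> = (norm z - r) * (r / norm z)" using nz by (simp add: c_def field_simps)
      also have "\<dots> \<le> (norm z - r) * 1" using False c by (intro mult_left_mono) (auto simp: c_def)
      finally show ?thesis using True by simp
    next
      case F: False
      then have ny: "norm y > 0" using r by linarith
      have "c \<le> d" unfolding c_def d_def using F le ny r by (auto intro!: divide_left_mono mult_pos_pos)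
      then have "\<bar>c - d\<bar> * norm y = (d - c) * norm y" by simp
      also have "\<dots> = (r / norm z) * (norm z - norm y)" using F nz ny by (simp add: c_def d_def field_simps)
      also have "\<dots> \<le> 1 * (norm z - norm y)" using c le by (intro mult_right_mono) (auto simp: c_def)
      finally show ?thesis by simp
    qed
    also have "\<dots> \<le> norm (z - y)" by (rule norm_triangle_ineq2)
    finally have 1: "\<bar>c - d\<bar> * norm y \<le> norm (z - y)" .
    have "ball_retract r z - ball_retract r y = c *\<^sub>R (z - y) + (c - d) *\<^sub>R y"
      using False dy by (simp add: ball_retract_def c_def algebra_simps)
    then have "norm (ball_retract r z - ball_retract r y) \<le> c * norm (z - y) + \<bar>c - d\<bar> * norm y"
      using norm_triangle_ineq[of "c *\<^sub>R (z - y)" "(c - d) *\<^sub>R y"] c by simp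
    also have "\<dots> \<le> 1 * norm (z - y) + norm (z - y)"
      using c 1 by (intro add_mono mult_right_mono) auto
    finally show ?thesis by simp
  qed
  show ?thesis
    using *[of y z] *[of z y] by (cases "norm y \<le> norm z") (auto simp: norm_minus_commute)
qed

lemma bounded_bilinear_quadratic_lipschitz:
  assumes "bounded_bilinear B"
  shows "\<exists>K\<ge>0. \<forall>p q. norm (B p p - B q q) \<le> K * (norm p + norm q) * norm (p - q)"
proof -
  interpret bounded_bilinear B by fact
  obtain K where K: "K \<ge> 0" "\<And>a b. norm (B a b) \<le> norm a * norm b * K"
    using nonneg_bounded by blast
  have "norm (B p p - B q q) \<le> K * (norm p + norm q) * norm (p - q)" for p q
  proof -
    have "B p p - B q q = B p (p - q) + B (p - q) q" by (simp add: diff_left diff_right)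
    then have "norm (B p p - B q q) \<le> norm p * norm (p - q) * K + norm (p - q) * norm q * K"
      using norm_triangle_le add_mono[OF K(2) K(2)] by metis
    then show ?thesis by (simp add: algebra_simps)
  qed
  then show ?thesis using K by blast
qed

lemma orthogonal_ode_norm_const:
  fixes z :: "real \<Rightarrow> 'a::real_inner"
  assumes "\<And>t. (z has_vector_derivative z' t) (at t)" "\<And>t. z t \<bullet> z' t = 0"
  shows "norm (z t) = norm (z 0)"
proof -
  have "((\<lambda>s. (norm (z s))\<^sup>2) has_real_derivative 0) (at s)" for s
    using has_real_derivative_norm_sq[OF assms(1), of s] assms(2) by simp
  then have "(norm (z t))\<^sup>2 = (norm (z 0))\<^sup>2"
    using DERIV_isconst_all[of "\<lambda>s. (norm (z s))\<^sup>2" t 0] by auto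
  then show ?thesis by simp
qed

text \<open>A quadratic vector field is only locally Lipschitz. Composed with the retraction onto the ball
of radius \<open>|z0|\<close> it becomes globally Lipschitz and stays orthogonal to the state, so the solution of the modified
equation remains on the sphere, where the retraction is the identity.\<close>

lemma quadratic_ode_global:
  fixes B :: "'a::{real_inner,banach} \<Rightarrow> 'a \<Rightarrow> 'a"
  assumes B: "bounded_bilinear B" and orth: "\<And>z. B z z \<bullet> z = 0"
  shows "\<exists>z. z 0 = z0 \<and> (\<forall>t. (z has_vector_derivative B (z t) (z t)) (at t))"
proof -
  interpret bounded_bilinear B by fact
  define r where "r = norm z0"
  have r: "0 \<le> r" by (simp add: r_def)
  let ?\<pi> = "ball_retract r :: 'a \<Rightarrow> 'a"
  obtain K where K: "K \<ge> 0" "\<And>p q. norm (B p p - B q q) \<le> K * (norm p + norm q) * norm (p - q)"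
    using bounded_bilinear_quadratic_lipschitz[OF B] by blast
  have lip: "norm (B (?\<pi> x) (?\<pi> x) - B (?\<pi> y) (?\<pi> y)) \<le> (K * (r + r) * 2 + 1) * norm (x - y)" for x y
  proof -
    have "norm (B (?\<pi> x) (?\<pi> x) - B (?\<pi> y) (?\<pi> y)) \<le> K * (norm (?\<pi> x) + norm (?\<pi> y)) * norm (?\<pi> x - ?\<pi> y)"
      by (rule K)
    also have "\<dots> \<le> K * (r + r) * (2 * norm (x - y))"
      using K(1) r by (intro mult_mono mult_left_mono add_mono norm_ball_retract ball_retract_lipschitz) auto
    also have "\<dots> \<le> (K * (r + r) * 2 + 1) * norm (x - y)" by (simp add: distrib_right)
    finally show ?thesis .
  qed
  have "K * (r + r) * 2 + 1 > 0" using K(1) r by (simp add: add_nonneg_pos)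
  then obtain z where z0: "z 0 = z0" and z: "\<And>t. (z has_vector_derivative B (?\<pi> (z t)) (?\<pi> (z t))) (at t)"
    using lipschitz_ode_global[of "\<lambda>x. B (?\<pi> x) (?\<pi> x)", OF lip] by blast
  have "B (?\<pi> x) (?\<pi> x) \<bullet> x = 0" for x
    using orth[of x] by (auto simp: ball_retract_def scaleR_left scaleR_right)
  then have "norm (z t) = r" for t
    using orthogonal_ode_norm_const[OF z, of t] by (simp add: z0 r_def inner_commute)
  then have "?\<pi> (z t) = z t" for t by (simp add: ball_retract_def)
  then show ?thesis using z z0 by auto
qed

lemma quadratic_ode_unique:
  fixes B :: "'a::{real_inner,banach} \<Rightarrow> 'a \<Rightarrow> 'a"
  assumes B: "bounded_bilinear B" and orth: "\<And>z. B z z \<bullet> z = 0"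
    and z: "\<And>t. (z has_vector_derivative B (z t) (z t)) (at t)"
    and y: "\<And>t. (y has_vector_derivative B (y t) (y t)) (at t)" and 0: "z 0 = y 0"
  shows "z t = y t"
proof -
  obtain K where K: "K \<ge> 0" "\<And>p q. norm (B p p - B q q) \<le> K * (norm p + norm q) * norm (p - q)"
    using bounded_bilinear_quadratic_lipschitz[OF B] by blast
  have n: "norm (z t) = norm (z 0)" "norm (y t) = norm (z 0)" for t
    using orthogonal_ode_norm_const[OF z, of t] orthogonal_ode_norm_const[OF y, of t] orth 0
    by (auto simp: inner_commute)
  show ?thesis
    by (rule lipschitz_ode_unique[OF z y _ 0, where L = "K * (norm (z 0) + norm (z 0))"])
       (metis K(2) n)
qed

section \<open>Lattice sums and convolutions\<close>

definition freq :: "int^3 \<Rightarrow> real^3" where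
  "freq k = (\<chi> i. real_of_int (k $ i))"

text \<open>The Japanese bracket of a frequency: the Fourier weight of one derivative, bounded below by 1.\<close>

definition bracket :: "int^3 \<Rightarrow> real" where
  "bracket k = sqrt (1 + (norm (freq k))\<^sup>2)"

lemma freq_simps [simp]: "freq (j + k) = freq j + freq k" "freq (- k) = - freq k" "freq 0 = 0"
    "freq (j - k) = freq j - freq k"
  by (auto simp: freq_def vec_eq_iff)

lemma freq_nth [simp]: "freq k $ i = real_of_int (k $ i)"
  by (simp add: freq_def)

lemma freq_eq_0_iff [simp]: "freq k = 0 \<longleftrightarrow> k = 0"
  by (auto simp: vec_eq_iff)

lemma bracket_sq: "(bracket k)\<^sup>2 = 1 + (norm (freq k))\<^sup>2"
  by (simp add: bracket_def)

lemma bracket_ge1: "1 \<le> bracket k" by (simp add: bracket_def)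

lemma bracket_pos: "0 < bracket k" using bracket_ge1[of k] by linarith

lemma bracket_minus [simp]: "bracket (- k) = bracket k" by (simp add: bracket_def)

lemma norm_freq_le_bracket: "norm (freq k) \<le> bracket k"
  unfolding bracket_def by (rule real_le_rsqrt) simp

definition lattice_box :: "nat \<Rightarrow> (int^3) set" where
  "lattice_box n = {k. \<forall>i. \<bar>k $ i\<bar> \<le> int n}"

lemma lattice_box_image: "lattice_box n = vec_lambda ` (PiE UNIV (\<lambda>_. {- int n..int n}))"
proof safe
  fix k :: "int^3" assume "k \<in> lattice_box n"
  then have "vec_nth k \<in> PiE UNIV (\<lambda>_. {- int n..int n})" by (auto simp: lattice_box_def abs_le_iff minus_le_iff)
  then show "k \<in> vec_lambda ` (PiE UNIV (\<lambda>_. {- int n..int n}))"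
    by (metis image_eqI vec_nth_inverse)
qed (auto simp: lattice_box_def abs_le_iff minus_le_iff PiE_iff)

lemma finite_lattice_box [simp]: "finite (lattice_box n)"
  by (simp add: lattice_box_image finite_PiE)

lemma card_lattice_box: "card (lattice_box n) = (2 * n + 1) ^ 3"
proof -
  have "inj_on vec_lambda (PiE (UNIV::3 set) (\<lambda>_. {- int n..int n}))"
    by (auto simp: inj_on_def vec_lambda_inject)
  then show ?thesis by (simp add: lattice_box_image card_image card_PiE prod_constant nat_add_distrib nat_mult_distrib)
qed

lemma lattice_box_mono: "m \<le> n \<Longrightarrow> lattice_box m \<subseteq> lattice_box n"
  unfolding lattice_box_def by (auto intro: order_trans)

lemma finite_subset_lattice_box:
  assumes "finite F" shows "\<exists>n. F \<subseteq> lattice_box n"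
  using assms
proof (induction F)
  case (insert k F)
  then obtain n where "F \<subseteq> lattice_box n" by blast
  moreover have "k \<in> lattice_box (nat (\<Sum>i\<in>UNIV. \<bar>k $ i\<bar>))"
    by (auto simp: lattice_box_def sum_nonneg intro!: member_le_sum)
  ultimately have "insert k F \<subseteq> lattice_box (max n (nat (\<Sum>i\<in>UNIV. \<bar>k $ i\<bar>)))"
    using lattice_box_mono[of _ "max n (nat (\<Sum>i\<in>UNIV. \<bar>k $ i\<bar>))"] by (meson insert_subset max.cobounded1 max.cobounded2 subsetD subset_trans)
  then show ?case by blast
qed auto

text \<open>The factor \<open>(1 + |k|\<^sup>2)\<^sup>-\<^sup>1\<close> is the inverse weight of \<open>H\<^sup>1\<close>; it is not summable over
the lattice in dimension three, and the second factor cuts it off at frequency \<open>R\<close>.\<close>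

definition lattice_kernel :: "real \<Rightarrow> int^3 \<Rightarrow> real" where
  "lattice_kernel R k = 1 / ((1 + (norm (freq k))\<^sup>2) * (1 + (norm (freq k))\<^sup>2 / R\<^sup>2))"

lemma lattice_kernel_nonneg: "0 \<le> lattice_kernel R k"
  by (simp add: lattice_kernel_def)

text \<open>One term in the comparison of a sum with the integral of the decreasing function \<open>R\<^sup>2 / (R\<^sup>2 + x\<^sup>2)\<close>.\<close>

lemma arctan_increment:
  fixes R :: real and n :: nat
  assumes "R > 0"
  shows "R\<^sup>2 / (R\<^sup>2 + (real n + 1)\<^sup>2) \<le> R * arctan ((real n + 1) / R) - R * arctan (real n / R)"
proof -
  have D: "((\<lambda>x. R * arctan (x / R)) has_real_derivative R\<^sup>2 / (R\<^sup>2 + x\<^sup>2)) (at x)" for x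
    using assms by (auto intro!: derivative_eq_intros simp: field_simps power2_eq_square)
  obtain z where z: "real n < z" "z < real n + 1"
    and eq: "R * arctan ((real n + 1) / R) - R * arctan (real n / R) = (real n + 1 - real n) * (R\<^sup>2 / (R\<^sup>2 + z\<^sup>2))"
    using MVT2[of "real n" "real n + 1" "\<lambda>x. R * arctan (x / R)" "\<lambda>x. R\<^sup>2 / (R\<^sup>2 + x\<^sup>2)"] D by auto
  have "R\<^sup>2 / (R\<^sup>2 + (real n + 1)\<^sup>2) \<le> R\<^sup>2 / (R\<^sup>2 + z\<^sup>2)"
    using z assms by (intro divide_left_mono add_left_mono power_mono mult_pos_pos add_pos_nonneg; auto)
  then show ?thesis using eq by simp
qed

lemma shell_lattice_kernel_le:
  assumes "k \<in> lattice_box (Suc n) - lattice_box n" "R > 0"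
  shows "lattice_kernel R k \<le> 1 / ((real n + 1)\<^sup>2 * (1 + (real n + 1)\<^sup>2 / R\<^sup>2))"
proof -
  obtain i where "\<not> \<bar>k $ i\<bar> \<le> int n" using assms by (auto simp: lattice_box_def)
  then have "real n + 1 \<le> \<bar>freq k $ i\<bar>" by simp
  also have "\<dots> \<le> norm (freq k)" by (rule component_le_norm_cart)
  finally have *: "(real n + 1)\<^sup>2 \<le> (norm (freq k))\<^sup>2" by (intro power_mono) auto
  then have "(real n + 1)\<^sup>2 \<le> 1 + (norm (freq k))\<^sup>2" by linarith
  with * show ?thesis
    unfolding lattice_kernel_def using assms(2)
    by (intro divide_left_mono mult_mono add_mono divide_right_mono mult_pos_pos; (assumption | auto intro!: add_pos_nonneg))
qed

text \<open>Each shell of sup-norm \<open>n\<close> has \<open>24 n\<^sup>2 + 2 \<le> 26 n\<^sup>2\<close> lattice points, which cancels the decay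
\<open>n\<^sup>-\<^sup>2\<close> of the first factor of the kernel and leaves a one-dimensional sum.\<close>

lemma sum_lattice_kernel_lattice_box:
  assumes "R > 0"
  shows "(\<Sum>k\<in>lattice_box n. lattice_kernel R k) \<le> 1 + 26 * R * arctan (real n / R)"
proof (induction n)
  case 0
  have "lattice_box 0 = {0}" by (auto simp: lattice_box_def vec_eq_iff)
  then show ?case by (simp add: lattice_kernel_def)
next
  case (Suc n)
  define x where "x = real n + 1"
  have x: "x \<ge> 1" by (simp add: x_def)
  have sub: "lattice_box n \<subseteq> lattice_box (Suc n)" by (rule lattice_box_mono) simp
  have "real (card (lattice_box (Suc n) - lattice_box n)) = real ((2 * Suc n + 1) ^ 3) - real ((2 * n + 1) ^ 3)"
    using card_mono[OF finite_lattice_box sub] by (simp add: card_Diff_subset[OF finite_lattice_box sub] card_lattice_box of_nat_diff)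
  also have "\<dots> = 24 * x\<^sup>2 + 2" by (simp add: x_def power2_eq_square power3_eq_cube algebra_simps)
  also have "\<dots> \<le> 26 * x\<^sup>2" using x by simp
  finally have card: "real (card (lattice_box (Suc n) - lattice_box n)) \<le> 26 * x\<^sup>2" .
  have "(\<Sum>k\<in>lattice_box (Suc n). lattice_kernel R k) = (\<Sum>k\<in>lattice_box (Suc n) - lattice_box n. lattice_kernel R k) + (\<Sum>k\<in>lattice_box n. lattice_kernel R k)"
    by (rule sum.subset_diff[OF sub finite_lattice_box])
  also have "(\<Sum>k\<in>lattice_box (Suc n) - lattice_box n. lattice_kernel R k) \<le> real (card (lattice_box (Suc n) - lattice_box n)) * (1 / (x\<^sup>2 * (1 + x\<^sup>2 / R\<^sup>2)))"
    unfolding x_def by (rule sum_bounded_above) (rule shell_lattice_kernel_le[OF _ assms])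
  also have "\<dots> \<le> (26 * x\<^sup>2) * (1 / (x\<^sup>2 * (1 + x\<^sup>2 / R\<^sup>2)))"
    by (rule mult_right_mono[OF card]) simp
  also have "\<dots> = 26 * (1 / (1 + x\<^sup>2 / R\<^sup>2))"
    using x by simp
  also have "1 / (1 + x\<^sup>2 / R\<^sup>2) = R\<^sup>2 / (R\<^sup>2 + x\<^sup>2)"
    using assms by (simp add: field_simps)
  also have "\<dots> \<le> R * arctan (x / R) - R * arctan (real n / R)"
    unfolding x_def by (rule arctan_increment[OF assms])
  finally show ?case using Suc by (simp add: x_def algebra_simps)
qed

lemma sum_lattice_kernel_le:
  assumes "R \<ge> 1" "finite F"
  shows "(\<Sum>k\<in>F. lattice_kernel R k) \<le> 53 * R"
proof -
  obtain n where n: "F \<subseteq> lattice_box n" using finite_subset_lattice_box[OF assms(2)] by blast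
  have "arctan (real n / R) \<le> 2" using arctan_ubound[of "real n / R"] pi_less_4 by linarith
  then have "R * arctan (real n / R) \<le> R * 2" using assms by (intro mult_left_mono) auto
  moreover have "(\<Sum>k\<in>F. lattice_kernel R k) \<le> (\<Sum>k\<in>lattice_box n. lattice_kernel R k)"
    by (rule sum_mono2) (use n in \<open>auto simp: lattice_kernel_nonneg\<close>)
  ultimately show ?thesis using sum_lattice_kernel_lattice_box[of R n] assms by linarith
qed

text \<open>If \<open>|j| \<le> |j + k|\<close> the summand is at most the kernel at \<open>j\<close>, otherwise it is at most the
kernel at \<open>j + k\<close>.\<close>

lemma sum_two_center_kernel_le:
  assumes "R \<ge> 1" "finite J"
  shows "(\<Sum>j\<in>J. 1 / ((1 + (norm (freq j))\<^sup>2 / R\<^sup>2) * (bracket (j + k))\<^sup>2)) \<le> 106 * R"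
proof -
  have le: "1 / ((1 + (norm (freq j))\<^sup>2 / R\<^sup>2) * (bracket (j + k))\<^sup>2) \<le> lattice_kernel R j + lattice_kernel R (j + k)" for j
  proof -
    define a where "a = (norm (freq j))\<^sup>2"
    define b where "b = (norm (freq (j + k)))\<^sup>2"
    have ab: "0 \<le> a" "0 \<le> b" by (auto simp: a_def b_def)
    have "1 / ((1 + a / R\<^sup>2) * (1 + b)) \<le> 1 / ((1 + a) * (1 + a / R\<^sup>2)) + 1 / ((1 + b) * (1 + b / R\<^sup>2))"
    proof (cases "a \<le> b")
      case True
      have "1 / ((1 + a / R\<^sup>2) * (1 + b)) \<le> 1 / ((1 + a) * (1 + a / R\<^sup>2))"
        unfolding mult.commute[of "1 + a"]
        using True ab assms(1) by (intro divide_left_mono mult_left_mono mult_pos_pos add_pos_nonneg) auto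
      then show ?thesis using ab by (simp add: add_increasing2)
    next
      case False
      have "1 / ((1 + a / R\<^sup>2) * (1 + b)) \<le> 1 / ((1 + b) * (1 + b / R\<^sup>2))"
        unfolding mult.commute[of _ "1 + b"]
        using False ab assms(1) by (intro divide_left_mono mult_left_mono mult_pos_pos add_pos_nonneg add_left_mono divide_right_mono) auto
      then show ?thesis using ab by (simp add: add_increasing)
    qed
    then show ?thesis by (simp add: lattice_kernel_def bracket_sq a_def b_def)
  qed
  have "(\<Sum>j\<in>J. 1 / ((1 + (norm (freq j))\<^sup>2 / R\<^sup>2) * (bracket (j + k))\<^sup>2))
      \<le> (\<Sum>j\<in>J. lattice_kernel R j) + (\<Sum>j\<in>J. lattice_kernel R (j + k))"
    unfolding sum.distrib[symmetric] by (rule sum_mono) (rule le)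
  also have "(\<Sum>j\<in>J. lattice_kernel R (j + k)) = (\<Sum>j\<in>(\<lambda>j. j + k) ` J. lattice_kernel R j)"
    by (subst sum.reindex) (auto simp: inj_on_def)
  finally show ?thesis
    using sum_lattice_kernel_le[OF assms] sum_lattice_kernel_le[OF assms(1) finite_imageI[OF assms(2)], of "\<lambda>j. j + k"] by linarith
qed

text \<open>A convolution of moduli, written as a correlation: up to reflections of frequencies this is every term in
the coefficients of a product of two real functions.\<close>

definition conv :: "(int^3 \<Rightarrow> 'a::real_normed_vector) \<Rightarrow> (int^3 \<Rightarrow> 'b::real_normed_vector) \<Rightarrow> int^3 \<Rightarrow> real" where
  "conv p q k = (\<Sum>\<^sub>\<infinity>j. norm (p j) * norm (q (j + k)))"

text \<open>Cauchy-Schwarz with the weights \<open>1 + |j|\<^sup>2/R\<^sup>2\<close> on \<open>p\<close> and \<open>1 + |j + k|\<^sup>2\<close> on \<open>q\<close>. The value \<open>R = 1\<close> says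
that products of \<open>H\<^sup>1\<close> functions are in \<open>L\<^sup>2\<close>; a value of \<open>R\<close> near the quotient of the \<open>H\<^sup>1\<close> and
\<open>L\<^sup>2\<close> norms of \<open>p\<close> gives their geometric mean, as an embedding of \<open>H\<^sup>1\<^sup>/\<^sup>2\<close> into \<open>L\<^sup>3\<close> would.\<close>

lemma conv_finite_bound:
  fixes p :: "int^3 \<Rightarrow> 'a::real_normed_vector" and q :: "int^3 \<Rightarrow> 'b::real_normed_vector"
  assumes P0: "l2_le p P0" and P1: "l2_le (\<lambda>j. bracket j *\<^sub>R p j) P1"
    and Q: "l2_le (\<lambda>j. bracket j *\<^sub>R q j) Q" and R: "R \<ge> 1" and J: "finite J" and F: "finite F"
  shows "(\<Sum>k\<in>F. (\<Sum>j\<in>J. norm (p j) * norm (q (j + k)))\<^sup>2) \<le> 106 * R * ((P0 + P1 / R\<^sup>2) * Q)"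
proof -
  define A where "A j = sqrt (1 + (norm (freq j))\<^sup>2 / R\<^sup>2)" for j
  have A2: "(A j)\<^sup>2 = 1 + (norm (freq j))\<^sup>2 / R\<^sup>2" for j by (simp add: A_def)
  have Apos: "A j > 0" for j by (simp add: A_def add_pos_nonneg)
  define T where "T j k = (A j * norm (p j))\<^sup>2 * (bracket (j + k) * norm (q (j + k)))\<^sup>2" for j k
  have "(\<Sum>j\<in>J. norm (p j) * norm (q (j + k)))\<^sup>2 \<le> 106 * R * (\<Sum>j\<in>J. T j k)" for k
  proof -
    have "(\<Sum>j\<in>J. norm (p j) * norm (q (j + k))) =
        (\<Sum>j\<in>J. (A j * norm (p j) * (bracket (j + k) * norm (q (j + k)))) * (1 / (A j * bracket (j + k))))"
      by (rule sum.cong) (use Apos bracket_pos in \<open>auto simp: field_simps less_imp_neq[symmetric]\<close>)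
    also have "\<dots>\<^sup>2 \<le> (\<Sum>j\<in>J. (A j * norm (p j) * (bracket (j + k) * norm (q (j + k))))\<^sup>2) * (\<Sum>j\<in>J. (1 / (A j * bracket (j + k)))\<^sup>2)"
      by (rule Cauchy_Schwarz_ineq_sum)
    also have "(\<Sum>j\<in>J. (A j * norm (p j) * (bracket (j + k) * norm (q (j + k))))\<^sup>2) = (\<Sum>j\<in>J. T j k)"
      by (simp add: T_def power_mult_distrib)
    also have "(\<Sum>j\<in>J. (1 / (A j * bracket (j + k)))\<^sup>2) = (\<Sum>j\<in>J. 1 / ((1 + (norm (freq j))\<^sup>2 / R\<^sup>2) * (bracket (j + k))\<^sup>2))"
      by (simp add: power_divide power_mult_distrib A2)
    also have "(\<Sum>j\<in>J. T j k) * \<dots> \<le> (\<Sum>j\<in>J. T j k) * (106 * R)"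
      by (rule mult_left_mono[OF sum_two_center_kernel_le[OF R J]]) (simp add: T_def sum_nonneg)
    finally show ?thesis by (simp add: mult.commute)
  qed
  then have "(\<Sum>k\<in>F. (\<Sum>j\<in>J. norm (p j) * norm (q (j + k)))\<^sup>2) \<le> (\<Sum>k\<in>F. 106 * R * (\<Sum>j\<in>J. T j k))"
    by (rule sum_mono)
  also have "\<dots> = 106 * R * (\<Sum>j\<in>J. (A j * norm (p j))\<^sup>2 * (\<Sum>k\<in>F. (bracket (j + k) * norm (q (j + k)))\<^sup>2))"
    unfolding sum_distrib_left[symmetric] T_def by (subst sum.swap) (simp add: sum_distrib_left)
  also have "\<dots> \<le> 106 * R * (\<Sum>j\<in>J. (A j * norm (p j))\<^sup>2 * Q)"
  proof (intro mult_left_mono sum_mono)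
    fix j
    have "(\<Sum>k\<in>F. (norm (bracket (j + k) *\<^sub>R q (j + k)))\<^sup>2) \<le> Q"
      by (rule l2_leD[OF l2_le_reindex[OF Q, of "\<lambda>k. j + k"] F]) (auto simp: inj_def)
    then show "(\<Sum>k\<in>F. (bracket (j + k) * norm (q (j + k)))\<^sup>2) \<le> Q"
      using bracket_pos by (simp add: power_mult_distrib)
  qed (use R in auto)
  also have "\<dots> = 106 * R * ((\<Sum>j\<in>J. (A j * norm (p j))\<^sup>2) * Q)"
    by (simp add: sum_distrib_right)
  also have "(\<Sum>j\<in>J. (A j * norm (p j))\<^sup>2) \<le> (\<Sum>j\<in>J. (norm (p j))\<^sup>2 + (norm (bracket j *\<^sub>R p j))\<^sup>2 / R\<^sup>2)"
    by (intro sum_mono) (use R in \<open>auto simp: power_mult_distrib A2 bracket_sq algebra_simps add_divide_distrib\<close>)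
  also have "\<dots> = (\<Sum>j\<in>J. (norm (p j))\<^sup>2) + (\<Sum>j\<in>J. (norm (bracket j *\<^sub>R p j))\<^sup>2) / R\<^sup>2"
    by (simp add: sum.distrib sum_divide_distrib)
  also have "\<dots> \<le> P0 + P1 / R\<^sup>2"
    by (intro add_mono divide_right_mono l2_leD[OF P0 J] l2_leD[OF P1 J]) auto
  finally show ?thesis using R l2_le_nonneg[OF Q] by (simp add: mult_left_mono mult_right_mono)
qed

lemma bracket_l2_le: "l2_le (\<lambda>j. bracket j *\<^sub>R p j) P \<Longrightarrow> l2_le p P"
  by (erule l2_le_dom1) (use bracket_ge1 in \<open>auto simp: mult_le_cancel_right1 intro: order_trans[OF _ abs_ge_self]\<close>)

lemma conv_summable:
  fixes p :: "int^3 \<Rightarrow> 'a::real_normed_vector" and q :: "int^3 \<Rightarrow> 'b::real_normed_vector"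
  assumes P: "l2_le (\<lambda>j. bracket j *\<^sub>R p j) P" and Q: "l2_le (\<lambda>j. bracket j *\<^sub>R q j) Q"
  shows "(\<lambda>j. norm (p j) * norm (q (j + k))) summable_on UNIV"
proof (rule nonneg_bdd_above_summable_on)
  show "bdd_above (sum (\<lambda>j. norm (p j) * norm (q (j + k))) ` {F. F \<subseteq> UNIV \<and> finite F})"
  proof (rule bdd_aboveI2)
    fix J :: "(int^3) set" assume "J \<in> {F. F \<subseteq> UNIV \<and> finite F}"
    then have "(\<Sum>j\<in>J. norm (p j) * norm (q (j + k)))\<^sup>2 \<le> 106 * 1 * ((P + P / 1\<^sup>2) * Q)"
      using conv_finite_bound[OF bracket_l2_le[OF P] P Q, of 1 J "{k}"] by simp
    then show "(\<Sum>j\<in>J. norm (p j) * norm (q (j + k))) \<le> sqrt (106 * 1 * ((P + P / 1\<^sup>2) * Q))"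
      by (rule real_le_rsqrt)
  qed
qed auto

lemma l2_le_conv:
  fixes p :: "int^3 \<Rightarrow> 'a::real_normed_vector" and q :: "int^3 \<Rightarrow> 'b::real_normed_vector"
  assumes P0: "l2_le p P0" and P1: "l2_le (\<lambda>j. bracket j *\<^sub>R p j) P1"
    and Q: "l2_le (\<lambda>j. bracket j *\<^sub>R q j) Q" and R: "R \<ge> 1"
  shows "l2_le (conv p q) (106 * R * ((P0 + P1 / R\<^sup>2) * Q))"
proof (rule l2_leI)
  fix F :: "(int^3) set" assume F: "finite F"
  have "((\<lambda>J. \<Sum>k\<in>F. (\<Sum>j\<in>J. norm (p j) * norm (q (j + k)))\<^sup>2) \<longlongrightarrow> (\<Sum>k\<in>F. (conv p q k)\<^sup>2)) (finite_subsets_at_top UNIV)"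
    unfolding conv_def by (intro tendsto_intros infsum_tendsto conv_summable[OF P1 Q])
  moreover have "\<forall>\<^sub>F J in finite_subsets_at_top UNIV. (\<Sum>k\<in>F. (\<Sum>j\<in>J. norm (p j) * norm (q (j + k)))\<^sup>2) \<le> 106 * R * ((P0 + P1 / R\<^sup>2) * Q)"
    using conv_finite_bound[OF P0 P1 Q R _ F] by (intro eventually_finite_subsets_at_top_weakI) auto
  ultimately have "(\<Sum>k\<in>F. (conv p q k)\<^sup>2) \<le> 106 * R * ((P0 + P1 / R\<^sup>2) * Q)"
    by (intro tendsto_upperbound) auto
  then show "(\<Sum>k\<in>F. (norm (conv p q k))\<^sup>2) \<le> 106 * R * ((P0 + P1 / R\<^sup>2) * Q)" by simp
qed

lemma conv_nonneg: "0 \<le> conv p q k"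
  unfolding conv_def by (rule infsum_nonneg) auto

lemma conv_commute: "conv p q k = conv q p (- k)"
proof -
  have "(\<Sum>\<^sub>\<infinity>j. norm (q j) * norm (p (j + - k))) = (\<Sum>\<^sub>\<infinity>j. norm (q (j + k)) * norm (p ((j + k) + - k)))"
    by (rule infsum_reindex_bij_betw[symmetric, of "\<lambda>j. j + k"])
       (rule bij_betw_byWitness[where f' = "\<lambda>j. j - k"], auto)
  then show ?thesis by (simp add: conv_def mult.commute)
qed

text \<open>For such a weight, a weight on the frequency of a product can be moved to one of the two factors.\<close>

definition subadd_weight :: "(int^3 \<Rightarrow> real) \<Rightarrow> real \<Rightarrow> bool" where
  "subadd_weight w c \<longleftrightarrow> 0 \<le> c \<and> (\<forall>k. 0 \<le> w k \<and> w (- k) = w k) \<and> (\<forall>j k. w k \<le> c * (w j + w (j + k)))"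

lemma subadd_weight_one: "subadd_weight (\<lambda>_. 1) 1"
  by (simp add: subadd_weight_def)

lemma subadd_weight_bracket: "subadd_weight bracket 1"
proof -
  have "bracket k \<le> bracket j + bracket (j + k)" for j k
  proof (rule power2_le_imp_le)
    define a b where "a = norm (freq j)" and "b = norm (freq (j + k))"
    have "norm (freq (j + k) - freq j) \<le> b + a" unfolding a_def b_def by (rule norm_triangle_ineq4)
    then have "(norm (freq k))\<^sup>2 \<le> (a + b)\<^sup>2" by (intro power_mono) auto
    moreover have "a * b \<le> bracket j * bracket (j + k)"
      unfolding a_def b_def by (intro mult_mono norm_freq_le_bracket) (auto simp: less_imp_le[OF bracket_pos])
    ultimately show "(bracket k)\<^sup>2 \<le> (bracket j + bracket (j + k))\<^sup>2"
      unfolding power2_sum bracket_sq by (simp add: a_def b_def power2_sum)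
  qed (simp add: add_nonneg_nonneg less_imp_le[OF bracket_pos])
  then show ?thesis by (auto simp: subadd_weight_def less_imp_le[OF bracket_pos])
qed

text \<open>Truncation keeps the constant, so estimates with truncated weights are uniform in the truncation.\<close>

lemma subadd_weight_min:
  assumes "subadd_weight w 1" "N \<ge> 0"
  shows "subadd_weight (\<lambda>k. min (w k) N) 1"
  unfolding subadd_weight_def
proof (intro conjI allI)
  fix j k
  have "w k \<le> w j + w (j + k)" "0 \<le> w j" "0 \<le> w (j + k)"
    using assms(1) by (auto simp: subadd_weight_def)
  then show "min (w k) N \<le> 1 * (min (w j) N + min (w (j + k)) N)" using assms(2) by (auto simp: min_def)
qed (use assms in \<open>auto simp: subadd_weight_def\<close>)

lemma subadd_weight_power:
  assumes "subadd_weight w 1"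
  shows "subadd_weight (\<lambda>k. w k ^ n) (2 ^ n)"
  unfolding subadd_weight_def
proof (intro conjI allI)
  fix j k
  define a b where "a = w j" and "b = w (j + k)"
  have *: "w k \<le> a + b" "0 \<le> a" "0 \<le> b" "0 \<le> w k"
    using assms(1) by (auto simp: subadd_weight_def a_def b_def)
  then have "w k ^ n \<le> (2 * max a b) ^ n" by (intro power_mono) auto
  also have "\<dots> = 2 ^ n * max a b ^ n" by (rule power_mult_distrib)
  also have "max a b ^ n \<le> a ^ n + b ^ n" using * by (auto simp: max_def)
  finally show "w k ^ n \<le> 2 ^ n * (w j ^ n + w (j + k) ^ n)" by (simp add: a_def b_def)
qed (use assms in \<open>auto simp: subadd_weight_def\<close>)

text \<open>The weight is moved to either factor, and the factor that does not carry it is measured in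
\<open>H\<^sup>1\<close>, the norm controlled by the energy.\<close>

lemma l2_le_weighted_conv:
  fixes p :: "int^3 \<Rightarrow> 'a::real_normed_vector" and q :: "int^3 \<Rightarrow> 'b::real_normed_vector"
  assumes w: "subadd_weight w c" and R: "R \<ge> 1"
    and P: "l2_le (\<lambda>j. bracket j *\<^sub>R p j) P" and P0: "l2_le (\<lambda>j. w j *\<^sub>R p j) P0" and P1: "l2_le (\<lambda>j. bracket j *\<^sub>R w j *\<^sub>R p j) P1"
    and Q: "l2_le (\<lambda>j. bracket j *\<^sub>R q j) Q" and Q0: "l2_le (\<lambda>j. w j *\<^sub>R q j) Q0" and Q1: "l2_le (\<lambda>j. bracket j *\<^sub>R w j *\<^sub>R q j) Q1"
  shows "l2_le (\<lambda>k. w k * conv p q k) (212 * c\<^sup>2 * R * ((P0 + P1 / R\<^sup>2) * Q + (Q0 + Q1 / R\<^sup>2) * P))"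
proof -
  define wp where "wp j = w j *\<^sub>R p j" for j
  define wq where "wq j = w j *\<^sub>R q j" for j
  have w0: "0 \<le> w k" "w (- k) = w k" "0 \<le> c" for k using w by (auto simp: subadd_weight_def)
  have le: "w k * conv p q k \<le> c * (conv wp q k + conv p wq k)" for k
  proof -
    have s: "(\<lambda>j. norm (wp j) * norm (q (j + k))) summable_on UNIV"
         "(\<lambda>j. norm (p j) * norm (wq (j + k))) summable_on UNIV"
         "(\<lambda>j. norm (p j) * norm (q (j + k))) summable_on UNIV"
      unfolding wp_def wq_def by (rule conv_summable[OF P1 Q] conv_summable[OF P Q1] conv_summable[OF P Q])+
    have "w k * conv p q k = (\<Sum>\<^sub>\<infinity>j. w k * (norm (p j) * norm (q (j + k))))"
      unfolding conv_def by (rule infsum_cmult_right'[symmetric])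
    also have "\<dots> \<le> (\<Sum>\<^sub>\<infinity>j. c * (norm (wp j) * norm (q (j + k)) + norm (p j) * norm (wq (j + k))))"
    proof (rule infsum_mono)
      fix j
      have "w k \<le> c * (w j + w (j + k))" using w by (auto simp: subadd_weight_def)
      then have "w k * (norm (p j) * norm (q (j + k))) \<le> (c * (w j + w (j + k))) * (norm (p j) * norm (q (j + k)))"
        by (rule mult_right_mono) simp
      then show "w k * (norm (p j) * norm (q (j + k))) \<le> c * (norm (wp j) * norm (q (j + k)) + norm (p j) * norm (wq (j + k)))"
        using w0 by (simp add: wp_def wq_def algebra_simps)
    qed (intro summable_on_cmult_right summable_on_add s)+
    also have "\<dots> = c * (conv wp q k + conv p wq k)"
      unfolding conv_def infsum_add[OF s(1,2), symmetric] by (rule infsum_cmult_right')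
    finally show ?thesis .
  qed
  have "l2_le (conv wp q) (106 * R * ((P0 + P1 / R\<^sup>2) * Q))"
    unfolding wp_def by (rule l2_le_conv[OF P0 P1 Q R])
  moreover have "l2_le (conv wq p) (106 * R * ((Q0 + Q1 / R\<^sup>2) * P))"
    unfolding wq_def by (rule l2_le_conv[OF Q0 Q1 P R])
  then have "l2_le (conv p wq) (106 * R * ((Q0 + Q1 / R\<^sup>2) * P))"
    using l2_le_reindex[of "conv wq p" _ uminus] by (simp add: conv_commute[of p wq, abs_def] inj_def)
  ultimately have "l2_le (\<lambda>k. conv wp q k + conv p wq k) (2 * (106 * R * ((P0 + P1 / R\<^sup>2) * Q)) + 2 * (106 * R * ((Q0 + Q1 / R\<^sup>2) * P)))"
    by (rule l2_le_add)
  then have "l2_le (\<lambda>k. w k * conv p q k) (c\<^sup>2 * (2 * (106 * R * ((P0 + P1 / R\<^sup>2) * Q)) + 2 * (106 * R * ((Q0 + Q1 / R\<^sup>2) * P))))"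
    by (rule l2_le_dom) (use le w0 in \<open>auto simp: abs_mult add_nonneg_nonneg abs_of_nonneg conv_nonneg\<close>)
  then show ?thesis by (simp add: algebra_simps)
qed

section \<open>The nonlinear term in coefficients\<close>

text \<open>The coefficients of the product of a scalar and a vector function: the product of two basis functions
is half a signed sum of four basis functions.\<close>

definition prod_coef :: "(int^3 \<Rightarrow> real) \<Rightarrow> (int^3 \<Rightarrow> 'a::real_normed_vector) \<Rightarrow> int^3 \<Rightarrow> 'a" where
  "prod_coef a b k = (1/2) *\<^sub>R (\<Sum>\<^sub>\<infinity>j. a j *\<^sub>R (b (j + k) + b (j - k) + b (k - j) - b (- k - j)))"

text \<open>The coefficients of \<open>(u \<cdot> \<nabla>) w\<close> for solenoidal \<open>u\<close>, as the divergence of the products \<open>u\<^sub>i w\<close>.\<close>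

definition transport :: "(int^3 \<Rightarrow> real^3) \<Rightarrow> (int^3 \<Rightarrow> real^3) \<Rightarrow> int^3 \<Rightarrow> real^3" where
  "transport a b k = - (2 * pi) *\<^sub>R (\<Sum>i\<in>UNIV. freq k $ i *\<^sub>R prod_coef (\<lambda>j. a j $ i) b (- k))"

text \<open>The four reflections of frequencies that occur in the coefficients of a product.\<close>

definition conv4 :: "(int^3 \<Rightarrow> 'a::real_normed_vector) \<Rightarrow> (int^3 \<Rightarrow> 'b::real_normed_vector) \<Rightarrow> int^3 \<Rightarrow> real" where
  "conv4 a b k = conv a b k + conv a b (- k) + (conv a (\<lambda>j. b (- j)) (- k) + conv a (\<lambda>j. b (- j)) k)"

lemma bracket_l2_reflect:
  "l2_le (\<lambda>j. bracket j *\<^sub>R b j) B \<Longrightarrow> l2_le (\<lambda>j. bracket j *\<^sub>R b (- j)) B"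
  using l2_le_reindex[of "\<lambda>j. bracket j *\<^sub>R b j" B uminus] by (simp add: inj_def)

lemma prod_coef_summable:
  fixes a :: "int^3 \<Rightarrow> real" and b :: "int^3 \<Rightarrow> 'a::banach"
  assumes A: "l2_le (\<lambda>j. bracket j *\<^sub>R a j) A" and B: "l2_le (\<lambda>j. bracket j *\<^sub>R b j) B"
  shows "(\<lambda>j. norm (a j *\<^sub>R (b (j + k) + b (j - k) + b (k - j) - b (- k - j)))) summable_on UNIV"
    and "norm (prod_coef a b k) \<le> (1/2) * conv4 a b k"
proof -
  note B' = bracket_l2_reflect[OF B]
  have s: "(\<lambda>j. norm (a j) * norm (b (j + k))) summable_on UNIV"
    "(\<lambda>j. norm (a j) * norm (b (j + - k))) summable_on UNIV"
    "(\<lambda>j. norm (a j) * norm (b (- (j + - k)))) summable_on UNIV"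
    "(\<lambda>j. norm (a j) * norm (b (- (j + k)))) summable_on UNIV"
    by (rule conv_summable[OF A B] conv_summable[OF A B'])+
  let ?g = "\<lambda>j. norm (a j) * norm (b (j + k)) + norm (a j) * norm (b (j + - k))
      + (norm (a j) * norm (b (- (j + - k))) + norm (a j) * norm (b (- (j + k))))"
  have sg: "?g summable_on UNIV" by (intro summable_on_add s)
  have le: "norm (a j *\<^sub>R (b (j + k) + b (j - k) + b (k - j) - b (- k - j))) \<le> ?g j" for j
  proof -
    have "norm (b (j + k) + b (j - k) + b (k - j) - b (- k - j)) \<le>
        norm (b (j + k)) + norm (b (j - k)) + norm (b (k - j)) + norm (b (- k - j))"
      by (intro norm_triangle_le_diff norm_triangle_le add_mono order_refl)
    then have "\<bar>a j\<bar> * norm (b (j + k) + b (j - k) + b (k - j) - b (- k - j)) \<le>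
        \<bar>a j\<bar> * (norm (b (j + k)) + norm (b (j - k)) + norm (b (k - j)) + norm (b (- k - j)))"
      by (rule mult_left_mono) simp
    moreover have "j + - k = j - k" "- (j + - k) = k - j" "- (j + k) = - k - j" by (simp_all add: algebra_simps)
    ultimately show ?thesis by (simp only: norm_scaleR real_norm_def distrib_left add.assoc)
  qed
  show 1: "(\<lambda>j. norm (a j *\<^sub>R (b (j + k) + b (j - k) + b (k - j) - b (- k - j)))) summable_on UNIV"
    by (rule Infinite_Sum.abs_summable_on_comparison_test'[OF sg le])
  have "norm (\<Sum>\<^sub>\<infinity>j. a j *\<^sub>R (b (j + k) + b (j - k) + b (k - j) - b (- k - j))) \<le> infsum ?g UNIV"
    by (rule norm_infsum_le[OF has_sum_infsum[OF abs_summable_summable[OF 1]] has_sum_infsum[OF sg] le])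
  also have "infsum ?g UNIV = conv4 a b k"
    unfolding conv4_def conv_def infsum_add[OF summable_on_add[OF s(1,2)] summable_on_add[OF s(3,4)]]
      infsum_add[OF s(1,2)] infsum_add[OF s(3,4)] by (rule refl)
  finally show "norm (prod_coef a b k) \<le> (1/2) * conv4 a b k" by (simp add: prod_coef_def)
qed

lemma conv_mono:
  assumes "\<And>j. norm (a' j) \<le> norm (a j)" and A: "l2_le (\<lambda>j. bracket j *\<^sub>R a j) A" and B: "l2_le (\<lambda>j. bracket j *\<^sub>R b j) B"
  shows "conv a' b k \<le> conv a b k"
proof -
  have A': "l2_le (\<lambda>j. bracket j *\<^sub>R a' j) A"
    by (rule l2_le_dom1[OF A]) (use assms(1) in \<open>auto intro!: mult_left_mono\<close>)
  show ?thesis unfolding conv_def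
    by (rule infsum_mono) (use assms(1) conv_summable[OF A B] conv_summable[OF A' B] in \<open>auto intro: mult_right_mono\<close>)
qed

lemma bracket_l2_component:
  assumes "l2_le (\<lambda>j. bracket j *\<^sub>R a j) A" shows "l2_le (\<lambda>j. bracket j *\<^sub>R (a j $ i :: real)) A"
  by (rule l2_le_dom1[OF assms]) (use component_le_norm_cart in \<open>auto simp: abs_mult intro!: mult_left_mono\<close>)

lemma norm_transport_le:
  assumes A: "l2_le (\<lambda>j. bracket j *\<^sub>R a j) A" and B: "l2_le (\<lambda>j. bracket j *\<^sub>R b j) B"
  shows "norm (transport a b k) \<le> 3 * pi * norm (freq k) * conv4 a b k"
proof -
  have p: "norm (prod_coef (\<lambda>j. a j $ i) b (- k)) \<le> (1/2) * conv4 a b k" for i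
  proof -
    have "norm (prod_coef (\<lambda>j. a j $ i) b (- k)) \<le> (1/2) * conv4 (\<lambda>j. a j $ i) b (- k)"
      by (rule prod_coef_summable(2)[OF bracket_l2_component[OF A] B])
    also have "conv4 (\<lambda>j. a j $ i) b (- k) \<le> conv4 a b (- k)"
      unfolding conv4_def using A B bracket_l2_reflect[OF B]
      by (intro add_mono conv_mono) (auto simp: component_le_norm_cart)
    also have "conv4 a b (- k) = conv4 a b k" by (simp add: conv4_def)
    finally show ?thesis by simp
  qed
  have "norm (\<Sum>i\<in>UNIV. freq k $ i *\<^sub>R prod_coef (\<lambda>j. a j $ i) b (- k)) \<le> (\<Sum>i\<in>(UNIV::3 set). norm (freq k) * ((1/2) * conv4 a b k))"
  proof (rule sum_norm_le)
    fix i :: 3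
    have "norm (freq k $ i *\<^sub>R prod_coef (\<lambda>j. a j $ i) b (- k)) = \<bar>freq k $ i\<bar> * norm (prod_coef (\<lambda>j. a j $ i) b (- k))"
      by (rule norm_scaleR)
    also have "\<dots> \<le> norm (freq k) * ((1/2) * conv4 a b k)"
      by (intro mult_mono component_le_norm_cart p) auto
    finally show "norm (freq k $ i *\<^sub>R prod_coef (\<lambda>j. a j $ i) b (- k)) \<le> norm (freq k) * ((1/2) * conv4 a b k)" .
  qed
  then show ?thesis
    using mult_left_mono[of "norm (\<Sum>i\<in>UNIV. freq k $ i *\<^sub>R prod_coef (\<lambda>j. a j $ i) b (- k))" _ "2 * pi"]
    by (simp add: transport_def abs_mult mult.assoc)
qed

definition conv_const :: real where "conv_const = (3 * pi)\<^sup>2 * (16 * 212)"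

lemma conv_const_pos: "0 < conv_const" by (simp add: conv_const_def)

lemma l2_le_weighted_transport:
  assumes w: "subadd_weight w c" and R: "R \<ge> 1"
    and A: "l2_le (\<lambda>j. bracket j *\<^sub>R a j) A" and A0: "l2_le (\<lambda>j. w j *\<^sub>R a j) A0" and A1: "l2_le (\<lambda>j. bracket j *\<^sub>R w j *\<^sub>R a j) A1"
    and B: "l2_le (\<lambda>j. bracket j *\<^sub>R b j) B" and B0: "l2_le (\<lambda>j. w j *\<^sub>R b j) B0" and B1: "l2_le (\<lambda>j. bracket j *\<^sub>R w j *\<^sub>R b j) B1"
  shows "l2_le (\<lambda>k. (w k / bracket k) *\<^sub>R transport a b k) (conv_const * c\<^sup>2 * R * ((A0 + A1 / R\<^sup>2) * B + (B0 + B1 / R\<^sup>2) * A))"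
proof -
  have w0: "0 \<le> w k" "w (- k) = w k" for k using w by (auto simp: subadd_weight_def)
  define X where "X = 212 * c\<^sup>2 * R * ((A0 + A1 / R\<^sup>2) * B + (B0 + B1 / R\<^sup>2) * A)"
  have refl: "l2_le (\<lambda>k. f (- k)) Y" if "l2_le f Y" for f :: "int^3 \<Rightarrow> 'x::real_normed_vector" and Y
    using l2_le_reindex[OF that, of uminus] by (simp add: inj_def)
  have 1: "l2_le (\<lambda>k. w k * conv a b k) X"
    unfolding X_def by (rule l2_le_weighted_conv[OF w R A A0 A1 B B0 B1])
  have 2: "l2_le (\<lambda>k. w k * conv a (\<lambda>j. b (- j)) k) X"
    unfolding X_def
    by (rule l2_le_weighted_conv[OF w R A A0 A1]) (use refl[OF B] refl[OF B0] refl[OF B1] in \<open>simp_all add: w0\<close>)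
  have "l2_le (\<lambda>k. (w k * conv a b k + w k * conv a b (- k)) + (w k * conv a (\<lambda>j. b (- j)) (- k) + w k * conv a (\<lambda>j. b (- j)) k))
     (2 * (2 * X + 2 * X) + 2 * (2 * X + 2 * X))"
    using refl[OF 1] refl[OF 2] by (intro l2_le_add 1 2) (simp_all add: w0)
  then have "l2_le (\<lambda>k. w k * conv4 a b k) (16 * X)"
    by (simp add: conv4_def algebra_simps)
  then have "l2_le (\<lambda>k. (w k / bracket k) *\<^sub>R transport a b k) ((3 * pi)\<^sup>2 * (16 * X))"
  proof (rule l2_le_dom)
    fix k
    have c0: "0 \<le> conv4 a b k" by (simp add: conv4_def conv_nonneg)
    have "norm ((w k / bracket k) *\<^sub>R transport a b k) \<le> (w k / bracket k) * (3 * pi * norm (freq k) * conv4 a b k)"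
      using w0 bracket_pos[of k] norm_transport_le[OF A B, of k] by (simp add: mult_left_mono divide_right_mono)
    also have "\<dots> \<le> (w k / bracket k) * (3 * pi * bracket k * conv4 a b k)"
      using w0 bracket_pos[of k] norm_freq_le_bracket[of k] c0 by (intro mult_left_mono mult_right_mono) auto
    also have "\<dots> = 3 * pi * norm (w k * conv4 a b k)"
      using w0 bracket_pos[of k] c0 by (simp add: abs_mult)
    finally show "norm ((w k / bracket k) *\<^sub>R transport a b k) \<le> 3 * pi * norm (w k * conv4 a b k)" .
  qed
  then show ?thesis by (simp add: X_def conv_const_def algebra_simps)
qed

lemma prod_coef_add_left:
  fixes b :: "int^3 \<Rightarrow> 'a::banach"
  assumes "l2_le (\<lambda>j. bracket j *\<^sub>R a j) A" "l2_le (\<lambda>j. bracket j *\<^sub>R a' j) A'" "l2_le (\<lambda>j. bracket j *\<^sub>R b j) B"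
  shows "prod_coef (\<lambda>j. a j + a' j) b k = prod_coef a b k + prod_coef a' b k"
  unfolding prod_coef_def scaleR_add_right[symmetric] scaleR_add_left
  by (subst infsum_add[OF abs_summable_summable abs_summable_summable])
     (use assms prod_coef_summable(1) in blast)+

lemma prod_coef_add_right:
  fixes b :: "int^3 \<Rightarrow> 'a::banach"
  assumes "l2_le (\<lambda>j. bracket j *\<^sub>R a j) A" "l2_le (\<lambda>j. bracket j *\<^sub>R b j) B" "l2_le (\<lambda>j. bracket j *\<^sub>R b' j) B'"
  shows "prod_coef a (\<lambda>j. b j + b' j) k = prod_coef a b k + prod_coef a b' k"
proof -
  have "(\<lambda>j. a j *\<^sub>R (b (j + k) + b' (j + k) + (b (j - k) + b' (j - k)) + (b (k - j) + b' (k - j)) - (b (- k - j) + b' (- k - j))))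
    = (\<lambda>j. a j *\<^sub>R (b (j + k) + b (j - k) + b (k - j) - b (- k - j)) + a j *\<^sub>R (b' (j + k) + b' (j - k) + b' (k - j) - b' (- k - j)))"
    by (simp add: algebra_simps)
  note eq = this
  show ?thesis
    unfolding prod_coef_def eq infsum_add[OF abs_summable_summable[OF prod_coef_summable(1)[OF assms(1,2)]] abs_summable_summable[OF prod_coef_summable(1)[OF assms(1,3)]]]
    by (rule scaleR_add_right)
qed

lemma prod_coef_scale_left: "prod_coef (\<lambda>j. c * a j) b k = c *\<^sub>R prod_coef a b k"
  unfolding prod_coef_def scaleR_scaleR[symmetric] infsum_scaleR_right by (simp add: mult.commute)

lemma prod_coef_scale_right: "prod_coef a (\<lambda>j. c *\<^sub>R b j) k = c *\<^sub>R prod_coef a b k"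
proof -
  have "(\<lambda>j. a j *\<^sub>R (c *\<^sub>R b (j + k) + c *\<^sub>R b (j - k) + c *\<^sub>R b (k - j) - c *\<^sub>R b (- k - j)))
    = (\<lambda>j. c *\<^sub>R a j *\<^sub>R (b (j + k) + b (j - k) + b (k - j) - b (- k - j)))"
    by (simp add: algebra_simps)
  note eq = this
  show ?thesis unfolding prod_coef_def eq infsum_scaleR_right by (rule scaleR_left_commute)
qed

lemma transport_add_left:
  assumes "l2_le (\<lambda>j. bracket j *\<^sub>R a j) A" "l2_le (\<lambda>j. bracket j *\<^sub>R a' j) A'" "l2_le (\<lambda>j. bracket j *\<^sub>R b j) B"
  shows "transport (\<lambda>j. a j + a' j) b k = transport a b k + transport a' b k"
  using prod_coef_add_left[OF bracket_l2_component[OF assms(1)] bracket_l2_component[OF assms(2)] assms(3)]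
  by (simp add: transport_def scaleR_add_right sum.distrib)

lemma transport_add_right:
  assumes "l2_le (\<lambda>j. bracket j *\<^sub>R a j) A" "l2_le (\<lambda>j. bracket j *\<^sub>R b j) B" "l2_le (\<lambda>j. bracket j *\<^sub>R b' j) B'"
  shows "transport a (\<lambda>j. b j + b' j) k = transport a b k + transport a b' k"
  using prod_coef_add_right[OF bracket_l2_component[OF assms(1)] assms(2,3)]
  by (simp add: transport_def scaleR_add_right sum.distrib)

lemma transport_scale_left: "transport (\<lambda>j. c *\<^sub>R a j) b k = c *\<^sub>R transport a b k"
  by (simp add: transport_def prod_coef_scale_left scaleR_sum_right mult.commute mult.left_commute)

lemma transport_scale_right: "transport a (\<lambda>j. c *\<^sub>R b j) k = c *\<^sub>R transport a b k"
  by (simp add: transport_def prod_coef_scale_right scaleR_sum_right mult.commute mult.left_commute)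

text \<open>The Leray projection acts on the coefficient of frequency \<open>k\<close> as the orthogonal projection onto the
plane normal to \<open>k\<close>; the value 0 at \<open>k = 0\<close> removes the mean.\<close>

definition leray_symbol :: "int^3 \<Rightarrow> real^3 \<Rightarrow> real^3" where
  "leray_symbol k v = (if k = 0 then 0 else v - ((v \<bullet> freq k) / (freq k \<bullet> freq k)) *\<^sub>R freq k)"

lemma leray_symbol_linear: "leray_symbol k (v + w) = leray_symbol k v + leray_symbol k w" "leray_symbol k (c *\<^sub>R v) = c *\<^sub>R leray_symbol k v"
  by (auto simp: leray_symbol_def inner_add_left add_divide_distrib algebra_simps)

lemma leray_symbol_orth: "leray_symbol k v \<bullet> freq k = 0"
  by (auto simp: leray_symbol_def inner_diff_left)

lemma leray_symbol_0 [simp]: "leray_symbol 0 v = 0" by (simp add: leray_symbol_def)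

lemma leray_symbol_id: "k \<noteq> 0 \<Longrightarrow> v \<bullet> freq k = 0 \<Longrightarrow> leray_symbol k v = v"
  by (simp add: leray_symbol_def)

lemma leray_symbol_inner: "leray_symbol k v \<bullet> w = v \<bullet> leray_symbol k w"
  by (auto simp: leray_symbol_def inner_diff_left inner_diff_right inner_commute)

lemma leray_symbol_leray_symbol [simp]: "leray_symbol k (leray_symbol k v) = leray_symbol k v"
  by (cases "k = 0") (auto simp: leray_symbol_id leray_symbol_orth)

lemma norm_leray_symbol_le: "norm (leray_symbol k v) \<le> norm v"
proof (cases "leray_symbol k v = 0")
  case False
  have "norm (leray_symbol k v) * norm (leray_symbol k v) = leray_symbol k v \<bullet> leray_symbol k v" by (simp add: power2_norm_eq_inner flip: power2_eq_square)
  also have "\<dots> = v \<bullet> leray_symbol k v" by (simp add: leray_symbol_inner)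
  also have "\<dots> \<le> norm v * norm (leray_symbol k v)" by (rule norm_cauchy_schwarz)
  finally show ?thesis using False by simp
qed simp

text \<open>The sum of \<open>(energy_weight \<alpha> k)\<^sup>2 |u k|\<^sup>2\<close> is the conserved energy.\<close>

definition energy_weight :: "real \<Rightarrow> int^3 \<Rightarrow> real" where
  "energy_weight \<alpha> k = sqrt (1 + 4 * pi\<^sup>2 * \<alpha>\<^sup>2 * (norm (freq k))\<^sup>2)"

text \<open>The factor by which the bracket may exceed the energy weight.\<close>

definition bracket_const :: "real \<Rightarrow> real" where
  "bracket_const \<alpha> = max 1 (1 / (2 * pi * \<alpha>))"

lemma energy_weight_sq: "(energy_weight \<alpha> k)\<^sup>2 = 1 + 4 * pi\<^sup>2 * \<alpha>\<^sup>2 * (norm (freq k))\<^sup>2"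
  by (simp add: energy_weight_def)

lemma energy_weight_ge1: "1 \<le> energy_weight \<alpha> k" by (simp add: energy_weight_def)

lemma energy_weight_pos: "0 < energy_weight \<alpha> k" using energy_weight_ge1[of \<alpha> k] by linarith

lemma bracket_const_ge1: "1 \<le> bracket_const \<alpha>" by (simp add: bracket_const_def)

lemma bracket_le_energy_weight:
  assumes "\<alpha> > 0" shows "bracket k \<le> bracket_const \<alpha> * energy_weight \<alpha> k"
proof (rule power2_le_imp_le)
  have "1 / (2 * pi * \<alpha>) \<le> bracket_const \<alpha>" by (simp add: bracket_const_def)
  then have "1 \<le> bracket_const \<alpha> * (2 * pi * \<alpha>)" using assms by (simp add: pos_divide_le_eq)
  then have 1: "1 \<le> (bracket_const \<alpha> * (2 * pi * \<alpha>))\<^sup>2" by (simp add: one_le_power)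
  have 2: "1 \<le> (bracket_const \<alpha>)\<^sup>2" using bracket_const_ge1 by (simp add: one_le_power)
  have "(bracket k)\<^sup>2 \<le> (bracket_const \<alpha>)\<^sup>2 + (bracket_const \<alpha> * (2 * pi * \<alpha>))\<^sup>2 * (norm (freq k))\<^sup>2"
    unfolding bracket_sq using 1 2 mult_right_mono[OF 1, of "(norm (freq k))\<^sup>2"] by simp
  then show "(bracket k)\<^sup>2 \<le> (bracket_const \<alpha> * energy_weight \<alpha> k)\<^sup>2"
    by (simp add: power_mult_distrib energy_weight_sq algebra_simps)
qed (use bracket_const_ge1[of \<alpha>] energy_weight_pos[of \<alpha> k] in simp)

lemma energy_weight_le_bracket: "energy_weight \<alpha> k \<le> max 1 (2 * pi * \<bar>\<alpha>\<bar>) * bracket k"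
proof (rule power2_le_imp_le)
  define c where "c = max 1 (2 * pi * \<bar>\<alpha>\<bar>)"
  have 1: "1 \<le> c\<^sup>2" by (simp add: c_def one_le_power)
  have "(2 * pi * \<bar>\<alpha>\<bar>)\<^sup>2 \<le> c\<^sup>2" by (rule power_mono) (auto simp: c_def)
  then have 2: "4 * pi\<^sup>2 * \<alpha>\<^sup>2 \<le> c\<^sup>2" by (simp add: power_mult_distrib)
  show "(energy_weight \<alpha> k)\<^sup>2 \<le> (max 1 (2 * pi * \<bar>\<alpha>\<bar>) * bracket k)\<^sup>2"
    unfolding energy_weight_sq power_mult_distrib bracket_sq c_def[symmetric]
    using 1 mult_right_mono[OF 2, of "(norm (freq k))\<^sup>2"] by (simp add: algebra_simps)
qed (use bracket_pos[of k] in simp)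

text \<open>The velocity coefficients of a state. Since the projection is built in, the energy identity for the
nonlinear term holds on all of \<open>ell2\<close> and not only for states of solenoidal fields.\<close>

definition velocity :: "real \<Rightarrow> ell2 \<Rightarrow> int^3 \<Rightarrow> real^3" where
  "velocity \<alpha> z k = (1 / energy_weight \<alpha> k) *\<^sub>R leray_symbol k (coef z k)"

lemma norm_velocity_le: "norm (velocity \<alpha> z k) \<le> (1 / energy_weight \<alpha> k) * norm (coef z k)"
  using norm_leray_symbol_le[of k "coef z k"] energy_weight_pos[of \<alpha> k] by (simp add: velocity_def divide_right_mono)

lemma bracket_norm_velocity_le:
  assumes "\<alpha> > 0" shows "bracket k * norm (velocity \<alpha> z k) \<le> bracket_const \<alpha> * norm (coef z k)"
proof -
  have "bracket k * norm (velocity \<alpha> z k) \<le> (bracket_const \<alpha> * energy_weight \<alpha> k) * ((1 / energy_weight \<alpha> k) * norm (coef z k))"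
    using bracket_le_energy_weight[OF assms, of k] bracket_pos[of k] by (intro mult_mono norm_velocity_le) auto
  then show ?thesis using energy_weight_pos[of \<alpha> k] by simp
qed

lemma l2_le_bracket_velocity:
  assumes "\<alpha> > 0" shows "l2_le (\<lambda>k. bracket k *\<^sub>R velocity \<alpha> z k) ((bracket_const \<alpha>)\<^sup>2 * (norm z)\<^sup>2)"
  by (rule l2_le_dom[OF l2_le_coef]) (use bracket_norm_velocity_le[OF assms] bracket_pos in \<open>auto simp: less_imp_le\<close>)

text \<open>The map \<open>-(I + \<alpha>\<^sup>2 A)\<^sup>-\<^sup>1 B\<close> in energy coordinates: of the two powers of the energy weight that
the inverse contributes, one is absorbed by the coordinates.\<close>

definition voigt_seq :: "real \<Rightarrow> ell2 \<Rightarrow> ell2 \<Rightarrow> int^3 \<Rightarrow> real^3" where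
  "voigt_seq \<alpha> z y k = - (1 / energy_weight \<alpha> k) *\<^sub>R leray_symbol k (transport (velocity \<alpha> z) (velocity \<alpha> y) k)"

definition voigt :: "real \<Rightarrow> ell2 \<Rightarrow> ell2 \<Rightarrow> ell2" where
  "voigt \<alpha> z y = Abs_ell2 (voigt_seq \<alpha> z y)"

text \<open>The inverse energy weight compensates the derivative in the transport term, and one derivative of the
velocity is the size of the state; therefore \<open>Z0\<close> bounds one derivative less than \<open>Z1\<close>.\<close>

lemma l2_le_weighted_voigt_seq:
  assumes \<alpha>: "\<alpha> > 0" and w: "subadd_weight w c" and R: "R \<ge> 1"
    and Z0: "l2_le (\<lambda>k. (w k / bracket k) *\<^sub>R coef z k) Z0" and Z1: "l2_le (\<lambda>k. w k *\<^sub>R coef z k) Z1"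
    and Y0: "l2_le (\<lambda>k. (w k / bracket k) *\<^sub>R coef y k) Y0" and Y1: "l2_le (\<lambda>k. w k *\<^sub>R coef y k) Y1"
  shows "l2_le (\<lambda>k. w k *\<^sub>R voigt_seq \<alpha> z y k)
     (bracket_const \<alpha> ^ 6 * conv_const * c\<^sup>2 * R * ((Z0 + Z1 / R\<^sup>2) * (norm y)\<^sup>2 + (Y0 + Y1 / R\<^sup>2) * (norm z)\<^sup>2))"
proof -
  have w0: "0 \<le> w k" for k using w by (auto simp: subadd_weight_def)
  have 0: "l2_le (\<lambda>k. w k *\<^sub>R velocity \<alpha> z k) ((bracket_const \<alpha>)\<^sup>2 * Z0)"
    if "l2_le (\<lambda>k. (w k / bracket k) *\<^sub>R coef z k) Z0" for z Z0
  proof (rule l2_le_dom[OF that])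
    fix k
    have "w k / bracket k * (bracket k * norm (velocity \<alpha> z k)) \<le> w k / bracket k * (bracket_const \<alpha> * norm (coef z k))"
      using w0 bracket_pos by (intro mult_left_mono bracket_norm_velocity_le[OF \<alpha>]) (simp add: less_imp_le)
    then show "norm (w k *\<^sub>R velocity \<alpha> z k) \<le> bracket_const \<alpha> * norm ((w k / bracket k) *\<^sub>R coef z k)"
      using w0[of k] bracket_pos[of k] by (simp add: mult.left_commute)
  qed
  have 1: "l2_le (\<lambda>k. bracket k *\<^sub>R w k *\<^sub>R velocity \<alpha> z k) ((bracket_const \<alpha>)\<^sup>2 * Z1)"
    if "l2_le (\<lambda>k. w k *\<^sub>R coef z k) Z1" for z Z1
  proof (rule l2_le_dom[OF that])
    fix k
    have "w k * (bracket k * norm (velocity \<alpha> z k)) \<le> w k * (bracket_const \<alpha> * norm (coef z k))"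
      using w0 by (intro mult_left_mono bracket_norm_velocity_le[OF \<alpha>])
    then show "norm (bracket k *\<^sub>R w k *\<^sub>R velocity \<alpha> z k) \<le> bracket_const \<alpha> * norm (w k *\<^sub>R coef z k)"
      using w0[of k] bracket_pos[of k] by (simp add: mult.left_commute)
  qed
  have "l2_le (\<lambda>k. (w k / bracket k) *\<^sub>R transport (velocity \<alpha> z) (velocity \<alpha> y) k)
     (conv_const * c\<^sup>2 * R * (((bracket_const \<alpha>)\<^sup>2 * Z0 + (bracket_const \<alpha>)\<^sup>2 * Z1 / R\<^sup>2) * ((bracket_const \<alpha>)\<^sup>2 * (norm y)\<^sup>2)
       + ((bracket_const \<alpha>)\<^sup>2 * Y0 + (bracket_const \<alpha>)\<^sup>2 * Y1 / R\<^sup>2) * ((bracket_const \<alpha>)\<^sup>2 * (norm z)\<^sup>2)))" (is "l2_le _ ?X")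
    by (rule l2_le_weighted_transport[OF w R l2_le_bracket_velocity[OF \<alpha>] 0[OF Z0] 1[OF Z1] l2_le_bracket_velocity[OF \<alpha>] 0[OF Y0] 1[OF Y1]])
  then have "l2_le (\<lambda>k. w k *\<^sub>R voigt_seq \<alpha> z y k) ((bracket_const \<alpha>)\<^sup>2 * ?X)"
  proof (rule l2_le_dom)
    fix k
    let ?n = "norm (transport (velocity \<alpha> z) (velocity \<alpha> y) k)"
    have "norm (w k *\<^sub>R voigt_seq \<alpha> z y k) \<le> w k / energy_weight \<alpha> k * ?n"
      using w0[of k] energy_weight_pos[of \<alpha> k] norm_leray_symbol_le[of k]
      by (simp add: voigt_seq_def mult_left_mono divide_right_mono)
    also have "\<dots> \<le> w k * (bracket_const \<alpha> / bracket k) * ?n"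
    proof -
      have "1 / energy_weight \<alpha> k \<le> bracket_const \<alpha> / bracket k"
        using bracket_le_energy_weight[OF \<alpha>, of k] energy_weight_pos[of \<alpha> k] bracket_pos[of k] by (simp add: field_simps)
      then have "w k * (1 / energy_weight \<alpha> k) * ?n \<le> w k * (bracket_const \<alpha> / bracket k) * ?n"
        using w0 by (intro mult_right_mono mult_left_mono) auto
      then show ?thesis by simp
    qed
    also have "\<dots> = bracket_const \<alpha> * norm ((w k / bracket k) *\<^sub>R transport (velocity \<alpha> z) (velocity \<alpha> y) k)"
      using w0[of k] bracket_pos[of k] by simp
    finally show "norm (w k *\<^sub>R voigt_seq \<alpha> z y k) \<le> \<dots>" .
  qed
  moreover have "(bracket_const \<alpha>)\<^sup>2 * ?X = bracket_const \<alpha> ^ 6 * conv_const * c\<^sup>2 * R * ((Z0 + Z1 / R\<^sup>2) * (norm y)\<^sup>2 + (Y0 + Y1 / R\<^sup>2) * (norm z)\<^sup>2)"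
    by (simp add: eval_nat_numeral algebra_simps add_divide_distrib)
  ultimately show ?thesis by simp
qed

lemma l2_le_voigt_seq:
  assumes "\<alpha> > 0"
  shows "l2_le (voigt_seq \<alpha> z y) (4 * bracket_const \<alpha> ^ 6 * conv_const * (norm z)\<^sup>2 * (norm y)\<^sup>2)"
proof -
  have 0: "l2_le (\<lambda>k. (1 / bracket k) *\<^sub>R coef z k) ((norm z)\<^sup>2)" for z
    by (rule l2_le_dom1[OF l2_le_coef])
       (use bracket_ge1 in \<open>auto simp: divide_le_eq mult_le_cancel_left1 intro: order_trans[OF _ abs_ge_self]\<close>)
  have 1: "l2_le (\<lambda>k. 1 *\<^sub>R coef z k) ((norm z)\<^sup>2)" for z using l2_le_coef[of z] by simp
  show ?thesis
    using l2_le_weighted_voigt_seq[OF assms subadd_weight_one order_refl 0 1 0 1, of z y] by (simp add: algebra_simps)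
qed

lemma coef_voigt: "\<alpha> > 0 \<Longrightarrow> coef (voigt \<alpha> z y) = voigt_seq \<alpha> z y"
  unfolding voigt_def by (rule coef_Abs[OF l2_le_voigt_seq])

lemma velocity_linear: "velocity \<alpha> (z + y) k = velocity \<alpha> z k + velocity \<alpha> y k" "velocity \<alpha> (c *\<^sub>R z) k = c *\<^sub>R velocity \<alpha> z k"
  by (simp_all add: velocity_def coef_simps leray_symbol_linear scaleR_add_right mult.commute)

lemma bounded_bilinear_voigt:
  assumes \<alpha>: "\<alpha> > 0" shows "bounded_bilinear (voigt \<alpha>)"
proof
  note S = l2_le_bracket_velocity[OF \<alpha>]
  have ext: "velocity \<alpha> (z + y) = (\<lambda>k. velocity \<alpha> z k + velocity \<alpha> y k)" "velocity \<alpha> (c *\<^sub>R z) = (\<lambda>k. c *\<^sub>R velocity \<alpha> z k)" for z y c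
    by (auto simp: velocity_linear)
  show "voigt \<alpha> (a + a') b = voigt \<alpha> a b + voigt \<alpha> a' b" for a a' b
    by (rule coef_eqI) (simp add: coef_voigt[OF \<alpha>] coef_simps voigt_seq_def ext transport_add_left[OF S S S] leray_symbol_linear scaleR_add_right)
  show "voigt \<alpha> a (b + b') = voigt \<alpha> a b + voigt \<alpha> a b'" for a b b'
    by (rule coef_eqI) (simp add: coef_voigt[OF \<alpha>] coef_simps voigt_seq_def ext transport_add_right[OF S S S] leray_symbol_linear scaleR_add_right)
  show "voigt \<alpha> (r *\<^sub>R a) b = r *\<^sub>R voigt \<alpha> a b" for r a b
    by (rule coef_eqI) (simp add: coef_voigt[OF \<alpha>] coef_simps voigt_seq_def ext transport_scale_left leray_symbol_linear mult.commute)
  show "voigt \<alpha> a (r *\<^sub>R b) = r *\<^sub>R voigt \<alpha> a b" for a r b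
    by (rule coef_eqI) (simp add: coef_voigt[OF \<alpha>] coef_simps voigt_seq_def ext transport_scale_right leray_symbol_linear mult.commute)
  show "\<exists>K. \<forall>a b. norm (voigt \<alpha> a b) \<le> norm a * norm b * K"
  proof (intro exI allI)
    fix a b
    show "norm (voigt \<alpha> a b) \<le> norm a * norm b * sqrt (4 * bracket_const \<alpha> ^ 6 * conv_const)"
    proof (rule norm_ell2_le)
      have "0 \<le> 4 * bracket_const \<alpha> ^ 6 * conv_const" using conv_const_pos bracket_const_ge1[of \<alpha>] by simp
      then have "(norm a * norm b * sqrt (4 * bracket_const \<alpha> ^ 6 * conv_const))\<^sup>2 = 4 * bracket_const \<alpha> ^ 6 * conv_const * (norm a)\<^sup>2 * (norm b)\<^sup>2"
        by (simp only: power_mult_distrib real_sqrt_pow2) (simp add: algebra_simps)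
      then show "l2_le (coef (voigt \<alpha> a b)) ((norm a * norm b * sqrt (4 * bracket_const \<alpha> ^ 6 * conv_const))\<^sup>2)"
        using l2_le_voigt_seq[OF \<alpha>, of a b] by (simp add: coef_voigt[OF \<alpha>])
    qed (use conv_const_pos bracket_const_ge1[of \<alpha>] in auto)
  qed
qed

section \<open>Periodic integration by parts\<close>

lemma space_torus [simp]: "space torus = cbox 0 1"
  by (simp add: torus_def)

lemma emeasure_torus: "emeasure torus (cbox 0 1) = 1"
proof -
  have "(1 :: real^3) \<bullet> b = 1" if "b \<in> Basis" for b
    using that by (auto simp: Basis_vec_def inner_axis)
  then show ?thesis by (simp add: torus_def emeasure_restrict_space emeasure_lborel_cbox_eq)
qed

lemma finite_measure_torus: "finite_measure torus"
  by (rule finite_measureI) (simp add: emeasure_torus)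

interpretation torus: finite_measure torus by (rule finite_measure_torus)

lemma measure_torus: "measure torus (cbox 0 1) = 1"
  by (simp add: measure_def emeasure_torus)

lemma integrable_torus_continuous:
  fixes f :: "real^3 \<Rightarrow> 'a::euclidean_space"
  assumes "continuous_on (cbox 0 1) f"
  shows "integrable torus f"
  using absolutely_integrable_continuous[OF assms]
  by (simp add: torus_def integrable_restrict_space set_integrable_def)

lemma continuous_borel_torus:
  fixes f :: "real^3 \<Rightarrow> 'a::euclidean_space"
  assumes "continuous_on (cbox 0 1) f"
  shows "f \<in> borel_measurable torus"
  using integrable_torus_continuous[OF assms] by auto

lemma integral_torus_HK:
  fixes f :: "real^3 \<Rightarrow> 'a::euclidean_space"
  assumes "integrable torus f"
  shows "(LINT x|torus. f x) = integral (cbox 0 1) f"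
  using lebesgue_integral_eq_integral[of "cbox 0 1" f] assms by (simp add: torus_def)

text \<open>The shifted cube is cut at the hyperplane \<open>x\<^sub>i = 1\<close> and its outer piece is moved back by one
period.\<close>

lemma integral_periodic_shift:
  fixes f :: "real^3 \<Rightarrow> 'a::euclidean_space"
  assumes f: "continuous_on UNIV f" and per: "\<And>x. f (x + axis i 1) = f x" and s: "0 \<le> s" "s \<le> 1"
  shows "integral (cbox 0 1) (\<lambda>x. f (x + s *\<^sub>R axis i 1)) = integral (cbox 0 1) f"
proof -
  define b where "b = (axis i 1 :: real^3)"
  have b: "b \<in> Basis" by (simp add: b_def axis_in_Basis_iff)
  have bj: "b $ j = (if j = i then 1 else 0)" for j by (simp add: b_def axis_def)
  have xb: "x \<bullet> b = x $ i" for x by (simp add: b_def inner_axis)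
  have box_iff: "x \<in> cbox u v \<longleftrightarrow> (u $ i \<le> x $ i \<and> x $ i \<le> v $ i) \<and> (\<forall>j. j \<noteq> i \<longrightarrow> u $ j \<le> x $ j \<and> x $ j \<le> v $ j)" for x u v :: "real^3"
    by (auto simp: mem_box_cart)
  have int: "f integrable_on cbox u v" for u v
    by (rule integrable_continuous) (rule continuous_on_subset[OF f], simp)
  have box: "cbox (s *\<^sub>R b) (1 + s *\<^sub>R b) \<inter> {x. x \<bullet> b \<le> 1} = cbox (s *\<^sub>R b) 1"
    "cbox (s *\<^sub>R b) (1 + s *\<^sub>R b) \<inter> {x. x \<bullet> b \<ge> 1} = cbox (0 + b) ((1 - (1 - s) *\<^sub>R b) + b)"
    "cbox 0 1 \<inter> {x. x \<bullet> b \<le> s} = cbox 0 (1 - (1 - s) *\<^sub>R b)"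
    "cbox 0 1 \<inter> {x. x \<bullet> b \<ge> s} = cbox (s *\<^sub>R b) 1"
    using s by (auto simp: box_iff xb bj)
  have "integral (cbox 0 1) (\<lambda>x. f (x + s *\<^sub>R b)) = integral (cbox 0 1) (f \<circ> (+) (s *\<^sub>R b))"
    by (simp add: o_def add.commute)
  also have "\<dots> = integral (cbox (s *\<^sub>R b) (1 + s *\<^sub>R b)) f"
    by (simp add: integral_shift_cbox_plus)
  also have "\<dots> = integral (cbox (s *\<^sub>R b) 1) f + integral (cbox (0 + b) ((1 - (1 - s) *\<^sub>R b) + b)) f"
    unfolding integral_split[OF int b, of _ _ 1] box by (rule refl)
  also have "integral (cbox (0 + b) ((1 - (1 - s) *\<^sub>R b) + b)) f = integral (cbox 0 (1 - (1 - s) *\<^sub>R b)) (f \<circ> (+) b)"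
    by (rule integral_shift_cbox_plus[symmetric])
  also have "f \<circ> (+) b = f"
    using per by (auto simp: b_def add.commute)
  also have "integral (cbox (s *\<^sub>R b) 1) f + integral (cbox 0 (1 - (1 - s) *\<^sub>R b)) f = integral (cbox 0 1) f"
    unfolding integral_split[OF int b, of 0 1 s] box by simp
  finally show ?thesis by (simp add: b_def)
qed

lemma pdiff_has_derivative:
  assumes "(f has_derivative f') (at x)"
  shows "pdiff i f x = f' (axis i 1)"
proof -
  have "((\<lambda>s. x + s *\<^sub>R axis i 1) has_derivative (\<lambda>s. s *\<^sub>R axis i 1)) (at 0)"
    by (auto intro!: derivative_eq_intros)
  then have "((\<lambda>s. f (x + s *\<^sub>R axis i 1)) has_derivative (\<lambda>s. f' (s *\<^sub>R axis i 1))) (at 0)"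
    by (rule has_derivative_compose) (use assms in simp)
  then have "((\<lambda>s. f (x + s *\<^sub>R axis i 1)) has_vector_derivative f' (axis i 1)) (at 0)"
    by (simp add: has_vector_derivative_def linear_simps(5)[OF has_derivative_bounded_linear[OF assms]])
  then show ?thesis by (simp add: pdiff_def vector_derivative_at)
qed

lemma has_vector_derivative_line:
  assumes "f differentiable (at (x + s *\<^sub>R axis i 1))"
  shows "((\<lambda>s. f (x + s *\<^sub>R axis i 1)) has_vector_derivative pdiff i f (x + s *\<^sub>R axis i 1)) (at s)"
proof -
  obtain f' where f': "(f has_derivative f') (at (x + s *\<^sub>R axis i 1))"
    using assms by (auto simp: differentiable_def)
  have "((\<lambda>s. x + s *\<^sub>R axis i 1) has_derivative (\<lambda>s. s *\<^sub>R axis i 1)) (at s)"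
    by (auto intro!: derivative_eq_intros)
  then have "((\<lambda>s. f (x + s *\<^sub>R axis i 1)) has_derivative (\<lambda>s. f' (s *\<^sub>R axis i 1))) (at s)"
    by (rule has_derivative_compose) (use f' in simp)
  then show ?thesis
    by (simp add: has_vector_derivative_def pdiff_has_derivative[OF f'] linear_simps(5)[OF has_derivative_bounded_linear[OF f']])
qed

definition periodic_C1 :: "3 \<Rightarrow> (real^3 \<Rightarrow> 'a::real_normed_vector) \<Rightarrow> bool" where
  "periodic_C1 i f \<longleftrightarrow> (\<forall>x. f differentiable (at x)) \<and> continuous_on UNIV (pdiff i f) \<and> (\<forall>x. f (x + axis i 1) = f x)"

lemma periodic_C1_continuous: "periodic_C1 i f \<Longrightarrow> continuous_on S f"
  by (auto simp: periodic_C1_def intro!: continuous_at_imp_continuous_on differentiable_imp_continuous_within)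

text \<open>Translating a periodic function does not change its integral; differentiating this in the
  translation parameter gives the vanishing of the integral of a partial derivative.\<close>

lemma integral_pdiff_eq_0:
  fixes f :: "real^3 \<Rightarrow> 'a::euclidean_space"
  assumes f: "periodic_C1 i f"
  shows "(LINT x|torus. pdiff i f x) = 0"
proof -
  have d: "f differentiable (at x)" and c: "continuous_on UNIV (pdiff i f)" and p: "f (x + axis i 1) = f x" for x
    using f by (auto simp: periodic_C1_def)
  define J where "J s = integral (cbox 0 1) (\<lambda>x. f (x + s *\<^sub>R axis i 1))" for s
  have "(J has_vector_derivative integral (cbox 0 1) (\<lambda>x. pdiff i f (x + 0 *\<^sub>R axis i 1))) (at 0 within {0..1})"
    unfolding J_def
  proof (rule leibniz_rule_vector_derivative)
    show "((\<lambda>s. f (x + s *\<^sub>R axis i 1)) has_vector_derivative pdiff i f (x + s *\<^sub>R axis i 1)) (at s within {0..1})" for s x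
      by (rule has_vector_derivative_at_within, rule has_vector_derivative_line, rule d)
    show "(\<lambda>x. f (x + s *\<^sub>R axis i 1)) integrable_on cbox 0 1" for s
      by (rule integrable_continuous, rule continuous_on_compose2[OF periodic_C1_continuous[OF f, of UNIV]])
         (auto intro!: continuous_intros)
    show "continuous_on ({0..1} \<times> cbox 0 1) (\<lambda>(s, x). pdiff i f (x + s *\<^sub>R axis i 1))"
      unfolding case_prod_beta
      by (rule continuous_on_compose2[OF c]) (auto intro!: continuous_intros)
  qed auto
  moreover have "(J has_vector_derivative 0) (at 0 within {0..1})"
  proof (rule has_vector_derivative_transform[where f = "\<lambda>_. J 0"])
    show "J s = J 0" if "s \<in> {0..1}" for s
      using integral_periodic_shift[OF periodic_C1_continuous[OF f] p, of s] that by (simp add: J_def)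
  qed auto
  ultimately have "integral (cbox 0 1) (pdiff i f) = 0"
    using vector_derivative_unique_within[of 0 "{0..1}" J]
    by (auto simp: trivial_limit_within islimpt_Icc)
  moreover have "integrable torus (pdiff i f)"
    by (rule integrable_torus_continuous) (rule continuous_on_subset[OF c], simp)
  ultimately show ?thesis by (simp add: integral_torus_HK)
qed

lemma pdiff_scaleR:
  assumes "f differentiable (at x)" "g differentiable (at x)"
  shows "pdiff i (\<lambda>x. f x *\<^sub>R g x) x = pdiff i f x *\<^sub>R g x + f x *\<^sub>R pdiff i g x"
proof -
  obtain f' g' where D: "(f has_derivative f') (at x)" "(g has_derivative g') (at x)"
    using assms by (auto simp: differentiable_def)
  show ?thesis
    using pdiff_has_derivative[OF has_derivative_scaleR[OF D]] pdiff_has_derivative[OF D(1)] pdiff_has_derivative[OF D(2)]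
    by (simp add: add.commute)
qed

lemma periodic_C1_scaleR:
  assumes f: "periodic_C1 i f" and g: "periodic_C1 i g"
  shows "periodic_C1 i (\<lambda>x. f x *\<^sub>R g x)"
proof -
  have d: "f differentiable (at x)" "g differentiable (at x)" for x
    using f g by (auto simp: periodic_C1_def)
  have "continuous_on UNIV (\<lambda>x. pdiff i f x *\<^sub>R g x + f x *\<^sub>R pdiff i g x)"
    using f g by (intro continuous_intros periodic_C1_continuous[OF f] periodic_C1_continuous[OF g]) (auto simp: periodic_C1_def)
  then show ?thesis
    using f g by (auto simp: periodic_C1_def pdiff_scaleR[OF d, abs_def])
qed

lemma integral_by_parts_torus:
  fixes g :: "real^3 \<Rightarrow> 'a::euclidean_space"
  assumes f: "periodic_C1 i f" and g: "periodic_C1 i g"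
  shows "(LINT x|torus. pdiff i f x *\<^sub>R g x) = - (LINT x|torus. f x *\<^sub>R pdiff i g x)"
proof -
  have d: "f differentiable (at x)" "g differentiable (at x)" for x
    using f g by (auto simp: periodic_C1_def)
  have c: "continuous_on (cbox 0 1) (pdiff i f)" "continuous_on (cbox 0 1) (pdiff i g)"
    using f g by (auto simp: periodic_C1_def intro: continuous_on_subset)
  have "0 = (LINT x|torus. pdiff i f x *\<^sub>R g x + f x *\<^sub>R pdiff i g x)"
    using integral_pdiff_eq_0[OF periodic_C1_scaleR[OF f g]] by (simp add: pdiff_scaleR[OF d])
  also have "\<dots> = (LINT x|torus. pdiff i f x *\<^sub>R g x) + (LINT x|torus. f x *\<^sub>R pdiff i g x)"
    by (intro Bochner_Integration.integral_add integrable_torus_continuous continuous_intros c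
        periodic_C1_continuous[OF f] periodic_C1_continuous[OF g])
  finally show ?thesis by (simp add: eq_neg_iff_add_eq_0)
qed

section \<open>The real Fourier basis\<close>

text \<open>The Hartley kernel. These functions form an orthonormal basis of real \<open>L\<^sup>2\<close>, in contrast to complex
exponentials, whose coefficients of real functions satisfy a symmetry condition.\<close>

definition cas :: "int^3 \<Rightarrow> real^3 \<Rightarrow> real" where
  "cas k x = cos (2 * pi * (freq k \<bullet> x)) + sin (2 * pi * (freq k \<bullet> x))"

lemma cas_has_derivative:
  "(cas k has_derivative (\<lambda>h. 2 * pi * (freq k \<bullet> h) * cas (- k) x)) (at x)"
proof -
  have L: "((\<lambda>x. 2 * pi * (freq k \<bullet> x)) has_derivative (\<lambda>h. 2 * pi * (freq k \<bullet> h))) (at x)"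
    by (intro bounded_linear_imp_has_derivative bounded_linear_mult_right[THEN bounded_linear_compose] bounded_linear_inner_right)
  have "(cas k has_derivative (\<lambda>h. (2 * pi * (freq k \<bullet> h)) * - sin (2 * pi * (freq k \<bullet> x))
      + (2 * pi * (freq k \<bullet> h)) * cos (2 * pi * (freq k \<bullet> x)))) (at x)"
    unfolding cas_def[abs_def] by (intro has_derivative_add has_derivative_cos has_derivative_sin L)
  then show ?thesis
    by (rule has_derivative_eq_rhs) (simp add: fun_eq_iff cas_def right_diff_distrib)
qed

lemma pdiff_cas: "pdiff i (cas k) = (\<lambda>x. 2 * pi * freq k $ i * cas (- k) x)"
  by (rule ext) (simp add: pdiff_has_derivative[OF cas_has_derivative] inner_axis)

lemma cas_differentiable [simp]: "cas k differentiable (at x)"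
  using cas_has_derivative by (auto simp: differentiable_def)

lemma continuous_on_cas [continuous_intros]: "continuous_on S (cas k)"
  unfolding cas_def[abs_def] by (intro continuous_intros)

lemma cas_periodic: "cas k (x + axis i 1) = cas k x"
proof -
  have eq: "2 * pi * (freq k \<bullet> (x + axis i 1)) = 2 * pi * (freq k \<bullet> x) + 2 * pi * real_of_int (k $ i)"
    by (simp add: inner_add_right inner_axis algebra_simps)
  have sc: "sin (2 * pi * real_of_int n) = 0" "cos (2 * pi * real_of_int n) = 1" for n :: int
    using sin_integer_2pi[of "real_of_int n"] cos_integer_2pi[of "real_of_int n"] by auto
  show ?thesis by (simp add: cas_def eq sin_add cos_add sc del: freq_nth)
qed

lemma periodic_C1_cas: "periodic_C1 i (cas k)"
  by (auto simp: periodic_C1_def cas_periodic pdiff_cas intro!: continuous_intros)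

lemma abs_cas_le: "\<bar>cas k x\<bar> \<le> 2"
  unfolding cas_def using abs_cos_le_one[of "2 * pi * (freq k \<bullet> x)"] abs_sin_le_one[of "2 * pi * (freq k \<bullet> x)"] by linarith

lemma cas_0 [simp]: "cas 0 x = 1"
  by (simp add: cas_def)

lemma cas_mult: "cas j x * cas k x = (1/2) * (cas (k - j) x + cas (j - k) x + cas (j + k) x - cas (- j - k) x)"
proof -
  define a b where "a = 2 * pi * (freq j \<bullet> x)" and "b = 2 * pi * (freq k \<bullet> x)"
  have "cas j x = cos a + sin a" "cas k x = cos b + sin b" "cas (k - j) x = cos (b - a) + sin (b - a)"
    "cas (j - k) x = cos (a - b) + sin (a - b)" "cas (j + k) x = cos (a + b) + sin (a + b)"
    "cas (- j - k) x = cos (- (a + b)) + sin (- (a + b))"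
    by (simp_all add: cas_def a_def b_def inner_add_left inner_diff_left algebra_simps)
  then show ?thesis
    by (simp only: cos_minus sin_minus sin_diff cos_diff sin_add cos_add) (simp add: algebra_simps)
qed

lemma cas_split: "cos (2 * pi * (freq k \<bullet> x)) = (1/2) * (cas k x + cas (- k) x)"
  "sin (2 * pi * (freq k \<bullet> x)) = (1/2) * (cas k x - cas (- k) x)"
  by (simp_all add: cas_def)

lemma integral_cas: "(LINT x|torus. cas k x) = (if k = 0 then 1 else 0)"
proof (cases "k = 0")
  case True then show ?thesis by (simp add: measure_torus)
next
  case False
  then obtain i where i: "k $ i \<noteq> 0" by (auto simp: vec_eq_iff)
  have "(LINT x|torus. pdiff i (cas (- k)) x) = 0"
    by (rule integral_pdiff_eq_0[OF periodic_C1_cas])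
  then have "2 * pi * freq (- k) $ i * (LINT x|torus. cas k x) = 0"
    by (simp add: pdiff_cas)
  then show ?thesis using i False by simp
qed

lemma integrable_cas [simp]: "integrable torus (cas k)"
  by (intro integrable_torus_continuous continuous_intros)

lemma integral_cas_cas: "(LINT x|torus. cas j x * cas k x) = (if j = k then 1 else 0)"
proof -
  have "(LINT x|torus. cas j x * cas k x) = (1/2) * ((LINT x|torus. cas (k - j) x) + (LINT x|torus. cas (j - k) x)
     + (LINT x|torus. cas (j + k) x) - (LINT x|torus. cas (- j - k) x))"
    unfolding cas_mult by simp
  also have "\<dots> = (if j = k then 1 else 0)"
  proof -
    have "- j - k = - (j + k)" by simp
    then have "- j - k = 0 \<longleftrightarrow> j + k = 0" by (simp only: neg_equal_0_iff_equal)
    moreover have "j - k = 0 \<longleftrightarrow> j = k" "k - j = 0 \<longleftrightarrow> j = k" by auto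
    ultimately show ?thesis unfolding integral_cas by (simp only:) (cases "j = k"; simp)
  qed
  finally show ?thesis .
qed

section \<open>Square integrable functions and Fourier coefficients\<close>

definition sqint :: "(real^3 \<Rightarrow> 'a::euclidean_space) \<Rightarrow> bool" where
  "sqint f \<longleftrightarrow> f \<in> borel_measurable torus \<and> integrable torus (\<lambda>x. (norm (f x))\<^sup>2)"

lemma L2_iff_sqint: "u \<in> L2 \<longleftrightarrow> sqint u"
  by (simp add: L2_def sqint_def)

lemma sqint_continuous:
  fixes f :: "real^3 \<Rightarrow> 'a::euclidean_space"
  assumes "continuous_on (cbox 0 1) f" shows "sqint f"
  unfolding sqint_def
  by (intro conjI continuous_borel_torus[OF assms] integrable_torus_continuous continuous_on_power continuous_on_norm assms)

lemma sqint_norm_mult: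
  fixes f :: "real^3 \<Rightarrow> 'a::euclidean_space" and g :: "real^3 \<Rightarrow> 'b::euclidean_space"
  assumes "sqint f" "sqint g"
  shows "integrable torus (\<lambda>x. norm (f x) * norm (g x))"
proof (rule Bochner_Integration.integrable_bound)
  show "integrable torus (\<lambda>x. (norm (f x))\<^sup>2 + (norm (g x))\<^sup>2)"
    using assms by (auto simp: sqint_def)
  show "(\<lambda>x. norm (f x) * norm (g x)) \<in> borel_measurable torus"
    using assms by (auto simp: sqint_def)
  have "norm (f x) * norm (g x) \<le> (norm (f x))\<^sup>2 + (norm (g x))\<^sup>2" for x
  proof -
    have "2 * (norm (f x) * norm (g x)) \<le> (norm (f x))\<^sup>2 + (norm (g x))\<^sup>2"
      using sum_squares_bound[of "norm (f x)" "norm (g x)"] by (simp add: mult.assoc)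
    moreover have "0 \<le> norm (f x) * norm (g x)" by simp
    ultimately show ?thesis by linarith
  qed
  then show "AE x in torus. norm (norm (f x) * norm (g x)) \<le> norm ((norm (f x))\<^sup>2 + (norm (g x))\<^sup>2)"
    by simp
qed

lemma sqint_inner:
  fixes f g :: "real^3 \<Rightarrow> 'a::euclidean_space"
  assumes "sqint f" "sqint g"
  shows "integrable torus (\<lambda>x. f x \<bullet> g x)"
  by (rule Bochner_Integration.integrable_bound[OF sqint_norm_mult[OF assms]])
     (use assms in \<open>auto simp: sqint_def Cauchy_Schwarz_ineq2\<close>)

lemma sqint_scaleR_integrable:
  fixes g :: "real^3 \<Rightarrow> 'a::euclidean_space"
  assumes "sqint f" "sqint g"
  shows "integrable torus (\<lambda>x. f x *\<^sub>R g x)"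
  by (rule Bochner_Integration.integrable_bound[OF sqint_norm_mult[OF assms]])
     (use assms in \<open>auto simp: sqint_def\<close>)

lemma sqint_add:
  fixes f g :: "real^3 \<Rightarrow> 'a::euclidean_space"
  assumes "sqint f" "sqint g"
  shows "sqint (\<lambda>x. f x + g x)"
  unfolding sqint_def
proof
  show m: "(\<lambda>x. f x + g x) \<in> borel_measurable torus" using assms by (auto simp: sqint_def)
  show "integrable torus (\<lambda>x. (norm (f x + g x))\<^sup>2)"
  proof (rule Bochner_Integration.integrable_bound)
    show "integrable torus (\<lambda>x. 2 * (norm (f x))\<^sup>2 + 2 * (norm (g x))\<^sup>2)"
      using assms by (auto simp: sqint_def)
    show "(\<lambda>x. (norm (f x + g x))\<^sup>2) \<in> borel_measurable torus" using m by measurable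
    have "(norm (f x + g x))\<^sup>2 \<le> 2 * (norm (f x))\<^sup>2 + 2 * (norm (g x))\<^sup>2" for x
      by (intro order_trans[OF _ sq_sum_le2] power_mono norm_triangle_ineq) auto
    then show "AE x in torus. norm ((norm (f x + g x))\<^sup>2) \<le> norm (2 * (norm (f x))\<^sup>2 + 2 * (norm (g x))\<^sup>2)"
      by simp
  qed
qed

lemma sqint_mult_bounded:
  fixes g :: "real^3 \<Rightarrow> 'a::euclidean_space"
  assumes "sqint g" "f \<in> borel_measurable torus" "\<And>x. x \<in> cbox 0 1 \<Longrightarrow> \<bar>f x\<bar> \<le> B"
  shows "sqint (\<lambda>x. f x *\<^sub>R g x)"
  unfolding sqint_def
proof
  show m: "(\<lambda>x. f x *\<^sub>R g x) \<in> borel_measurable torus" using assms by (auto simp: sqint_def)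
  show "integrable torus (\<lambda>x. (norm (f x *\<^sub>R g x))\<^sup>2)"
  proof (rule Bochner_Integration.integrable_bound)
    show "integrable torus (\<lambda>x. B\<^sup>2 * (norm (g x))\<^sup>2)"
      using assms by (auto simp: sqint_def)
    show "(\<lambda>x. (norm (f x *\<^sub>R g x))\<^sup>2) \<in> borel_measurable torus" using m by measurable
    show "AE x in torus. norm ((norm (f x *\<^sub>R g x))\<^sup>2) \<le> norm (B\<^sup>2 * (norm (g x))\<^sup>2)"
    proof (rule AE_I2)
      fix x assume "x \<in> space torus"
      then have "\<bar>f x\<bar>\<^sup>2 \<le> B\<^sup>2" using assms(3) by (intro power_mono) auto
      then show "norm ((norm (f x *\<^sub>R g x))\<^sup>2) \<le> norm (B\<^sup>2 * (norm (g x))\<^sup>2)"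
        by (simp add: power_mult_distrib mult_right_mono)
    qed
  qed
qed

lemma sqint_cmult: "sqint g \<Longrightarrow> sqint (\<lambda>x. c *\<^sub>R g x)" for g :: "real^3 \<Rightarrow> 'a::euclidean_space"
  by (rule sqint_mult_bounded[where B = "\<bar>c\<bar>"]) auto

lemma sqint_diff: "sqint f \<Longrightarrow> sqint g \<Longrightarrow> sqint (\<lambda>x. f x - g x)" for g :: "real^3 \<Rightarrow> 'a::euclidean_space"
  using sqint_add[of f "\<lambda>x. (-1) *\<^sub>R g x"] sqint_cmult[of g "-1"] by simp

lemma sqint_sum:
  fixes f :: "'i \<Rightarrow> real^3 \<Rightarrow> 'a::euclidean_space"
  assumes "\<And>i. i \<in> I \<Longrightarrow> sqint (f i)"
  shows "sqint (\<lambda>x. \<Sum>i\<in>I. f i x)"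
  using assms
proof (induction I rule: infinite_finite_induct)
  case (insert i I)
  then show ?case using sqint_add[of "f i" "\<lambda>x. \<Sum>i\<in>I. f i x"] by simp
qed (simp_all add: sqint_continuous)

lemma sqint_integrable: "sqint f \<Longrightarrow> integrable torus f" for f :: "real^3 \<Rightarrow> 'a::euclidean_space"
  using sqint_scaleR_integrable[of "\<lambda>_. 1" f] sqint_continuous[of "\<lambda>_. 1::real"] by simp

lemma sqint_cas_mult: "sqint f \<Longrightarrow> sqint (\<lambda>x. cas k x *\<^sub>R f x)" for f :: "real^3 \<Rightarrow> 'a::euclidean_space"
  by (rule sqint_mult_bounded[where B = 2]) (simp_all add: abs_cas_le continuous_borel_torus continuous_on_cas)

definition fcoef :: "(real^3 \<Rightarrow> 'a::euclidean_space) \<Rightarrow> int^3 \<Rightarrow> 'a" where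
  "fcoef f k = (LINT x|torus. cas k x *\<^sub>R f x)"

lemma fcoef_add: "sqint f \<Longrightarrow> sqint g \<Longrightarrow> fcoef (\<lambda>x. f x + g x) k = fcoef f k + fcoef g k"
  unfolding fcoef_def scaleR_add_right
  by (rule Bochner_Integration.integral_add) (auto intro: sqint_integrable sqint_cas_mult)

lemma fcoef_diff: "sqint f \<Longrightarrow> sqint g \<Longrightarrow> fcoef (\<lambda>x. f x - g x) k = fcoef f k - fcoef g k"
  unfolding fcoef_def scaleR_diff_right
  by (rule Bochner_Integration.integral_diff) (auto intro: sqint_integrable sqint_cas_mult)

lemma fcoef_cmult: "fcoef (\<lambda>x. c *\<^sub>R f x) k = c *\<^sub>R fcoef f k"
proof -
  have "(\<lambda>x. cas k x *\<^sub>R c *\<^sub>R f x) = (\<lambda>x. c *\<^sub>R (cas k x *\<^sub>R f x))" by (simp add: mult.commute)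
  then show ?thesis unfolding fcoef_def by (simp only: integral_scaleR_right)
qed

lemma fcoef_sum:
  assumes "\<And>i. i \<in> I \<Longrightarrow> sqint (f i)"
  shows "fcoef (\<lambda>x. \<Sum>i\<in>I. f i x) k = (\<Sum>i\<in>I. fcoef (f i) k)"
  unfolding fcoef_def scaleR_sum_right
  by (rule Bochner_Integration.integral_sum) (use assms in \<open>auto intro: sqint_integrable sqint_cas_mult\<close>)

lemma fcoef_cas: "fcoef (\<lambda>x. cas j x *\<^sub>R v) k = (if j = k then v else 0)"
proof -
  have "fcoef (\<lambda>x. cas j x *\<^sub>R v) k = (LINT x|torus. (cas k x * cas j x) *\<^sub>R v)" by (simp add: fcoef_def)
  also have "\<dots> = (LINT x|torus. cas k x * cas j x) *\<^sub>R v"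
    by (rule integral_scaleR_left)
       (auto intro!: integrable_torus_continuous continuous_intros)
  finally show ?thesis by (simp add: integral_cas_cas)
qed

lemma fcoef_linear:
  assumes "sqint f" "bounded_linear T"
  shows "fcoef (\<lambda>x. T (f x)) k = T (fcoef f k)"
proof -
  have "fcoef (\<lambda>x. T (f x)) k = (LINT x|torus. T (cas k x *\<^sub>R f x))"
    by (simp add: fcoef_def linear_simps(5)[OF assms(2)])
  also have "\<dots> = T (fcoef f k)"
    unfolding fcoef_def by (rule integral_bounded_linear[OF assms(2)]) (intro sqint_integrable sqint_cas_mult assms)
  finally show ?thesis .
qed

lemma fcoef_AE_cong:
  assumes "AE x in torus. f x = g x" "f \<in> borel_measurable torus" "g \<in> borel_measurable torus"
  shows "fcoef f k = fcoef g k"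
proof -
  have "cas k \<in> borel_measurable torus" by (intro continuous_borel_torus continuous_intros)
  then show ?thesis
    unfolding fcoef_def using assms
    by (intro integral_cong_AE borel_measurable_scaleR) auto
qed

section \<open>Completeness of the Fourier basis\<close>

text \<open>The inductive form makes orthogonality to all trigonometric polynomials provable by rule induction.\<close>

inductive trigfun :: "(real^3 \<Rightarrow> real) \<Rightarrow> bool" where
  cas: "trigfun (cas k)"
| scale: "trigfun f \<Longrightarrow> trigfun (\<lambda>x. c * f x)"
| add: "trigfun f \<Longrightarrow> trigfun g \<Longrightarrow> trigfun (\<lambda>x. f x + g x)"

lemma trigfun_const: "trigfun (\<lambda>_. c)"
  using trigfun.scale[OF trigfun.cas, of c 0] by simp

lemma trigfun_mult:
  assumes "trigfun f" "trigfun g" shows "trigfun (\<lambda>x. f x * g x)"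
  using assms
proof (induction f arbitrary: g)
  case (cas j)
  then show ?case
  proof (induction g)
    case (cas k)
    have "(\<lambda>x. cas j x * cas k x) = (\<lambda>x. (1/2) * ((cas (k - j) x + cas (j - k) x) + (cas (j + k) x + (-1) * cas (- j - k) x)))"
      by (simp add: cas_mult fun_eq_iff)
    then show ?case by (simp only:) (intro trigfun.intros)
  next
    case (scale g c)
    then show ?case using trigfun.scale[of _ c] by (simp add: mult.left_commute)
  next
    case (add g h)
    then show ?case using trigfun.add by (simp add: distrib_left)
  qed
next
  case (scale f c)
  then show ?case using trigfun.scale[of _ c] by (simp add: mult.assoc)
next
  case (add f h)
  then show ?case using trigfun.add by (simp add: distrib_right)
qed

lemma trigfun_sum: "(\<And>i. i \<in> I \<Longrightarrow> trigfun (f i)) \<Longrightarrow> trigfun (\<lambda>x. \<Sum>i\<in>I. f i x)"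
proof (induction I rule: infinite_finite_induct)
  case (insert i I)
  then have "trigfun (\<lambda>x. f i x + (\<Sum>i\<in>I. f i x))" by (intro trigfun.add) auto
  then show ?case using insert by simp
qed (simp_all add: trigfun_const)

lemma trigfun_continuous: "trigfun f \<Longrightarrow> continuous_on S f"
  by (induction rule: trigfun.induct)
     (simp_all add: continuous_on_cas continuous_on_mult continuous_on_add)

text \<open>The torus as a compact subset of \<open>\<real>\<^sup>6\<close>: polynomials there pull back to
  trigonometric polynomials.\<close>

definition circles :: "real^3 \<Rightarrow> (real^3) \<times> (real^3)" where
  "circles x = (\<chi> i. cos (2 * pi * x $ i), \<chi> i. sin (2 * pi * x $ i))"

lemma freq_axis: "freq (axis i 1) \<bullet> x = x $ i"
proof -
  have "freq (axis i 1) = axis i 1" by (simp add: vec_eq_iff axis_def)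
  then show ?thesis by (simp add: inner_axis')
qed

lemma trigfun_cos_sin: "trigfun (\<lambda>x. cos (2 * pi * x $ i))" "trigfun (\<lambda>x. sin (2 * pi * x $ i))"
proof -
  have "(\<lambda>x. cos (2 * pi * x $ i)) = (\<lambda>x. (1/2) * (cas (axis i 1) x + cas (- axis i 1) x))"
    using cas_split(1)[of "axis i 1"] by (simp add: freq_axis fun_eq_iff)
  then show "trigfun (\<lambda>x. cos (2 * pi * x $ i))" by (simp only:) (intro trigfun.intros)
  have "(\<lambda>x. sin (2 * pi * x $ i)) = (\<lambda>x. (1/2) * (cas (axis i 1) x + (-1) * cas (- axis i 1) x))"
    using cas_split(2)[of "axis i 1"] by (simp add: freq_axis fun_eq_iff)
  then show "trigfun (\<lambda>x. sin (2 * pi * x $ i))" by (simp only:) (intro trigfun.intros)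
qed

lemma trigfun_polynomial_circles:
  assumes "real_polynomial_function p" shows "trigfun (\<lambda>x. p (circles x))"
  using assms
proof (induction rule: real_polynomial_function.induct)
  case (linear f)
  interpret bounded_linear f by fact
  have "circles x = (\<Sum>i\<in>UNIV. cos (2 * pi * x $ i) *\<^sub>R (axis i 1, 0) + sin (2 * pi * x $ i) *\<^sub>R (0, axis i 1))" for x
    by (simp add: circles_def prod_eq_iff fst_sum snd_sum vec_eq_iff axis_def if_distrib[of "\<lambda>u. _ * u"] cong: if_cong)
  then have "f (circles x) = (\<Sum>i\<in>UNIV. f (axis i 1, 0) * cos (2 * pi * x $ i) + f (0, axis i 1) * sin (2 * pi * x $ i))" for x
    by (simp only: sum add scaleR real_scaleR_def mult.commute[of "f _"])
  then show ?case
    by (simp only:) (intro trigfun_sum trigfun.add trigfun.scale trigfun_cos_sin)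
qed (auto intro: trigfun_const trigfun.add trigfun_mult)

text \<open>Only boundary points of the cube are identified, so functions that vanish on the boundary
factor through the map.\<close>

lemma circles_eqD:
  assumes "circles x = circles y" "x \<in> cbox 0 1" "y \<in> cbox 0 1"
  shows "x = y \<or> (x \<notin> box 0 1 \<and> y \<notin> box 0 1)"
proof (rule disjCI)
  assume nb: "\<not> (x \<notin> box 0 1 \<and> y \<notin> box 0 1)"
  have b: "0 \<le> x $ i" "x $ i \<le> 1" "0 \<le> y $ i" "y $ i \<le> 1" for i
    using assms(2,3) by (auto simp: mem_box_cart)
  have z: "\<exists>n::int. x $ i = y $ i + n" for i
  proof -
    have "cos (2 * pi * x $ i) = cos (2 * pi * y $ i)" "sin (2 * pi * x $ i) = sin (2 * pi * y $ i)"
      using assms(1) by (auto simp: circles_def vec_eq_iff)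
    then obtain n :: int where "2 * pi * x $ i = 2 * pi * y $ i + 2 * pi * n"
      using sin_cos_eq_iff by metis
    then have "2 * pi * x $ i = 2 * pi * (y $ i + n)" by (simp add: distrib_left)
    then have "x $ i = y $ i + n" by simp
    then show ?thesis by blast
  qed
  have "x $ i = y $ i" for i
  proof -
    obtain n :: int where n: "x $ i = y $ i + n" using z by blast
    have "(0 < x $ i \<and> x $ i < 1) \<or> (0 < y $ i \<and> y $ i < 1)" using nb by (auto simp: mem_box_cart)
    then have "-1 < real_of_int n" "real_of_int n < 1" using b[of i] n by linarith+
    then have "n = 0" by linarith
    then show ?thesis using n by simp
  qed
  then show "x = y" by (simp add: vec_eq_iff)
qed

lemma continuous_on_circles: "continuous_on S circles"
  unfolding circles_def[abs_def]
  by (intro continuous_on_Pair continuous_on_vec_lambda continuous_intros)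

text \<open>Stone-Weierstrass on the compact image of the cube: the function factors through the map to the
circles, and the factor is continuous because preimages of closed sets are images of compact sets.\<close>

lemma trigfun_dense:
  fixes g :: "real^3 \<Rightarrow> real"
  assumes g: "continuous_on (cbox 0 1) g" and g0: "\<And>x. x \<in> cbox 0 1 - box 0 1 \<Longrightarrow> g x = 0" and e: "e > 0"
  shows "\<exists>p. trigfun p \<and> (\<forall>x\<in>cbox 0 1. \<bar>g x - p x\<bar> < e)"
proof -
  define K where "K = circles ` cbox 0 1"
  have K: "compact K" unfolding K_def
    by (rule compact_continuous_image[OF continuous_on_circles compact_cbox])
  define h where "h y = g (SOME x. x \<in> cbox 0 1 \<and> circles x = y)" for y
  have h: "h (circles x) = g x" if x: "x \<in> cbox 0 1" for x
  proof -
    let ?z = "SOME z. z \<in> cbox 0 1 \<and> circles z = circles x"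
    have z: "?z \<in> cbox 0 1 \<and> circles ?z = circles x" by (rule someI[of _ x]) (use x in auto)
    then have "?z = x \<or> (?z \<notin> box 0 1 \<and> x \<notin> box 0 1)" using circles_eqD x by blast
    then have "g ?z = g x" using g0[of ?z] g0[of x] z x by auto
    then show ?thesis by (simp add: h_def)
  qed
  have "continuous_on K h"
    unfolding continuous_on_closed_vimage[OF compact_imp_closed[OF K]]
  proof (intro allI impI)
    fix B :: "real set" assume "closed B"
    have "h -` B \<inter> K = circles ` (g -` B \<inter> cbox 0 1)" using h by (auto simp: K_def)
    moreover have "closed (g -` B \<inter> cbox 0 1)"
      using continuous_on_closed_vimage[OF closed_cbox, of 0 1 g] g \<open>closed B\<close> by blast
    then have "compact ((g -` B \<inter> cbox 0 1) \<inter> cbox 0 1)"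
      by (rule closed_Int_compact) (rule compact_cbox)
    then have "compact (circles ` (g -` B \<inter> cbox 0 1))"
      by (intro compact_continuous_image continuous_on_circles) (simp add: Int_assoc)
    ultimately show "closed (h -` B \<inter> K)" by (simp add: compact_imp_closed)
  qed
  then obtain p where p: "real_polynomial_function p" "\<And>y. y \<in> K \<Longrightarrow> \<bar>h y - p y\<bar> < e"
    using Stone_Weierstrass_real_polynomial_function[OF K _ e] by blast
  show ?thesis
  proof (intro exI conjI ballI)
    show "trigfun (\<lambda>x. p (circles x))" by (rule trigfun_polynomial_circles[OF p(1)])
    show "\<bar>g x - p (circles x)\<bar> < e" if "x \<in> cbox 0 1" for x
      using p(2)[of "circles x"] h[OF that] that by (simp add: K_def)
  qed
qed

lemma AE_torus_iff: "(AE x in torus. P x) \<longleftrightarrow> (AE x in lebesgue. x \<in> cbox 0 1 \<longrightarrow> P x)"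
  unfolding torus_def by (rule AE_restrict_space_iff) simp

lemma AE_torus_null: "T \<in> null_sets lebesgue \<Longrightarrow> AE x in torus. x \<notin> T"
  unfolding AE_torus_iff using AE_not_in[of T lebesgue] by (auto elim: eventually_mono)

lemma AE_torus_box: "AE x in torus. x \<in> box 0 1"
proof -
  have "cbox 0 1 - box 0 1 \<in> null_sets (lebesgue :: (real^3) measure)"
    using negligible_frontier_interval negligible_iff_null_sets by blast
  then have "AE x in lebesgue. x \<notin> cbox 0 1 - box 0 (1::real^3)" by (rule AE_not_in)
  then show ?thesis unfolding AE_torus_iff by (auto elim: eventually_mono)
qed

lemma trigfun_orth:
  fixes f :: "real^3 \<Rightarrow> real"
  assumes f: "sqint f" and 0: "\<And>k. fcoef f k = 0" and "trigfun p"
  shows "(LINT x|torus. p x * f x) = 0"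
  using assms(3)
proof (induction rule: trigfun.induct)
  case (cas k) then show ?case using 0[of k] by (simp add: fcoef_def)
next
  case (scale g c)
  then show ?case by (simp add: mult.assoc)
next
  case (add g h)
  have "integrable torus (\<lambda>x. p x * f x)" if "trigfun p" for p
    using sqint_scaleR_integrable[OF sqint_continuous[OF trigfun_continuous[OF that]] f] by simp
  then show ?case using add by (simp add: distrib_right)
qed

text \<open>Orthogonality passes from trigonometric polynomials to continuous functions that
vanish on the boundary, from these to indicators of open sets and, through \<open>G\<^sub>\<delta>\<close> hulls, to indicators of measurable
sets, among them the sets where the function is positive or negative.\<close>

lemma fcoef_zero_imp_AE_zero_real:
  fixes f :: "real^3 \<Rightarrow> real"
  assumes f: "sqint f" and 0: "\<And>k. fcoef f k = 0"
  shows "AE x in torus. f x = 0"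
proof -
  have fi: "integrable torus f" by (rule sqint_integrable[OF f])
  have fm: "f \<in> borel_measurable torus" using fi by auto
  \<comment> \<open>Orthogonality to continuous functions vanishing on the boundary of the cube.\<close>
  have cont0: "(LINT x|torus. g x * f x) = 0"
    if g: "continuous_on (cbox 0 1) g" and g0: "\<And>x. x \<in> cbox 0 1 - box 0 1 \<Longrightarrow> g x = 0" for g
  proof -
    define M where "M = (LINT x|torus. \<bar>f x\<bar>)"
    have "\<bar>LINT x|torus. g x * f x\<bar> \<le> e * M" if e: "e > 0" for e
    proof -
      obtain p where p: "trigfun p" "\<And>x. x \<in> cbox 0 1 \<Longrightarrow> \<bar>g x - p x\<bar> < e"
        using trigfun_dense[OF g g0 e] by blast
      have i: "integrable torus (\<lambda>x. g x * f x)" "integrable torus (\<lambda>x. p x * f x)"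
        using sqint_scaleR_integrable[OF sqint_continuous[OF g] f]
          sqint_scaleR_integrable[OF sqint_continuous[OF trigfun_continuous[OF p(1)]] f] by simp_all
      have "(LINT x|torus. g x * f x) = (LINT x|torus. g x * f x - p x * f x)"
        using i trigfun_orth[OF f 0 p(1)] by simp
      also have "\<bar>\<dots>\<bar> \<le> (LINT x|torus. \<bar>g x * f x - p x * f x\<bar>)"
        by (rule integral_abs_bound)
      also have "\<dots> \<le> (LINT x|torus. e * \<bar>f x\<bar>)"
      proof (rule integral_mono)
        fix x assume "x \<in> space torus"
        then have "\<bar>g x - p x\<bar> * \<bar>f x\<bar> \<le> e * \<bar>f x\<bar>" using p(2)[of x] by (intro mult_right_mono) auto
        then show "\<bar>g x * f x - p x * f x\<bar> \<le> e * \<bar>f x\<bar>" by (simp flip: left_diff_distrib abs_mult)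
      qed (use i fi in auto)
      finally show ?thesis using fi by (simp add: M_def)
    qed
    then have "\<bar>LINT x|torus. g x * f x\<bar> \<le> 0 + e" if "e > 0" for e
    proof -
      have M: "0 \<le> M" by (simp add: M_def)
      have "\<bar>LINT x|torus. g x * f x\<bar> \<le> e / (M + 1) * M"
        using \<open>\<And>e. e > 0 \<Longrightarrow> _\<close>[of "e / (M + 1)"] that M by simp
      also have "\<dots> \<le> e" using M that by (simp add: field_simps)
      finally show ?thesis by simp
    qed
    then have "\<bar>LINT x|torus. g x * f x\<bar> \<le> 0" by (rule field_le_epsilon)
    then show ?thesis by simp
  qed
  have open0: "(LINT x|torus. indicator U x * f x) = 0" if U: "open U" "U \<subseteq> box 0 1" for U
  proof -
    have Uc: "U \<subseteq> cbox 0 1" using U(2) box_subset_cbox[of 0 "1::real^3"] by blast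
    have ne: "- U \<noteq> {}" using U(2) by (metis Compl_empty_eq bot.extremum_uniqueI bounded_box bounded_subset double_compl not_bounded_UNIV)
    define g where "g n x = min 1 (real n * infdist x (- U))" for n x
    have gc: "continuous_on S (g n)" for S n unfolding g_def
      by (intro continuous_intros)
    have gU: "g n x = 0" if "x \<notin> U" for n x using that by (simp add: g_def)
    have "(\<lambda>n. LINT x|torus. g n x * f x) \<longlonglongrightarrow> (LINT x|torus. indicator U x * f x)"
    proof (rule integral_dominated_convergence)
      show "(\<lambda>x. indicator U x * f x) \<in> borel_measurable torus"
        using U(1) Uc fm by (intro borel_measurable_times borel_measurable_indicator) (auto simp: torus_def sets_restrict_space_iff)
      show "(\<lambda>x. g n x * f x) \<in> borel_measurable torus" for n
        by (rule borel_measurable_times[OF continuous_borel_torus[OF gc] fm])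
      show "integrable torus (\<lambda>x. \<bar>f x\<bar>)" using fi by simp
      have "(\<lambda>n. g n x) \<longlonglongrightarrow> indicator U x" for x
      proof (cases "x \<in> U")
        case True
        then have d: "infdist x (- U) > 0"
          using infdist_pos_not_in_closed[of "- U" x] U(1) ne by auto
        obtain N :: nat where N: "1 / infdist x (- U) < N" using reals_Archimedean2 by blast
        have "g n x = 1" if "n \<ge> N" for n
        proof -
          have "1 / infdist x (- U) < n" using N that by linarith
          then have "1 < real n * infdist x (- U)" using d by (simp add: field_simps)
          then show ?thesis by (simp add: g_def)
        qed
        then show ?thesis using True by (intro tendsto_eventually eventually_sequentiallyI[of N]) simp
      qed (simp add: gU)
      then show "AE x in torus. (\<lambda>n. g n x * f x) \<longlonglongrightarrow> indicator U x * f x"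
        by (intro always_eventually allI tendsto_mult tendsto_const)
      have "\<bar>g n x\<bar> \<le> 1" for n x using infdist_nonneg[of x "- U"] by (auto simp: g_def)
      then have "\<bar>g n x * f x\<bar> \<le> \<bar>f x\<bar>" for n x by (simp add: abs_mult mult_left_le_one_le)
      then show "AE x in torus. norm (g n x * f x) \<le> \<bar>f x\<bar>" for n by simp
    qed
    moreover have "(LINT x|torus. g n x * f x) = 0" for n
      by (rule cont0[OF gc]) (use U(2) gU in blast)
    ultimately show ?thesis by (simp add: LIMSEQ_const_iff)
  qed
  have meas0: "(LINT x|torus. indicator A x * f x) = 0" if A: "A \<in> sets lebesgue" for A
  proof -
    obtain C T where C: "gdelta C" "T \<in> null_sets lebesgue" "A \<union> T = C" "disjnt A T"
      using lebesgue_set_almost_gdelta[OF A] by metis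
    then obtain F where F: "\<And>n::nat. open (F n)" "C = (\<Inter>(F ` UNIV))"
      unfolding gdelta.simps by blast
    define U where "U n = (\<Inter>i\<le>n. F i) \<inter> box 0 1" for n
    have U: "open (U n)" "U n \<subseteq> box 0 1" for n using F(1) by (auto simp: U_def)
    have "(\<lambda>n. LINT x|torus. indicator (U n) x * f x) \<longlonglongrightarrow> (LINT x|torus. indicator A x * f x)"
    proof (rule integral_dominated_convergence)
      have Am: "A \<inter> space torus \<in> sets torus" using A by (auto simp: torus_def sets_restrict_space_iff)
      show "(\<lambda>x. indicator A x * f x) \<in> borel_measurable torus"
        using Am fm by (intro borel_measurable_times borel_measurable_indicator') (auto simp: Int_def conj_commute)
      show "(\<lambda>x. indicator (U n) x * f x) \<in> borel_measurable torus" for n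
        using U fm box_subset_cbox[of 0 "1::real^3"] by (intro borel_measurable_times borel_measurable_indicator) (auto simp: torus_def sets_restrict_space_iff)
      show "integrable torus (\<lambda>x. \<bar>f x\<bar>)" using fi by simp
      show "AE x in torus. norm (indicator (U n) x * f x) \<le> \<bar>f x\<bar>" for n
        by (auto simp: indicator_def)
      show "AE x in torus. (\<lambda>n. indicator (U n) x * f x) \<longlonglongrightarrow> indicator A x * f x"
        using AE_torus_box AE_torus_null[OF C(2)]
      proof eventually_elim
        case (elim x)
        have "(\<lambda>n. indicator (U n) x :: real) \<longlonglongrightarrow> indicator A x"
        proof (cases "x \<in> A")
          case True
          then have "x \<in> U n" for n using C(3) F(2) elim by (auto simp: U_def)
          then show ?thesis using True by simp
        next
          case False
          then have "x \<notin> C" using C(3) elim by auto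
          then obtain N where "x \<notin> F N" using F(2) by auto
          then have "x \<notin> U n" if "n \<ge> N" for n using that by (auto simp: U_def)
          then show ?thesis using False by (intro tendsto_eventually eventually_sequentiallyI[of N]) simp
        qed
        then show ?case by (intro tendsto_mult tendsto_const)
      qed
    qed
    then show ?thesis using open0[OF U] by (simp add: LIMSEQ_const_iff)
  qed
  have half: "AE x in torus. s * f x \<le> 0" for s :: real
  proof -
    define A where "A = {x \<in> cbox 0 1. 0 < s * f x}"
    have "{x \<in> space torus. 0 < s * f x} \<in> sets torus" using fm by measurable
    then have A: "A \<in> sets torus" by (simp add: A_def)
    then have AL: "A \<in> sets lebesgue" by (auto simp: torus_def sets_restrict_space_iff)
    have "(LINT x|torus. s * (indicator A x * f x)) = 0" using meas0[OF AL] by simp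
    moreover have "integrable torus (\<lambda>x. s * (indicator A x * f x))"
      using integrable_mult_indicator[OF A fi] by simp
    moreover have "AE x in torus. 0 \<le> s * (indicator A x * f x)"
      by (auto simp: A_def indicator_def)
    ultimately have "AE x in torus. s * (indicator A x * f x) = 0"
      using integral_nonneg_eq_0_iff_AE by blast
    then show ?thesis
    proof (rule AE_mp, intro AE_I2 impI)
      fix x assume x: "x \<in> space torus" "s * (indicator A x * f x) = 0"
      show "s * f x \<le> 0"
      proof (rule ccontr)
        assume "\<not> s * f x \<le> 0"
        then have "x \<in> A" using x by (simp add: A_def)
        then show False using x \<open>\<not> s * f x \<le> 0\<close> by auto
      qed
    qed
  qed
  show ?thesis using half[of 1] half[of "-1"] by eventually_elim simp
qed

lemma fcoef_zero_imp_AE_zero: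
  fixes f :: "real^3 \<Rightarrow> 'a::euclidean_space"
  assumes f: "sqint f" and 0: "\<And>k. fcoef f k = 0"
  shows "AE x in torus. f x = 0"
proof -
  have "AE x in torus. f x \<bullet> b = 0" if b: "b \<in> Basis" for b
  proof (rule fcoef_zero_imp_AE_zero_real)
    have bl: "bounded_linear (\<lambda>v. v \<bullet> b)" by (rule bounded_linear_inner_left)
    show "fcoef (\<lambda>x. f x \<bullet> b) k = 0" for k using fcoef_linear[OF f bl, of k] 0[of k] by simp
    show "sqint (\<lambda>x. f x \<bullet> b)"
      unfolding sqint_def
    proof
      show m: "(\<lambda>x. f x \<bullet> b) \<in> borel_measurable torus" using f by (auto simp: sqint_def)
      show "integrable torus (\<lambda>x. (norm (f x \<bullet> b))\<^sup>2)"
      proof (rule Bochner_Integration.integrable_bound)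
        show "integrable torus (\<lambda>x. (norm (f x))\<^sup>2)" using f by (auto simp: sqint_def)
        show "(\<lambda>x. (norm (f x \<bullet> b))\<^sup>2) \<in> borel_measurable torus" using m by measurable
        have "(norm (f x \<bullet> b))\<^sup>2 \<le> (norm (f x))\<^sup>2" for x
          using Basis_le_norm[OF b, of "f x"] by (intro power_mono) auto
        then show "AE x in torus. norm ((norm (f x \<bullet> b))\<^sup>2) \<le> norm ((norm (f x))\<^sup>2)" by simp
      qed
    qed
  qed
  then have "AE x in torus. \<forall>b\<in>Basis. f x \<bullet> b = 0"
    by (simp add: AE_finite_all)
  then show ?thesis by eventually_elim (simp add: euclidean_all_zero_iff)
qed

lemma fcoef_eq_imp_AE_eq:
  fixes f :: "real^3 \<Rightarrow> 'a::euclidean_space"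
  assumes "sqint f" "sqint g" "\<And>k. fcoef f k = fcoef g k"
  shows "AE x in torus. f x = g x"
  using fcoef_zero_imp_AE_zero[OF sqint_diff[OF assms(1,2)]] assms(3) by (simp add: fcoef_diff[OF assms(1,2)])

section \<open>Riesz-Fischer and Parseval\<close>

definition fourier_sum :: "(int^3) set \<Rightarrow> (int^3 \<Rightarrow> 'a::euclidean_space) \<Rightarrow> real^3 \<Rightarrow> 'a" where
  "fourier_sum F a x = (\<Sum>k\<in>F. cas k x *\<^sub>R a k)"

lemma sqint_fourier_sum: "sqint (fourier_sum F a)"
  unfolding fourier_sum_def[abs_def]
  by (intro sqint_continuous continuous_on_sum continuous_on_scaleR continuous_on_cas continuous_on_const)

lemma fcoef_fourier_sum: "finite F \<Longrightarrow> fcoef (fourier_sum F a) k = (if k \<in> F then a k else 0)"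
  unfolding fourier_sum_def[abs_def]
  by (subst fcoef_sum) (auto intro!: sqint_continuous continuous_intros simp: fcoef_cas)

lemma integral_inner_fourier_sum:
  assumes "sqint h" "finite F"
  shows "(LINT x|torus. h x \<bullet> fourier_sum F c x) = (\<Sum>k\<in>F. fcoef h k \<bullet> c k)"
proof -
  have "h x \<bullet> fourier_sum F c x = (\<Sum>k\<in>F. (cas k x *\<^sub>R h x) \<bullet> c k)" for x
    by (simp add: fourier_sum_def inner_sum_right)
  moreover have "(LINT x|torus. (cas k x *\<^sub>R h x) \<bullet> c k) = fcoef h k \<bullet> c k" for k
    unfolding fcoef_def
    by (rule integral_inner_left) (intro impI sqint_integrable sqint_cas_mult assms)
  moreover have "integrable torus (\<lambda>x. (cas k x *\<^sub>R h x) \<bullet> c k)" for k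
    by (intro integrable_inner_left impI sqint_integrable sqint_cas_mult assms)
  ultimately show ?thesis by (simp only: Bochner_Integration.integral_sum)
qed

lemma norm_sq_diff_fourier_sum:
  assumes h: "sqint h" and F: "finite F"
  shows "(LINT x|torus. (norm (h x - fourier_sum F (fcoef h) x))\<^sup>2) = (LINT x|torus. (norm (h x))\<^sup>2) - (\<Sum>k\<in>F. (norm (fcoef h k))\<^sup>2)"
proof -
  let ?P = "fourier_sum F (fcoef h)"
  have i: "integrable torus (\<lambda>x. h x \<bullet> h x)" "integrable torus (\<lambda>x. h x \<bullet> ?P x)" "integrable torus (\<lambda>x. ?P x \<bullet> ?P x)"
    by (intro sqint_inner h sqint_fourier_sum)+
  have "(norm (h x - ?P x))\<^sup>2 = h x \<bullet> h x - 2 * (h x \<bullet> ?P x) + ?P x \<bullet> ?P x" for x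
    by (simp add: power2_norm_eq_inner inner_diff_left inner_diff_right inner_commute)
  then have "(LINT x|torus. (norm (h x - ?P x))\<^sup>2) =
      (LINT x|torus. h x \<bullet> h x) - 2 * (LINT x|torus. h x \<bullet> ?P x) + (LINT x|torus. ?P x \<bullet> ?P x)"
    using i by simp
  then show ?thesis
    by (simp add: integral_inner_fourier_sum[OF h F] integral_inner_fourier_sum[OF sqint_fourier_sum F] fcoef_fourier_sum[OF F] power2_norm_eq_inner)
qed

lemma bessel:
  assumes "sqint h" shows "l2_le (fcoef h) (LINT x|torus. (norm (h x))\<^sup>2)"
proof (rule l2_leI)
  fix F :: "(int^3) set" assume "finite F"
  have "0 \<le> (LINT x|torus. (norm (h x - fourier_sum F (fcoef h) x))\<^sup>2)" by simp
  then show "(\<Sum>k\<in>F. (norm (fcoef h k))\<^sup>2) \<le> (LINT x|torus. (norm (h x))\<^sup>2)"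
    unfolding norm_sq_diff_fourier_sum[OF assms \<open>finite F\<close>] by simp
qed

lemma norm_sq_fourier_sum: "finite F \<Longrightarrow> (LINT x|torus. (norm (fourier_sum F a x))\<^sup>2) = (\<Sum>k\<in>F. (norm (a k))\<^sup>2)"
  using integral_inner_fourier_sum[OF sqint_fourier_sum, of F F a a] by (simp add: power2_norm_eq_inner fcoef_fourier_sum)

lemma fourier_sum_Diff: "finite G \<Longrightarrow> F \<subseteq> G \<Longrightarrow> fourier_sum G a x - fourier_sum F a x = fourier_sum (G - F) a x"
  by (simp add: fourier_sum_def sum_diff)

text \<open>Partial sums over boxes with geometrically decaying tails have summable increments in \<open>L\<^sup>1\<close>, hence
converge almost everywhere, and Fatou's lemma turns this into convergence in \<open>L\<^sup>2\<close>. The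
norm identity for the limit is what Parseval's identity for general functions is reduced to.\<close>

lemma riesz_fischer:
  fixes a :: "int^3 \<Rightarrow> 'a::euclidean_space"
  assumes a: "l2_le a B"
  shows "\<exists>g. sqint g \<and> (\<forall>k. fcoef g k = a k) \<and> (LINT x|torus. (norm (g x))\<^sup>2) = (\<Sum>\<^sub>\<infinity>k. (norm (a k))\<^sup>2)"
proof -
  define tot where "tot = (\<Sum>\<^sub>\<infinity>k. (norm (a k))\<^sup>2)"
  define P where "P n = (\<Sum>k\<in>lattice_box n. (norm (a k))\<^sup>2)" for n
  have le_tot: "(\<Sum>k\<in>F. (norm (a k))\<^sup>2) \<le> tot" if "finite F" for F
    unfolding tot_def by (rule finite_sum_le_infsum) (use l2_le_summable(1)[OF a] that in auto)
  have Pmono: "P m \<le> P n" if "m \<le> n" for m n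
    unfolding P_def by (rule sum_mono2) (use lattice_box_mono[OF that] in auto)
  have close: "\<exists>n. \<forall>m\<ge>n. tot - P m \<le> e" if e: "e > 0" for e
  proof -
    obtain F where F: "finite F" "dist (\<Sum>k\<in>F. (norm (a k))\<^sup>2) tot \<le> e"
      using infsum_finite_approximation[of "\<lambda>k. (norm (a k))\<^sup>2" UNIV e] l2_le_summable(1)[OF a] e by (auto simp: tot_def)
    obtain n where n: "F \<subseteq> lattice_box n" using finite_subset_lattice_box[OF F(1)] by blast
    have "(\<Sum>k\<in>F. (norm (a k))\<^sup>2) \<le> P n"
      unfolding P_def by (rule sum_mono2) (use n in auto)
    then have "tot - P m \<le> e" if "m \<ge> n" for m using F(2) Pmono[OF that] by (auto simp: dist_real_def)
    then show ?thesis by blast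
  qed
  have "\<forall>i. \<exists>n. \<forall>m\<ge>n. tot - P m \<le> (1/4) ^ i" using close by simp
  then obtain r0 where r0: "\<And>i m. m \<ge> r0 i \<Longrightarrow> tot - P m \<le> (1/4) ^ i" by metis
  define r where "r i = (\<Sum>j\<le>i. r0 j)" for i
  have r: "tot - P (r i) \<le> (1/4) ^ i" for i
    by (rule r0) (auto simp: r_def intro: member_le_sum)
  have r_mono: "r i \<le> r j" if "i \<le> j" for i j
    unfolding r_def by (rule sum_mono2) (use that in auto)
  define S where "S i = fourier_sum (lattice_box (r i)) a" for i
  have Sd: "(LINT x|torus. (norm (S j x - S i x))\<^sup>2) \<le> (1/4) ^ i" if "i \<le> j" for i j
  proof -
    have sub: "lattice_box (r i) \<subseteq> lattice_box (r j)" by (rule lattice_box_mono[OF r_mono[OF that]])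
    have "(LINT x|torus. (norm (S j x - S i x))\<^sup>2) = P (r j) - P (r i)"
      unfolding S_def fourier_sum_Diff[OF finite_lattice_box sub] norm_sq_fourier_sum[OF finite_Diff[OF finite_lattice_box]] P_def
      by (rule sum_diff[OF finite_lattice_box sub])
    also have "\<dots> \<le> tot - P (r i)" using le_tot[OF finite_lattice_box] by (simp add: P_def)
    finally show ?thesis using r[of i] by linarith
  qed
  have sS: "sqint (S i)" for i unfolding S_def by (rule sqint_fourier_sum)
  have mS: "S i \<in> borel_measurable torus" for i using sS by (simp add: sqint_def)
  have iD: "integrable torus (\<lambda>x. (norm (S j x - S i x))\<^sup>2)" for i j
    using sqint_diff[OF sS sS] by (simp add: sqint_def)
  define D where "D i x = norm (S (Suc i) x - S i x)" for i x
  have mD: "D i \<in> borel_measurable torus" for i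
    unfolding D_def using mS[measurable] by measurable
  have iD1: "integrable torus (D i)" for i
    unfolding D_def by (rule integrable_norm[OF sqint_integrable[OF sqint_diff[OF sS sS]]])
  have iD2: "integrable torus (\<lambda>x. (D i x)\<^sup>2)" for i
    using iD[of "Suc i" i] by (simp add: D_def)
  \<comment> \<open>On a space of measure 1 this follows from \<open>D \<le> \<epsilon>/2 + D\<^sup>2/(2 \<epsilon>)\<close> with \<open>\<epsilon> = 2\<^sup>-\<^sup>i\<close>.\<close>
  have D1: "(LINT x|torus. D i x) \<le> (1/2) ^ i" for i
  proof -
    have "(LINT x|torus. D i x) \<le> (LINT x|torus. (1/2) * (1/2) ^ i + (1/2) * 2 ^ i * (D i x)\<^sup>2)"
    proof (rule integral_mono)
      fix x
      have "0 \<le> (D i x * 2 ^ i - 1)\<^sup>2 * (1/2) ^ i" by simp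
      also have "\<dots> = 2 ^ i * (D i x)\<^sup>2 - 2 * D i x + (1/2) ^ i"
        by (simp add: power2_eq_square algebra_simps power_divide) 
      finally show "D i x \<le> (1/2) * (1/2) ^ i + (1/2) * 2 ^ i * (D i x)\<^sup>2" by simp
    qed (use iD2 iD1 in auto)
    also have "\<dots> = (1/2) * (1/2) ^ i + (1/2) * 2 ^ i * (LINT x|torus. (D i x)\<^sup>2)"
      using iD[of "Suc i" i] by (simp add: D_def measure_torus)
    also have "\<dots> \<le> (1/2) * (1/2) ^ i + (1/2) * 2 ^ i * (1/4) ^ i"
      using Sd[of i "Suc i"] by (intro add_left_mono mult_left_mono) (auto simp: D_def)
    also have "\<dots> = (1/2) ^ i"
    proof -
      have "2 ^ i * (1/4) ^ i = ((1/2) ^ i :: real)" by (simp flip: power_mult_distrib)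
      then show ?thesis by (simp only: mult.assoc)
    qed
    finally show ?thesis .
  qed
  have "(\<integral>\<^sup>+x. (\<Sum>i. ennreal (D i x)) \<partial>torus) = (\<Sum>i. \<integral>\<^sup>+x. ennreal (D i x) \<partial>torus)"
    by (rule nn_integral_suminf) (use mD in measurable)
  also have "\<dots> = (\<Sum>i. ennreal (LINT x|torus. D i x))"
  proof -
    have "(\<integral>\<^sup>+x. ennreal (D i x) \<partial>torus) = ennreal (LINT x|torus. D i x)" for i
      by (rule nn_integral_eq_integral[OF iD1]) (simp add: D_def)
    then show ?thesis by simp
  qed
  also have "\<dots> \<le> (\<Sum>i. ennreal ((1/2) ^ i))"
    by (intro suminf_le ennreal_leI D1) auto
  also have "\<dots> = ennreal (\<Sum>i. (1/2) ^ i)"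
    by (rule suminf_ennreal2) (auto simp: summable_geometric)
  finally have "(\<integral>\<^sup>+x. (\<Sum>i. ennreal (D i x)) \<partial>torus) \<noteq> \<infinity>"
    by (simp add: top.not_eq_extremum ennreal_less_top le_less_trans)
  then have "AE x in torus. (\<Sum>i. ennreal (D i x)) \<noteq> \<infinity>"
    by (intro nn_integral_PInf_AE) (use mD in measurable)
  then have conv: "AE x in torus. convergent (\<lambda>i. S i x)"
  proof eventually_elim
    case (elim x)
    have "summable (\<lambda>i. D i x)"
      by (rule summable_suminf_not_top) (use elim in \<open>auto simp: D_def\<close>)
    then have "summable (\<lambda>i. S (Suc i) x - S i x)" unfolding D_def by (rule summable_norm_cancel)
    then have "convergent (\<lambda>n. \<Sum>i<n. S (Suc i) x - S i x)" by (simp add: summable_iff_convergent)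
    then have "convergent (\<lambda>n. S n x - S 0 x)" unfolding sum_lessThan_telescope[of "\<lambda>n. S n x"] .
    then show ?case using convergent_add[of "\<lambda>n. S n x - S 0 x" "\<lambda>_. S 0 x"] by (simp add: convergent_const)
  qed
  define g where "g x = lim (\<lambda>i. S i x)" for x
  have mg: "g \<in> borel_measurable torus"
    unfolding g_def by (rule borel_measurable_lim_metric[OF mS])
  have fatou: "(\<integral>\<^sup>+x. ennreal ((norm (g x - S i x))\<^sup>2) \<partial>torus) \<le> ennreal ((1/4) ^ i)" for i
  proof -
    have "(\<integral>\<^sup>+x. ennreal ((norm (g x - S i x))\<^sup>2) \<partial>torus) = (\<integral>\<^sup>+x. liminf (\<lambda>j. ennreal ((norm (S j x - S i x))\<^sup>2)) \<partial>torus)"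
    proof (rule nn_integral_cong_AE, use conv in eventually_elim)
      case (elim x)
      then have "(\<lambda>j. S j x) \<longlonglongrightarrow> g x" by (simp add: g_def convergent_LIMSEQ_iff)
      then have "(\<lambda>j. ennreal ((norm (S j x - S i x))\<^sup>2)) \<longlonglongrightarrow> ennreal ((norm (g x - S i x))\<^sup>2)"
        by (intro tendsto_intros)
      then show ?case by (metis lim_imp_Liminf sequentially_bot)
    qed
    also have "\<dots> \<le> liminf (\<lambda>j. \<integral>\<^sup>+x. ennreal ((norm (S j x - S i x))\<^sup>2) \<partial>torus)"
      by (rule nn_integral_liminf) (use mS in measurable)
    also have "\<dots> \<le> ennreal ((1/4) ^ i)"
    proof (rule Liminf_le)
      show "\<forall>\<^sub>F j in sequentially. (\<integral>\<^sup>+x. ennreal ((norm (S j x - S i x))\<^sup>2) \<partial>torus) \<le> ennreal ((1/4) ^ i)"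
        using eventually_ge_at_top[of i]
        by eventually_elim (simp add: nn_integral_eq_integral iD Sd ennreal_leI)
    qed simp
    finally show ?thesis .
  qed
  have sgS: "sqint (\<lambda>x. g x - S i x)" for i
    unfolding sqint_def
  proof
    show m: "(\<lambda>x. g x - S i x) \<in> borel_measurable torus" using mg mS by (rule borel_measurable_diff)
    show "integrable torus (\<lambda>x. (norm (g x - S i x))\<^sup>2)"
      by (rule integrableI_nonneg) (use m fatou[of i] in \<open>auto simp: le_less_trans\<close>)
  qed
  have sg: "sqint g" using sqint_add[OF sgS[of 0] sS[of 0]] by simp
  have gS: "(LINT x|torus. (norm (g x - S i x))\<^sup>2) \<le> (1/4) ^ i" for i
  proof -
    have "ennreal (LINT x|torus. (norm (g x - S i x))\<^sup>2) = (\<integral>\<^sup>+x. ennreal ((norm (g x - S i x))\<^sup>2) \<partial>torus)"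
      by (rule nn_integral_eq_integral[symmetric]) (use sgS[of i] in \<open>auto simp: sqint_def\<close>)
    also note fatou[of i]
    finally show ?thesis by (subst (asm) ennreal_le_iff) auto
  qed
  have lim4: "(\<lambda>i. (1/4 :: real) ^ i) \<longlonglongrightarrow> 0" by (rule LIMSEQ_power_zero) simp
  have unb: "\<exists>N. \<forall>i\<ge>N. k \<in> lattice_box (r i) \<or> a k = 0" for k
  proof (cases "a k = 0")
    case False
    have "\<exists>N. (1/4) ^ N < (norm (a k))\<^sup>2" using False by (intro real_arch_pow_inv) auto
    then obtain N where N: "(1/4) ^ N < (norm (a k))\<^sup>2" by blast
    have "k \<in> lattice_box (r i)" if "i \<ge> N" for i
    proof (rule ccontr)
      assume "k \<notin> lattice_box (r i)"
      then have "P (r i) + (norm (a k))\<^sup>2 = (\<Sum>k\<in>insert k (lattice_box (r i)). (norm (a k))\<^sup>2)" by (simp add: P_def)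
      also have "\<dots> \<le> tot" by (rule le_tot) simp
      finally have "(norm (a k))\<^sup>2 \<le> (1/4) ^ i" using r[of i] by linarith
      also have "\<dots> \<le> (1/4) ^ N" using that by (intro power_decreasing) auto
      finally show False using N by linarith
    qed
    then show ?thesis by blast
  qed auto
  have fcg: "fcoef g k = a k" for k
  proof -
    obtain N where N: "\<And>i. i \<ge> N \<Longrightarrow> k \<in> lattice_box (r i) \<or> a k = 0" using unb by blast
    have "(norm (fcoef g k - a k))\<^sup>2 \<le> (1/4) ^ i" if "i \<ge> N" for i
    proof -
      have "fcoef (\<lambda>x. g x - S i x) k = fcoef g k - a k"
      proof -
        have "fcoef (S i) k = a k" using N[OF that] by (auto simp: S_def fcoef_fourier_sum)
        then show ?thesis using fcoef_diff[OF sg sS, of i k] by simp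
      qed
      then show ?thesis using l2_le_component[OF bessel[OF sgS[of i]], of k] gS[of i] by simp
    qed
    then have "(norm (fcoef g k - a k))\<^sup>2 \<le> 0"
      by (intro LIMSEQ_le_const[OF lim4]) auto
    then show ?thesis by simp
  qed
  have "fcoef g = a" using fcg by auto
  have "(LINT x|torus. (norm (g x))\<^sup>2) - tot \<le> (1/4) ^ i" for i
  proof -
    have "(LINT x|torus. (norm (g x))\<^sup>2) - P (r i) \<le> (1/4) ^ i"
      using norm_sq_diff_fourier_sum[OF sg finite_lattice_box, of "r i"] gS[of i] by (simp add: \<open>fcoef g = a\<close> S_def P_def)
    then show ?thesis using le_tot[OF finite_lattice_box, of "r i"] by (simp add: P_def)
  qed
  then have "(LINT x|torus. (norm (g x))\<^sup>2) - tot \<le> 0"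
    by (intro LIMSEQ_le_const[OF lim4]) auto
  moreover have "tot \<le> (LINT x|torus. (norm (g x))\<^sup>2)"
    using l2_le_summable(2)[OF bessel[OF sg]] by (simp add: \<open>fcoef g = a\<close> tot_def)
  ultimately show ?thesis using sg fcg by (intro exI[of _ g]) (auto simp: tot_def)
qed

text \<open>The function rebuilt from the coefficients agrees with the original one almost everywhere.\<close>

lemma parseval_norm:
  assumes f: "sqint f"
  shows "(LINT x|torus. (norm (f x))\<^sup>2) = (\<Sum>\<^sub>\<infinity>k. (norm (fcoef f k))\<^sup>2)"
proof -
  obtain g where g: "sqint g" "\<And>k. fcoef g k = fcoef f k" "(LINT x|torus. (norm (g x))\<^sup>2) = (\<Sum>\<^sub>\<infinity>k. (norm (fcoef f k))\<^sup>2)"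
    using riesz_fischer[OF bessel[OF f]] by blast
  have "AE x in torus. f x = g x" by (rule fcoef_eq_imp_AE_eq[OF f g(1)]) (simp add: g)
  then have "(LINT x|torus. (norm (f x))\<^sup>2) = (LINT x|torus. (norm (g x))\<^sup>2)"
    using f g(1) by (intro integral_cong_AE) (auto simp: sqint_def)
  then show ?thesis using g(3) by simp
qed

lemma parseval_inner:
  assumes f: "sqint f" and g: "sqint g"
  shows "((\<lambda>k. fcoef f k \<bullet> fcoef g k) has_sum (LINT x|torus. f x \<bullet> g x)) UNIV"
proof -
  have s: "(\<lambda>k. (norm (fcoef h k))\<^sup>2) summable_on UNIV" if "sqint h" for h :: "real^3 \<Rightarrow> 'a"
    using bessel[OF that] by (simp add: l2_le_iff)
  have i: "integrable torus (\<lambda>x. (norm (h x))\<^sup>2)" if "sqint h" for h :: "real^3 \<Rightarrow> 'a"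
    using that by (simp add: sqint_def)
  note p = sqint_add[OF f g] and m = sqint_diff[OF f g]
  have pol: "u \<bullet> v = (1/4) * (norm (u + v))\<^sup>2 + (-1/4) * (norm (u - v))\<^sup>2" for u v :: 'a
    by (simp add: power2_norm_eq_inner inner_add_left inner_add_right inner_diff_left inner_diff_right inner_commute field_simps)
  have "((\<lambda>k. (1/4) * (norm (fcoef (\<lambda>x. f x + g x) k))\<^sup>2 + (-1/4) * (norm (fcoef (\<lambda>x. f x - g x) k))\<^sup>2) has_sum
      (1/4) * (LINT x|torus. (norm (f x + g x))\<^sup>2) + (-1/4) * (LINT x|torus. (norm (f x - g x))\<^sup>2)) UNIV"
    unfolding parseval_norm[OF p] parseval_norm[OF m]
    by (intro has_sum_add has_sum_cmult_right has_sum_infsum s p m)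
  moreover have "(1/4) * (LINT x|torus. (norm (f x + g x))\<^sup>2) + (-1/4) * (LINT x|torus. (norm (f x - g x))\<^sup>2) = (LINT x|torus. f x \<bullet> g x)"
    unfolding pol using i[OF p] i[OF m] by simp
  ultimately show ?thesis
    by (simp only: fcoef_add[OF f g] fcoef_diff[OF f g] pol[symmetric])
qed

section \<open>Parseval for products\<close>

lemma sqint_linear:
  fixes f :: "real^3 \<Rightarrow> 'a::euclidean_space" and T :: "'a \<Rightarrow> 'b::euclidean_space"
  assumes f: "sqint f" and T: "bounded_linear T"
  shows "sqint (\<lambda>x. T (f x))"
proof -
  obtain K where K: "\<And>v. norm (T v) \<le> norm v * K" using bounded_linear.bounded[OF T] by blast
  have fm: "f \<in> borel_measurable torus" using f by (simp add: sqint_def)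
  have m: "(\<lambda>x. T (f x)) \<in> borel_measurable torus"
    by (rule measurable_compose[OF fm borel_measurable_continuous_onI[OF linear_continuous_on[OF T]]])
  have "integrable torus (\<lambda>x. (norm (T (f x)))\<^sup>2)"
  proof (rule Bochner_Integration.integrable_bound)
    show "integrable torus (\<lambda>x. K\<^sup>2 * (norm (f x))\<^sup>2)" using f by (simp add: sqint_def)
    show "(\<lambda>x. (norm (T (f x)))\<^sup>2) \<in> borel_measurable torus" using m[measurable] by measurable
    have "(norm (T (f x)))\<^sup>2 \<le> K\<^sup>2 * (norm (f x))\<^sup>2" for x
      using power_mono[OF K[of "f x"] norm_ge_zero, of 2] by (simp add: power_mult_distrib mult.commute)
    then show "AE x in torus. norm ((norm (T (f x)))\<^sup>2) \<le> norm (K\<^sup>2 * (norm (f x))\<^sup>2)" by simp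
  qed
  then show ?thesis using m by (simp add: sqint_def)
qed

lemma l2_le_norm_iff: "l2_le (\<lambda>k. norm (a k)) B \<longleftrightarrow> l2_le a B"
  by (simp add: l2_le_def)

lemma parseval_scaleR:
  fixes f :: "real^3 \<Rightarrow> real" and g :: "real^3 \<Rightarrow> 'a::euclidean_space"
  assumes f: "sqint f" and g: "sqint g"
  shows "((\<lambda>j. fcoef f j *\<^sub>R fcoef g j) has_sum (LINT x|torus. f x *\<^sub>R g x)) UNIV"
proof -
  have "(\<lambda>j. norm (fcoef f j) \<bullet> norm (fcoef g j)) summable_on UNIV"
    by (rule l2_le_inner[OF l2_le_norm_iff[THEN iffD2, OF bessel[OF f]] l2_le_norm_iff[THEN iffD2, OF bessel[OF g]]])
  then have "(\<lambda>j. norm (fcoef f j *\<^sub>R fcoef g j)) summable_on UNIV"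
    by (simp only: norm_scaleR inner_real_def real_norm_def)
  then have s: "(\<lambda>j. fcoef f j *\<^sub>R fcoef g j) summable_on UNIV"
    by (rule abs_summable_summable)
  have "(\<Sum>\<^sub>\<infinity>j. fcoef f j *\<^sub>R fcoef g j) = (LINT x|torus. f x *\<^sub>R g x)"
  proof (rule euclidean_eqI)
    fix b :: 'a assume "b \<in> Basis"
    have bl: "bounded_linear (\<lambda>v::'a. v \<bullet> b)" by (rule bounded_linear_inner_left)
    have "((\<lambda>j. (fcoef f j *\<^sub>R fcoef g j) \<bullet> b) has_sum (\<Sum>\<^sub>\<infinity>j. fcoef f j *\<^sub>R fcoef g j) \<bullet> b) UNIV"
      by (rule has_sum_bounded_linear[OF bl has_sum_infsum[OF s]])
    moreover have "((\<lambda>j. (fcoef f j *\<^sub>R fcoef g j) \<bullet> b) has_sum (LINT x|torus. f x *\<^sub>R g x) \<bullet> b) UNIV"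
    proof -
      have "(LINT x|torus. f x *\<^sub>R g x) \<bullet> b = (LINT x|torus. (f x *\<^sub>R g x) \<bullet> b)"
        by (rule integral_inner_left[symmetric]) (rule sqint_scaleR_integrable[OF f g])
      then show ?thesis
        using parseval_inner[OF f sqint_linear[OF g bl]]
        by (simp only: fcoef_linear[OF g bl] inner_scaleR_left inner_real_def)
    qed
    ultimately show "(\<Sum>\<^sub>\<infinity>j. fcoef f j *\<^sub>R fcoef g j) \<bullet> b = (LINT x|torus. f x *\<^sub>R g x) \<bullet> b"
      by (rule has_sum_unique)
  qed
  then show ?thesis using has_sum_infsum[OF s] by simp
qed

lemma fcoef_cas_mult:
  fixes g :: "real^3 \<Rightarrow> 'a::euclidean_space"
  assumes g: "sqint g"
  shows "fcoef (\<lambda>x. cas k x *\<^sub>R g x) j = (1/2) *\<^sub>R (fcoef g (j + k) + fcoef g (j - k) + fcoef g (k - j) - fcoef g (- k - j))"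
proof -
  have i: "integrable torus (\<lambda>x. cas l x *\<^sub>R g x)" for l by (intro sqint_integrable sqint_cas_mult g)
  have "cas j x *\<^sub>R cas k x *\<^sub>R g x = (1/2) *\<^sub>R (cas (j + k) x *\<^sub>R g x + cas (j - k) x *\<^sub>R g x + cas (k - j) x *\<^sub>R g x - cas (- k - j) x *\<^sub>R g x)" for x
  proof -
    have "- j - k = - k - j" by simp
    then show ?thesis unfolding scaleR_scaleR cas_mult by (simp only:) (simp add: algebra_simps)
  qed
  then show ?thesis
    unfolding fcoef_def using i by simp
qed

text \<open>Parseval for \<open>f\<close> and \<open>cas k \<sqdot> g\<close>, because multiplication by a basis function only moves frequencies.\<close>

theorem fcoef_prod:
  fixes g :: "real^3 \<Rightarrow> 'a::euclidean_space"
  assumes f: "sqint f" and g: "sqint g"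
  shows "fcoef (\<lambda>x. f x *\<^sub>R g x) k = prod_coef (fcoef f) (fcoef g) k"
proof -
  have "fcoef (\<lambda>x. f x *\<^sub>R g x) k = (LINT x|torus. f x *\<^sub>R (cas k x *\<^sub>R g x))"
    by (simp add: fcoef_def mult.commute)
  also have "\<dots> = (\<Sum>\<^sub>\<infinity>j. fcoef f j *\<^sub>R fcoef (\<lambda>x. cas k x *\<^sub>R g x) j)"
    by (rule infsumI[symmetric], rule parseval_scaleR[OF f sqint_cas_mult[OF g]])
  also have "\<dots> = (\<Sum>\<^sub>\<infinity>j. (1/2) *\<^sub>R (fcoef f j *\<^sub>R (fcoef g (j + k) + fcoef g (j - k) + fcoef g (k - j) - fcoef g (- k - j))))"
    unfolding fcoef_cas_mult[OF g] by (simp only: scaleR_left_commute)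
  finally show ?thesis by (simp only: prod_coef_def infsum_scaleR_right)
qed

section \<open>Derivatives as Fourier multipliers\<close>

text \<open>Since \<open>\<partial>\<^sub>i cas k = 2 \<pi> k\<^sub>i cas (-k)\<close>, the step from \<open>n\<close> to \<open>n + 1\<close> derivatives contributes the sign
\<open>(-1)\<^sup>n\<close>.\<close>

fun deriv_sign :: "nat \<Rightarrow> real" where
  "deriv_sign 0 = 1"
| "deriv_sign (Suc n) = (-1) ^ n * deriv_sign n"

lemma deriv_sign_sq: "(deriv_sign n)\<^sup>2 = 1"
  by (induction n) (auto simp: power_mult_distrib simp flip: power_mult)

definition reflect :: "nat \<Rightarrow> int^3 \<Rightarrow> int^3" where
  "reflect n k = (if even n then k else - k)"

lemma reflect_reflect [simp]: "reflect n (reflect n k) = k" by (simp add: reflect_def)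

lemma inj_reflect: "inj (reflect n)" by (metis injI reflect_reflect)

lemma bij_reflect: "bij_betw (reflect n) UNIV UNIV"
  by (rule bij_betw_byWitness[where f' = "reflect n"]) auto

definition freq_prod :: "3 list \<Rightarrow> int^3 \<Rightarrow> real" where
  "freq_prod is k = prod_list (map (\<lambda>i. 2 * pi * freq k $ i) is)"

lemma freq_prod_Cons: "freq_prod (i # is) k = 2 * pi * freq k $ i * freq_prod is k" by (simp add: freq_prod_def)

lemma freq_prod_minus: "freq_prod is (- k) = (-1) ^ length is * freq_prod is k"
  by (induction "is") (auto simp: freq_prod_def)

lemma freq_prod_reflect: "freq_prod is (reflect (length is) k) = (-1) ^ length is * freq_prod is k"
  by (simp add: reflect_def freq_prod_minus)

lemma pdiff_cmult_cas: "pdiff i (\<lambda>x. c * cas k x) = (\<lambda>x. c * (2 * pi * freq k $ i) * cas (- k) x)"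
  by (rule ext, subst pdiff_has_derivative[OF has_derivative_mult_right[OF cas_has_derivative]])
     (simp add: inner_axis)

lemma foldr_pdiff_cas:
  "foldr pdiff is (cas k) = (\<lambda>x. deriv_sign (length is) * freq_prod is k * cas (reflect (length is) k) x)"
proof (induction "is")
  case Nil show ?case by (simp add: freq_prod_def reflect_def)
next
  case (Cons i "is")
  have "freq (reflect (length is) k) $ i = (-1) ^ length is * freq k $ i" "- reflect (length is) k = reflect (length (i # is)) k"
    by (auto simp: reflect_def)
  note eqs = this
  have "foldr pdiff (i # is) (cas k) = pdiff i (\<lambda>x. (deriv_sign (length is) * freq_prod is k) * cas (reflect (length is) k) x)"
    using Cons by simp
  also have "\<dots> = (\<lambda>x. deriv_sign (length (i # is)) * freq_prod (i # is) k * cas (reflect (length (i # is)) k) x)"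
    unfolding pdiff_cmult_cas eqs freq_prod_Cons by (simp add: mult_ac)
  finally show ?case .
qed

lemma smooth_periodic_cas: "smooth_periodic (cas k)"
  unfolding smooth_periodic_def foldr_pdiff_cas
proof (intro conjI allI)
  show "(\<lambda>x. deriv_sign (length is) * freq_prod is k * cas (reflect (length is) k) x) differentiable (at x)" for "is" x
    using has_derivative_mult_right[OF cas_has_derivative] by (auto simp: differentiable_def)
qed (rule cas_periodic)

lemma pdiff_periodic: "(\<And>x. f (x + axis j 1) = f x) \<Longrightarrow> pdiff i f (x + axis j 1) = pdiff i f x"
proof -
  assume p: "\<And>x. f (x + axis j 1) = f x"
  have "f (x + axis j 1 + s *\<^sub>R axis i 1) = f (x + s *\<^sub>R axis i 1)" for s
    using p[of "x + s *\<^sub>R axis i 1"] by (simp add: add_ac)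
  then show ?thesis by (simp add: pdiff_def)
qed

lemma foldr_pdiff_periodic_C1:
  assumes "smooth_periodic \<phi>"
  shows "periodic_C1 i (foldr pdiff is \<phi>)"
proof -
  have d: "foldr pdiff is \<phi> differentiable (at x)" for "is" x using assms by (simp add: smooth_periodic_def)
  have p: "foldr pdiff is \<phi> (x + axis j 1) = foldr pdiff is \<phi> x" for j x
    using assms by (induction "is" arbitrary: x) (auto simp: smooth_periodic_def intro: pdiff_periodic)
  have "continuous_on UNIV (foldr pdiff (i # is) \<phi>)"
    using d[of "i # is"] by (intro continuous_at_imp_continuous_on ballI differentiable_imp_continuous_within)
  then show ?thesis using d p by (simp add: periodic_C1_def)
qed

lemma sqint_foldr_pdiff:
  assumes "smooth_periodic \<phi>" shows "sqint (foldr pdiff is \<phi>)"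
  by (rule sqint_continuous[OF periodic_C1_continuous[OF foldr_pdiff_periodic_C1[OF assms]]])

lemma fcoef_pdiff:
  assumes "periodic_C1 i f"
  shows "fcoef (pdiff i f) k = - (2 * pi * freq k $ i) *\<^sub>R fcoef f (- k)"
proof -
  have "fcoef (pdiff i f) k = - (LINT x|torus. pdiff i (cas k) x *\<^sub>R f x)"
    using integral_by_parts_torus[OF periodic_C1_cas assms] by (simp add: fcoef_def)
  also have "\<dots> = - (LINT x|torus. (2 * pi * freq k $ i) *\<^sub>R (cas (- k) x *\<^sub>R f x))"
    by (simp add: pdiff_cas)
  finally show ?thesis by (simp only: integral_scaleR_right fcoef_def) simp
qed

lemma fcoef_foldr_pdiff:
  assumes "smooth_periodic \<phi>"
  shows "fcoef (foldr pdiff is \<phi>) k = (-1) ^ length is * deriv_sign (length is) * freq_prod is k * fcoef \<phi> (reflect (length is) k)"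
proof (induction "is" arbitrary: k)
  case Nil show ?case by (simp add: freq_prod_def reflect_def)
next
  case (Cons i "is")
  have r: "reflect (length is) (- k) = reflect (length (i # is)) k" by (auto simp: reflect_def)
  have "fcoef (foldr pdiff (i # is) \<phi>) k = - (2 * pi * freq k $ i) * fcoef (foldr pdiff is \<phi>) (- k)"
    using fcoef_pdiff[OF foldr_pdiff_periodic_C1[OF assms]] by simp
  also have "\<dots> = - (2 * pi * freq k $ i) * (((-1) ^ length is * (-1) ^ length is) * deriv_sign (length is) * freq_prod is k * fcoef \<phi> (reflect (length (i # is)) k))"
    unfolding Cons r freq_prod_minus by (simp only: mult_ac)
  also have "(-1) ^ length is * (-1) ^ length is = (1::real)" by (simp flip: power_mult_distrib)
  finally show ?case by (simp add: freq_prod_Cons mult_ac)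
qed

definition pdiff_list :: "nat^3 \<Rightarrow> 3 list" where
  "pdiff_list \<beta> = replicate (\<beta> $ 1) 1 @ replicate (\<beta> $ 2) 2 @ replicate (\<beta> $ 3) 3"

lemma mdiff_foldr: "mdiff \<beta> \<phi> = foldr pdiff (pdiff_list \<beta>) \<phi>"
  by (simp add: mdiff_def pdiff_list_def foldr_replicate)

lemma length_pdiff_list: "length (pdiff_list \<beta>) = multi_order \<beta>"
  by (simp add: pdiff_list_def multi_order_def sum_3)

definition freq_power :: "nat^3 \<Rightarrow> int^3 \<Rightarrow> real" where
  "freq_power \<beta> k = freq_prod (pdiff_list \<beta>) k"

lemma freq_power_alt: "freq_power \<beta> k = (2 * pi * freq k $ 1) ^ (\<beta> $ 1) * (2 * pi * freq k $ 2) ^ (\<beta> $ 2) * (2 * pi * freq k $ 3) ^ (\<beta> $ 3)"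
  by (simp add: freq_power_def freq_prod_def pdiff_list_def prod_list_replicate)

text \<open>The Fourier multiplier of a weak derivative of order \<open>n\<close>; the frequency is reflected when \<open>n\<close> is odd
  because differentiation exchanges \<open>cas k\<close> and \<open>cas (- k)\<close>.\<close>

definition deriv_mult :: "nat^3 \<Rightarrow> (int^3 \<Rightarrow> 'a::real_vector) \<Rightarrow> int^3 \<Rightarrow> 'a" where
  "deriv_mult \<beta> a k = ((-1) ^ multi_order \<beta> * deriv_sign (multi_order \<beta>) * freq_power \<beta> k) *\<^sub>R a (reflect (multi_order \<beta>) k)"

lemma weak_deriv_imp_deriv_mult:
  assumes u: "sqint u" and g: "sqint g" and w: "is_weak_deriv \<beta> u g"
  shows "fcoef g k = deriv_mult \<beta> (fcoef u) k"
proof -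
  let ?n = "multi_order \<beta>"
  have "(LINT x|torus. mdiff \<beta> (cas k) x *\<^sub>R u x) = (-1) ^ ?n *\<^sub>R fcoef g k"
    using w smooth_periodic_cas[of k] unfolding is_weak_deriv_def fcoef_def by blast
  moreover have "(LINT x|torus. mdiff \<beta> (cas k) x *\<^sub>R u x) = (LINT x|torus. (deriv_sign ?n * freq_power \<beta> k) *\<^sub>R (cas (reflect ?n k) x *\<^sub>R u x))"
    by (simp add: mdiff_foldr foldr_pdiff_cas length_pdiff_list freq_power_def)
  ultimately have eq: "(-1) ^ ?n *\<^sub>R fcoef g k = (deriv_sign ?n * freq_power \<beta> k) *\<^sub>R fcoef u (reflect ?n k)"
    by (simp only: integral_scaleR_right fcoef_def)
  have "fcoef g k = (-1) ^ ?n *\<^sub>R ((-1) ^ ?n *\<^sub>R fcoef g k)" by (simp flip: power_mult_distrib)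
  then show ?thesis unfolding eq by (simp add: deriv_mult_def mult.assoc)
qed

text \<open>Both sides of the defining identity are Parseval sums that agree term by term after a
reflection of the frequencies.\<close>

lemma deriv_mult_imp_weak_deriv:
  assumes u: "sqint u" and g: "sqint g" and eq: "\<And>k. fcoef g k = deriv_mult \<beta> (fcoef u) k"
  shows "is_weak_deriv \<beta> u g"
  unfolding is_weak_deriv_def
proof (intro allI impI)
  fix \<phi> assume \<phi>: "smooth_periodic \<phi>"
  let ?n = "multi_order \<beta>"
  have s\<phi>: "sqint \<phi>" using sqint_foldr_pdiff[OF \<phi>, of "[]"] by simp
  have sm: "sqint (mdiff \<beta> \<phi>)" unfolding mdiff_foldr by (rule sqint_foldr_pdiff[OF \<phi>])
  have 1: "((\<lambda>k. fcoef (mdiff \<beta> \<phi>) k *\<^sub>R fcoef u k) has_sum (LINT x|torus. mdiff \<beta> \<phi> x *\<^sub>R u x)) UNIV"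
    by (rule parseval_scaleR[OF sm u])
  have "((\<lambda>k. fcoef \<phi> k *\<^sub>R fcoef g k) has_sum (LINT x|torus. \<phi> x *\<^sub>R g x)) UNIV"
    by (rule parseval_scaleR[OF s\<phi> g])
  then have "((\<lambda>k. (-1) ^ ?n *\<^sub>R (fcoef \<phi> k *\<^sub>R fcoef g k)) has_sum ((-1) ^ ?n *\<^sub>R (LINT x|torus. \<phi> x *\<^sub>R g x))) UNIV"
    by (rule has_sum_scaleR)
  then have 2: "((\<lambda>k. (-1) ^ ?n *\<^sub>R (fcoef \<phi> (reflect ?n k) *\<^sub>R fcoef g (reflect ?n k))) has_sum ((-1) ^ ?n *\<^sub>R (LINT x|torus. \<phi> x *\<^sub>R g x))) UNIV"
    by (subst has_sum_reindex_bij_betw[OF bij_reflect[of ?n]])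
  have "fcoef (mdiff \<beta> \<phi>) k *\<^sub>R fcoef u k = (-1) ^ ?n *\<^sub>R (fcoef \<phi> (reflect ?n k) *\<^sub>R fcoef g (reflect ?n k))" for k
  proof -
    have "freq_power \<beta> (reflect ?n k) = (-1) ^ ?n * freq_power \<beta> k"
      using freq_prod_reflect[of "pdiff_list \<beta>" k] by (simp add: freq_power_def length_pdiff_list)
    then show ?thesis
      using fcoef_foldr_pdiff[OF \<phi>, of "pdiff_list \<beta>" k]
      by (simp add: eq deriv_mult_def mdiff_foldr length_pdiff_list freq_power_def mult_ac flip: power_mult_distrib)
  qed
  then show "(LINT x|torus. mdiff \<beta> \<phi> x *\<^sub>R u x) = (-1) ^ ?n *\<^sub>R (LINT x|torus. \<phi> x *\<^sub>R g x)"
    using 1 2 by (simp only:) (rule has_sum_unique)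
qed

lemma norm_deriv_mult: "norm (deriv_mult \<beta> a k) = norm (freq_power \<beta> (reflect (multi_order \<beta>) k) *\<^sub>R a (reflect (multi_order \<beta>) k))"
proof -
  have "\<bar>deriv_sign (multi_order \<beta>)\<bar> = 1" using deriv_sign_sq[of "multi_order \<beta>"] by (auto simp: power2_eq_1_iff)
  moreover have "\<bar>freq_power \<beta> (reflect (multi_order \<beta>) k)\<bar> = \<bar>freq_power \<beta> k\<bar>"
    using freq_prod_reflect[of "pdiff_list \<beta>" k] by (simp add: freq_power_def length_pdiff_list abs_mult)
  ultimately show ?thesis by (simp add: deriv_mult_def abs_mult)
qed

lemma l2_le_deriv_mult_iff: "l2_le (deriv_mult \<beta> a) B \<longleftrightarrow> l2_le (\<lambda>k. freq_power \<beta> k *\<^sub>R a k) B"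
proof
  assume "l2_le (deriv_mult \<beta> a) B"
  then have "l2_le (\<lambda>k. deriv_mult \<beta> a (reflect (multi_order \<beta>) k)) B" by (rule l2_le_reindex[OF _ inj_reflect])
  then show "l2_le (\<lambda>k. freq_power \<beta> k *\<^sub>R a k) B" by (rule l2_le_dom1) (simp add: norm_deriv_mult)
next
  assume "l2_le (\<lambda>k. freq_power \<beta> k *\<^sub>R a k) B"
  then have "l2_le (\<lambda>k. freq_power \<beta> (reflect (multi_order \<beta>) k) *\<^sub>R a (reflect (multi_order \<beta>) k)) B"
    by (rule l2_le_reindex[OF _ inj_reflect])
  then show "l2_le (deriv_mult \<beta> a) B" by (rule l2_le_dom1) (simp add: norm_deriv_mult)
qed

lemma ex_weak_deriv_iff:
  assumes u: "sqint u"
  shows "(\<exists>g\<in>L2. is_weak_deriv \<beta> u g) \<longleftrightarrow> (\<exists>B. l2_le (\<lambda>k. freq_power \<beta> k *\<^sub>R fcoef u k) B)"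
proof
  assume "\<exists>g\<in>L2. is_weak_deriv \<beta> u g"
  then obtain g where g: "sqint g" "is_weak_deriv \<beta> u g" by (auto simp: L2_iff_sqint)
  have "fcoef g = deriv_mult \<beta> (fcoef u)" using weak_deriv_imp_deriv_mult[OF u g] by auto
  then show "\<exists>B. l2_le (\<lambda>k. freq_power \<beta> k *\<^sub>R fcoef u k) B" using bessel[OF g(1)] l2_le_deriv_mult_iff by metis
next
  assume "\<exists>B. l2_le (\<lambda>k. freq_power \<beta> k *\<^sub>R fcoef u k) B"
  then obtain B where "l2_le (deriv_mult \<beta> (fcoef u)) B" using l2_le_deriv_mult_iff by blast
  then obtain g where g: "sqint g" "\<And>k. fcoef g k = deriv_mult \<beta> (fcoef u) k" using riesz_fischer by blast
  have "is_weak_deriv \<beta> u g" by (rule deriv_mult_imp_weak_deriv[OF u g])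
  then show "\<exists>g\<in>L2. is_weak_deriv \<beta> u g" using g(1) by (auto simp: L2_iff_sqint)
qed

lemma weak_deriv:
  assumes u: "sqint u" and B: "l2_le (\<lambda>k. freq_power \<beta> k *\<^sub>R fcoef u k) B"
  shows "sqint (weak_deriv \<beta> u)" "fcoef (weak_deriv \<beta> u) k = deriv_mult \<beta> (fcoef u) k"
proof -
  have "\<exists>g. g \<in> L2 \<and> is_weak_deriv \<beta> u g" using ex_weak_deriv_iff[OF u] B by blast
  from someI_ex[OF this] have *: "sqint (weak_deriv \<beta> u)" "is_weak_deriv \<beta> u (weak_deriv \<beta> u)"
    by (auto simp: weak_deriv_def L2_iff_sqint)
  show "sqint (weak_deriv \<beta> u)" by (rule *)
  show "fcoef (weak_deriv \<beta> u) k = deriv_mult \<beta> (fcoef u) k" by (rule weak_deriv_imp_deriv_mult[OF u *])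
qed

lemma L2_norm_sq: "(L2_norm f)\<^sup>2 = (LINT x|torus. (norm (f x))\<^sup>2)"
  by (simp add: L2_norm_def)

lemma L2_norm_weak_deriv:
  assumes u: "sqint u" and B: "l2_le (\<lambda>k. freq_power \<beta> k *\<^sub>R fcoef u k) B"
  shows "(L2_norm (weak_deriv \<beta> u))\<^sup>2 = (\<Sum>\<^sub>\<infinity>k. (norm (freq_power \<beta> k *\<^sub>R fcoef u k))\<^sup>2)"
proof -
  have "(L2_norm (weak_deriv \<beta> u))\<^sup>2 = (\<Sum>\<^sub>\<infinity>k. (norm (deriv_mult \<beta> (fcoef u) k))\<^sup>2)"
    unfolding L2_norm_sq parseval_norm[OF weak_deriv(1)[OF u B]] weak_deriv(2)[OF u B] ..
  also have "\<dots> = (\<Sum>\<^sub>\<infinity>k. (norm (freq_power \<beta> k *\<^sub>R fcoef u k))\<^sup>2)"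
    unfolding norm_deriv_mult by (rule infsum_reindex_bij_betw[OF bij_reflect])
  finally show ?thesis .
qed

section \<open>Sobolev norms as weighted sums\<close>

lemma finite_multi_order: "finite {\<beta> :: nat^3. multi_order \<beta> \<le> m}"
proof (rule finite_subset)
  show "{\<beta> :: nat^3. multi_order \<beta> \<le> m} \<subseteq> vec_lambda ` (PiE UNIV (\<lambda>_. {..m}))"
  proof
    fix \<beta> :: "nat^3" assume "\<beta> \<in> {\<beta>. multi_order \<beta> \<le> m}"
    then have "\<beta> $ i \<le> m" for i
      using member_le_sum[of i UNIV "\<lambda>i. \<beta> $ i"] by (simp add: multi_order_def)
    then have "vec_nth \<beta> \<in> PiE UNIV (\<lambda>_. {..m})" by auto
    then show "\<beta> \<in> vec_lambda ` (PiE UNIV (\<lambda>_. {..m}))" by (metis image_eqI vec_nth_inverse)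
  qed
qed (auto intro!: finite_imageI finite_PiE)

lemma abs_freq_power_le: 
  assumes "multi_order \<beta> \<le> m"
  shows "\<bar>freq_power \<beta> k\<bar> \<le> (2 * pi) ^ m * bracket k ^ m"
proof -
  have c: "\<bar>2 * pi * freq k $ i\<bar> \<le> 2 * pi * bracket k" for i
    using order_trans[OF component_le_norm_cart norm_freq_le_bracket, of k i] by (simp add: abs_mult)
  have ge1: "1 \<le> 2 * pi * bracket k"
  proof -
    have "1 * 1 \<le> (2 * pi) * bracket k" using bracket_ge1[of k] pi_gt3 by (intro mult_mono) auto
    then show ?thesis by simp
  qed
  have "\<bar>freq_power \<beta> k\<bar> \<le> (2 * pi * bracket k) ^ (\<beta> $ 1) * (2 * pi * bracket k) ^ (\<beta> $ 2) * (2 * pi * bracket k) ^ (\<beta> $ 3)"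
  proof -
    have p: "\<bar>(2 * pi * freq k $ i) ^ n\<bar> \<le> (2 * pi * bracket k) ^ n" for i n
      using power_mono[OF c abs_ge_zero] by (simp only: power_abs)
    show ?thesis
      unfolding freq_power_alt abs_mult[of "_ * _ ^ _"] abs_mult[of "_ ^ _"] using ge1 bracket_pos[of k]
      by (intro mult_mono p mult_nonneg_nonneg zero_le_power) auto
  qed
  also have "\<dots> = (2 * pi * bracket k) ^ multi_order \<beta>" by (simp add: multi_order_def sum_3 power_add)
  also have "\<dots> \<le> (2 * pi * bracket k) ^ m" using ge1 assms by (intro power_increasing) auto
  finally show ?thesis by (simp add: power_mult_distrib)
qed

definition sobolev_weight :: "nat \<Rightarrow> int^3 \<Rightarrow> real" where
  "sobolev_weight m k = (\<Sum>\<beta> | multi_order \<beta> \<le> m. (freq_power \<beta> k)\<^sup>2)"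

lemma freq_power_le_sobolev_weight: "multi_order \<beta> \<le> m \<Longrightarrow> (freq_power \<beta> k)\<^sup>2 \<le> sobolev_weight m k"
  unfolding sobolev_weight_def by (rule member_le_sum) (auto simp: finite_multi_order)

text \<open>The squared bracket is a sum of four terms, so it is at most four times 1 or four times some \<open>k\<^sub>i\<^sup>2\<close>, and the
weight contains the order \<open>0\<close> and the pure derivatives of order \<open>m\<close>.\<close>

lemma bracket_le_sobolev_weight: "(bracket k ^ m)\<^sup>2 \<le> 4 ^ m * sobolev_weight m k"
proof -
  have "(bracket k)\<^sup>2 = 1 + (freq k $ 1)\<^sup>2 + (freq k $ 2)\<^sup>2 + (freq k $ 3)\<^sup>2"
    by (simp only: bracket_sq power2_norm_eq_inner inner_vec_def sum_3) (simp add: power2_eq_square)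
  then have "(bracket k)\<^sup>2 \<le> 4 \<or> (bracket k)\<^sup>2 \<le> 4 * (freq k $ 1)\<^sup>2 \<or> (bracket k)\<^sup>2 \<le> 4 * (freq k $ 2)\<^sup>2 \<or> (bracket k)\<^sup>2 \<le> 4 * (freq k $ 3)\<^sup>2"
    by linarith
  then have "(bracket k)\<^sup>2 \<le> 4 \<or> (\<exists>i. (bracket k)\<^sup>2 \<le> 4 * (freq k $ i)\<^sup>2)" by blast
  then show ?thesis
  proof
    assume "(bracket k)\<^sup>2 \<le> 4"
    then have "((bracket k)\<^sup>2) ^ m \<le> 4 ^ m * 1" by (simp add: power_mono)
    also have "\<dots> \<le> 4 ^ m * sobolev_weight m k"
      using freq_power_le_sobolev_weight[of 0 m k] by (intro mult_left_mono) (auto simp: multi_order_def freq_power_alt)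
    finally show ?thesis by (simp add: power_mult[symmetric] mult.commute)
  next
    assume "\<exists>i. (bracket k)\<^sup>2 \<le> 4 * (freq k $ i)\<^sup>2"
    then obtain i where "(bracket k)\<^sup>2 \<le> 4 * (freq k $ i)\<^sup>2" by blast
    also have "\<dots> \<le> 4 * (2 * pi * freq k $ i)\<^sup>2"
    proof -
      have "1 \<le> (2 * pi)\<^sup>2" using pi_gt3 by (intro one_le_power) auto
      then have "1 * (freq k $ i)\<^sup>2 \<le> (2 * pi)\<^sup>2 * (freq k $ i)\<^sup>2" by (rule mult_right_mono) simp
      then show ?thesis by (simp add: power_mult_distrib)
    qed
    finally have "((bracket k)\<^sup>2) ^ m \<le> (4 * (2 * pi * freq k $ i)\<^sup>2) ^ m" by (intro power_mono) auto
    also have "\<dots> = 4 ^ m * (freq_power (axis i m) k)\<^sup>2"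
    proof -
      have "freq_power (axis i m) k = (2 * pi * freq k $ i) ^ m"
        using exhaust_3[of i] by (auto simp: freq_power_alt axis_def)
      moreover have "(4 * x\<^sup>2) ^ m = 4 ^ m * (x ^ m)\<^sup>2" for x :: real
        by (simp only: power_mult_distrib power_mult[symmetric] mult.commute)
      ultimately show ?thesis by (simp only:)
    qed
    also have "\<dots> \<le> 4 ^ m * sobolev_weight m k"
      by (intro mult_left_mono freq_power_le_sobolev_weight) (auto simp: multi_order_def axis_def)
    finally show ?thesis by (simp add: power_mult[symmetric] mult.commute)
  qed
qed

definition sobolev_const :: "nat \<Rightarrow> real" where
  "sobolev_const m = real (card {\<beta> :: nat^3. multi_order \<beta> \<le> m}) * ((2 * pi) ^ m)\<^sup>2"

lemma sobolev_const_nonneg: "0 \<le> sobolev_const m" by (simp add: sobolev_const_def)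

lemma sobolev_weight_le: "sobolev_weight m k \<le> sobolev_const m * (bracket k ^ m)\<^sup>2"
proof -
  have "sobolev_weight m k \<le> (\<Sum>\<beta> :: nat^3 | multi_order \<beta> \<le> m. ((2 * pi) ^ m * bracket k ^ m)\<^sup>2)"
    unfolding sobolev_weight_def using abs_freq_power_le by (intro sum_mono) (simp add: abs_le_square_iff[symmetric] less_imp_le[OF bracket_pos] abs_mult)
  then show ?thesis by (simp add: sobolev_const_def power_mult_distrib)
qed

lemma bracket_weight_le_sobolev_weight: "(norm (bracket k ^ m *\<^sub>R v))\<^sup>2 \<le> 4 ^ m * sobolev_weight m k * (norm v)\<^sup>2"
  for v :: "'a::real_normed_vector"
  using mult_right_mono[OF bracket_le_sobolev_weight, of "(norm v)\<^sup>2" k m]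
  by (simp only: norm_scaleR power_mult_distrib power2_abs real_norm_def zero_le_power2)

lemma sobolev_weight_le_bracket_weight: "sobolev_weight m k * (norm v)\<^sup>2 \<le> sobolev_const m * (norm (bracket k ^ m *\<^sub>R v))\<^sup>2"
  for v :: "'a::real_normed_vector"
  using mult_right_mono[OF sobolev_weight_le, of "(norm v)\<^sup>2" m k]
  by (simp only: norm_scaleR power_mult_distrib power2_abs real_norm_def zero_le_power2 mult.assoc)

lemma sobolev_iff: "u \<in> sobolev m \<longleftrightarrow> sqint u \<and> (\<exists>B. l2_le (\<lambda>k. bracket k ^ m *\<^sub>R fcoef u k) B)"
proof
  assume "u \<in> sobolev m"
  then have u: "sqint u" and w: "\<And>\<beta>. multi_order \<beta> \<le> m \<Longrightarrow> \<exists>B. l2_le (\<lambda>k. freq_power \<beta> k *\<^sub>R fcoef u k) B"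
    using ex_weak_deriv_iff by (auto simp: sobolev_def L2_iff_sqint)
  then obtain B where B: "\<And>\<beta>. multi_order \<beta> \<le> m \<Longrightarrow> l2_le (\<lambda>k. freq_power \<beta> k *\<^sub>R fcoef u k) (B \<beta>)" by metis
  have "l2_le (\<lambda>k. bracket k ^ m *\<^sub>R fcoef u k) (4 ^ m * (\<Sum>\<beta> | multi_order \<beta> \<le> m. B \<beta>))"
  proof (rule l2_leI)
    fix F :: "(int^3) set" assume F: "finite F"
    have "(\<Sum>k\<in>F. (norm (bracket k ^ m *\<^sub>R fcoef u k))\<^sup>2) \<le> (\<Sum>k\<in>F. 4 ^ m * sobolev_weight m k * (norm (fcoef u k))\<^sup>2)"
      by (intro sum_mono bracket_weight_le_sobolev_weight)
    also have "\<dots> = 4 ^ m * (\<Sum>\<beta> | multi_order \<beta> \<le> m. \<Sum>k\<in>F. (norm (freq_power \<beta> k *\<^sub>R fcoef u k))\<^sup>2)"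
      unfolding sobolev_weight_def
      by (subst sum.swap) (simp only: sum_distrib_left sum_distrib_right norm_scaleR power_mult_distrib power2_abs real_norm_def mult.assoc)
    also have "\<dots> \<le> 4 ^ m * (\<Sum>\<beta> | multi_order \<beta> \<le> m. B \<beta>)"
      by (intro mult_left_mono sum_mono l2_leD[OF B F]) auto
    finally show "(\<Sum>k\<in>F. (norm (bracket k ^ m *\<^sub>R fcoef u k))\<^sup>2) \<le> 4 ^ m * (\<Sum>\<beta> | multi_order \<beta> \<le> m. B \<beta>)" .
  qed
  then show "sqint u \<and> (\<exists>B. l2_le (\<lambda>k. bracket k ^ m *\<^sub>R fcoef u k) B)" using u by blast
next
  assume *: "sqint u \<and> (\<exists>B. l2_le (\<lambda>k. bracket k ^ m *\<^sub>R fcoef u k) B)"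
  then obtain B where B: "l2_le (\<lambda>k. bracket k ^ m *\<^sub>R fcoef u k) B" by blast
  have "\<exists>B. l2_le (\<lambda>k. freq_power \<beta> k *\<^sub>R fcoef u k) B" if "multi_order \<beta> \<le> m" for \<beta>
  proof (rule exI, rule l2_le_dom[OF B, where c = "(2 * pi) ^ m"])
    fix k
    have "\<bar>freq_power \<beta> k\<bar> * norm (fcoef u k) \<le> ((2 * pi) ^ m * bracket k ^ m) * norm (fcoef u k)"
      by (rule mult_right_mono[OF abs_freq_power_le[OF that]]) simp
    then show "norm (freq_power \<beta> k *\<^sub>R fcoef u k) \<le> (2 * pi) ^ m * norm (bracket k ^ m *\<^sub>R fcoef u k)"
      using bracket_pos[of k] by (simp only: norm_scaleR abs_of_pos zero_less_power mult.assoc)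
  qed
  then show "u \<in> sobolev m" using * ex_weak_deriv_iff by (auto simp: sobolev_def L2_iff_sqint)
qed

lemma sobolev_norm_eq:
  assumes "u \<in> sobolev m"
  shows "((\<lambda>k. sobolev_weight m k * (norm (fcoef u k))\<^sup>2) has_sum (sobolev_norm m u)\<^sup>2) UNIV"
proof -
  have u: "sqint u" using assms by (simp add: sobolev_iff)
  have w: "\<exists>B. l2_le (\<lambda>k. freq_power \<beta> k *\<^sub>R fcoef u k) B" if "multi_order \<beta> \<le> m" for \<beta>
    using assms that ex_weak_deriv_iff[OF u] by (auto simp: sobolev_def)
  have s: "((\<lambda>k. (norm (freq_power \<beta> k *\<^sub>R fcoef u k))\<^sup>2) has_sum (L2_norm (weak_deriv \<beta> u))\<^sup>2) UNIV" if "multi_order \<beta> \<le> m" for \<beta>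
  proof -
    obtain B where B: "l2_le (\<lambda>k. freq_power \<beta> k *\<^sub>R fcoef u k) B" using w[OF \<open>multi_order \<beta> \<le> m\<close>] by blast
    show ?thesis unfolding L2_norm_weak_deriv[OF u B] by (rule has_sum_infsum[OF l2_le_summable(1)[OF B]])
  qed
  have "((\<lambda>k. \<Sum>\<beta> | multi_order \<beta> \<le> m. (norm (freq_power \<beta> k *\<^sub>R fcoef u k))\<^sup>2) has_sum (\<Sum>\<beta> | multi_order \<beta> \<le> m. (L2_norm (weak_deriv \<beta> u))\<^sup>2)) UNIV"
  proof -
    have "((\<lambda>k. \<Sum>\<beta>\<in>S. (norm (freq_power \<beta> k *\<^sub>R fcoef u k))\<^sup>2) has_sum (\<Sum>\<beta>\<in>S. (L2_norm (weak_deriv \<beta> u))\<^sup>2)) UNIV"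
      if "finite S" "\<forall>\<beta>\<in>S. multi_order \<beta> \<le> m" for S
      using that
    proof (induction S)
      case (insert \<beta> S)
      have "((\<lambda>k. (norm (freq_power \<beta> k *\<^sub>R fcoef u k))\<^sup>2 + (\<Sum>\<beta>\<in>S. (norm (freq_power \<beta> k *\<^sub>R fcoef u k))\<^sup>2)) has_sum
          (L2_norm (weak_deriv \<beta> u))\<^sup>2 + (\<Sum>\<beta>\<in>S. (L2_norm (weak_deriv \<beta> u))\<^sup>2)) UNIV"
        by (rule has_sum_add) (use insert s in auto)
      then show ?case using insert.hyps by simp
    qed simp
    from this[OF finite_multi_order] show ?thesis by blast
  qed
  moreover have "(\<Sum>\<beta> | multi_order \<beta> \<le> m. (norm (freq_power \<beta> k *\<^sub>R fcoef u k))\<^sup>2) = sobolev_weight m k * (norm (fcoef u k))\<^sup>2" for k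
    by (simp only: sobolev_weight_def sum_distrib_right norm_scaleR power_mult_distrib power2_abs real_norm_def)
  moreover have "(sobolev_norm m u)\<^sup>2 = (\<Sum>\<beta> | multi_order \<beta> \<le> m. (L2_norm (weak_deriv \<beta> u))\<^sup>2)"
    by (simp add: sobolev_norm_def sum_nonneg)
  ultimately show ?thesis by (simp only:)
qed

lemma sobolev_norm_nonneg: "0 \<le> sobolev_norm m u"
  by (simp add: sobolev_norm_def sum_nonneg)

lemma sobolev_norm_lower:
  assumes "u \<in> sobolev m"
  shows "l2_le (\<lambda>k. bracket k ^ m *\<^sub>R fcoef u k) (4 ^ m * (sobolev_norm m u)\<^sup>2)"
proof (rule l2_leI)
  fix F :: "(int^3) set" assume F: "finite F"
  have "(\<Sum>k\<in>F. (norm (bracket k ^ m *\<^sub>R fcoef u k))\<^sup>2) \<le> (\<Sum>k\<in>F. 4 ^ m * sobolev_weight m k * (norm (fcoef u k))\<^sup>2)"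
    by (intro sum_mono bracket_weight_le_sobolev_weight)
  also have "\<dots> = 4 ^ m * (\<Sum>k\<in>F. sobolev_weight m k * (norm (fcoef u k))\<^sup>2)"
    by (simp add: sum_distrib_left mult.assoc)
  also have "\<dots> \<le> 4 ^ m * (sobolev_norm m u)\<^sup>2"
    by (intro mult_left_mono finite_sum_le_has_sum[OF sobolev_norm_eq[OF assms]] F) (auto simp: sobolev_weight_def sum_nonneg)
  finally show "(\<Sum>k\<in>F. (norm (bracket k ^ m *\<^sub>R fcoef u k))\<^sup>2) \<le> 4 ^ m * (sobolev_norm m u)\<^sup>2" .
qed

lemma sobolev_norm_upper:
  assumes u: "sqint u" and B: "l2_le (\<lambda>k. bracket k ^ m *\<^sub>R fcoef u k) B"
  shows "(sobolev_norm m u)\<^sup>2 \<le> sobolev_const m * B"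
proof -
  have "u \<in> sobolev m" using assms sobolev_iff by blast
  then show ?thesis
  proof (rule has_sum_le_finite_sums[OF sobolev_norm_eq])
    fix F :: "(int^3) set" assume F: "finite F" "F \<subseteq> UNIV"
    have "(\<Sum>k\<in>F. sobolev_weight m k * (norm (fcoef u k))\<^sup>2) \<le> (\<Sum>k\<in>F. sobolev_const m * (norm (bracket k ^ m *\<^sub>R fcoef u k))\<^sup>2)"
      by (intro sum_mono sobolev_weight_le_bracket_weight)
    also have "\<dots> \<le> sobolev_const m * B"
      using l2_leD[OF B F(1)] sobolev_const_nonneg by (simp flip: sum_distrib_left add: mult_left_mono)
    finally show "(\<Sum>k\<in>F. sobolev_weight m k * (norm (fcoef u k))\<^sup>2) \<le> sobolev_const m * B" .
  qed
qed

section \<open>Solenoidal fields and their coefficients\<close>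

text \<open>Vanishing mean and divergence, read off from the coefficients.\<close>

definition solenoidal :: "(int^3 \<Rightarrow> real^3) \<Rightarrow> bool" where
  "solenoidal a \<longleftrightarrow> a 0 = 0 \<and> (\<forall>k. a k \<bullet> freq k = 0)"

lemma solenoidal_leray_symbol: "solenoidal a \<Longrightarrow> leray_symbol k (a k) = a k"
  by (cases "k = 0") (auto simp: solenoidal_def leray_symbol_id)

lemma solenoidal_scaleR_leray_symbol: "solenoidal (\<lambda>k. c k *\<^sub>R leray_symbol k (a k))"
  by (simp add: solenoidal_def leray_symbol_orth)

lemma fourier_sum_has_derivative:
  "(fourier_sum F a has_derivative (\<lambda>h. \<Sum>k\<in>F. (2 * pi * (freq k \<bullet> h) * cas (- k) x) *\<^sub>R a k)) (at x)"
  unfolding fourier_sum_def[abs_def]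
  by (intro has_derivative_sum has_derivative_scaleR_left cas_has_derivative)

lemma pdiff_fourier_sum: "pdiff i (fourier_sum F a) x = (\<Sum>k\<in>F. (2 * pi * freq k $ i * cas (- k) x) *\<^sub>R a k)"
  by (simp add: pdiff_has_derivative[OF fourier_sum_has_derivative] inner_axis)

lemma continuous_on_pdiff_fourier_sum: "continuous_on S (pdiff i (fourier_sum F a))"
proof -
  have "pdiff i (fourier_sum F a) = (\<lambda>x. \<Sum>k\<in>F. (2 * pi * freq k $ i * cas (- k) x) *\<^sub>R a k)" by (rule ext) (rule pdiff_fourier_sum)
  then show ?thesis
    by (simp only:) (intro continuous_on_sum continuous_on_scaleR continuous_on_mult continuous_on_cas continuous_on_const)
qed

lemma periodic_C1_fourier_sum: "periodic_C1 i (fourier_sum F a)"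
  unfolding periodic_C1_def
proof (intro conjI allI)
  show "fourier_sum F a differentiable (at x)" for x using fourier_sum_has_derivative by (auto simp: differentiable_def)
  show "continuous_on UNIV (pdiff i (fourier_sum F a))" by (rule continuous_on_pdiff_fourier_sum)
  show "fourier_sum F a (x + axis i 1) = fourier_sum F a x" for x by (simp add: fourier_sum_def cas_periodic)
qed

lemma divergence_fourier_sum: "divergence (fourier_sum F a) x = (\<Sum>k\<in>F. cas (- k) x *\<^sub>R (2 * pi * (a k \<bullet> freq k)))"
proof -
  have "divergence (fourier_sum F a) x = (\<Sum>i\<in>UNIV. \<Sum>k\<in>F. (2 * pi * freq k $ i * cas (- k) x) * a k $ i)"
    unfolding divergence_def pdiff_fourier_sum by simp
  also have "\<dots> = (\<Sum>k\<in>F. \<Sum>i\<in>UNIV. (2 * pi * freq k $ i * cas (- k) x) * a k $ i)"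
    by (rule sum.swap)
  also have "\<dots> = (\<Sum>k\<in>F. cas (- k) x *\<^sub>R (2 * pi * (a k \<bullet> freq k)))"
    by (rule sum.cong) (simp_all add: inner_vec_def sum_distrib_left mult_ac)
  finally show ?thesis .
qed

lemma fcoef_0: "fcoef f 0 = (LINT x|torus. f x)"
  by (simp add: fcoef_def)

lemma freq_inner_sum: "(\<Sum>i\<in>UNIV. real_of_int (k $ i) * x $ i) = freq k \<bullet> x"
  by (simp add: inner_vec_def)

lemma fourier_sum_solenoidal:
  assumes F: "finite F" and a: "solenoidal a"
  shows "fourier_sum F a \<in> solenoidal_trig"
proof -
  have "trig_poly (fourier_sum F a)"
    unfolding trig_poly_def freq_inner_sum
    by (intro exI[of _ F] exI[of _ a] conjI F ext) (simp add: fourier_sum_def cas_def scaleR_add_left)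
  moreover have "divergence (fourier_sum F a) x = 0" for x
    using a by (simp add: divergence_fourier_sum solenoidal_def)
  moreover have "(LINT x|torus. fourier_sum F a x) = 0"
    using a fcoef_fourier_sum[OF F, of a 0] by (simp add: fcoef_0 solenoidal_def)
  ultimately show ?thesis by (simp add: solenoidal_trig_def)
qed

text \<open>A pair of a cosine and a sine of frequency \<open>k\<close> is a combination of the basis functions of \<open>k\<close> and \<open>-k\<close>.\<close>

lemma trig_poly_fourier_sum:
  assumes "trig_poly \<phi>"
  shows "\<exists>F c. finite F \<and> \<phi> = fourier_sum F c"
proof -
  obtain K :: "(int^3) set" and a b where K: "finite K"
    and \<phi>: "\<phi> = (\<lambda>x. \<Sum>k\<in>K. cos (2 * pi * (freq k \<bullet> x)) *\<^sub>R a k + sin (2 * pi * (freq k \<bullet> x)) *\<^sub>R b k)"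
    using assms unfolding trig_poly_def freq_inner_sum by blast
  define p where "p k = (if k \<in> K then (1/2) *\<^sub>R (a k + b k) else 0)" for k
  define q where "q k = (if - k \<in> K then (1/2) *\<^sub>R (a (- k) - b (- k)) else 0)" for k
  define F where "F = K \<union> uminus ` K"
  have F: "finite F" using K by (simp add: F_def)
  have "\<phi> x = fourier_sum F (\<lambda>k. p k + q k) x" for x
  proof -
    have "(\<Sum>k\<in>F. cas k x *\<^sub>R p k) = (\<Sum>k\<in>K. cas k x *\<^sub>R p k)"
      by (rule sum.mono_neutral_right[OF F]) (auto simp: F_def p_def)
    moreover have "(\<Sum>k\<in>F. cas k x *\<^sub>R q k) = (\<Sum>k\<in>uminus ` K. cas k x *\<^sub>R q k)"
    proof (rule sum.mono_neutral_right[OF F])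
      show "\<forall>k\<in>F - uminus ` K. cas k x *\<^sub>R q k = 0"
      proof
        fix k assume k: "k \<in> F - uminus ` K"
        have "- k \<notin> K"
        proof
          assume "- k \<in> K"
          then have "- (- k) \<in> uminus ` K" by (rule imageI)
          then show False using k by simp
        qed
        then show "cas k x *\<^sub>R q k = 0" by (simp add: q_def)
      qed
    qed (simp add: F_def)
    moreover have "(\<Sum>k\<in>uminus ` K. cas k x *\<^sub>R q k) = (\<Sum>k\<in>K. cas (- k) x *\<^sub>R q (- k))"
      by (subst sum.reindex) (auto simp: inj_on_def)
    ultimately have "fourier_sum F (\<lambda>k. p k + q k) x = (\<Sum>k\<in>K. cas k x *\<^sub>R p k + cas (- k) x *\<^sub>R q (- k))"
      by (simp only: fourier_sum_def scaleR_add_right sum.distrib)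
    also have "\<dots> = \<phi> x"
      unfolding \<phi>
    proof (rule sum.cong[OF refl])
      fix k assume k: "k \<in> K"
      have "u *\<^sub>R (1/2) *\<^sub>R (v + w) + u' *\<^sub>R (1/2) *\<^sub>R (v - w) = ((1/2) * (u + u')) *\<^sub>R v + ((1/2) * (u - u')) *\<^sub>R w"
        for u u' and v w :: "real^3"
        by (simp add: algebra_simps add_divide_distrib diff_divide_distrib)
      then show "cas k x *\<^sub>R p k + cas (- k) x *\<^sub>R q (- k) = cos (2 * pi * (freq k \<bullet> x)) *\<^sub>R a k + sin (2 * pi * (freq k \<bullet> x)) *\<^sub>R b k"
        using k by (simp only: p_def q_def cas_split if_True minus_minus)
    qed
    finally show ?thesis by simp
  qed
  then show ?thesis using F by blast
qed

lemma solenoidal_trigD: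
  assumes "\<phi> \<in> solenoidal_trig"
  shows "\<exists>F. finite F \<and> \<phi> = fourier_sum F (fcoef \<phi>) \<and> (\<forall>k. k \<notin> F \<longrightarrow> fcoef \<phi> k = 0)" and "solenoidal (fcoef \<phi>)"
proof -
  obtain F c where F: "finite F" and \<phi>: "\<phi> = fourier_sum F c"
  proof -
    have "trig_poly \<phi>" using assms by (simp add: solenoidal_trig_def)
    then show thesis using that trig_poly_fourier_sum by blast
  qed
  have fcoef: "fcoef \<phi> k = (if k \<in> F then c k else 0)" for k
    unfolding \<phi> by (rule fcoef_fourier_sum[OF F])
  have "fourier_sum F (fcoef \<phi>) x = fourier_sum F c x" for x
    unfolding fourier_sum_def by (rule sum.cong) (simp_all add: fcoef)
  then have "\<phi> = fourier_sum F (fcoef \<phi>)" unfolding \<phi> by auto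
  then show "\<exists>F. finite F \<and> \<phi> = fourier_sum F (fcoef \<phi>) \<and> (\<forall>k. k \<notin> F \<longrightarrow> fcoef \<phi> k = 0)"
    using F fcoef by auto
  have "fcoef \<phi> 0 = 0" using assms by (simp add: fcoef_0 solenoidal_trig_def)
  moreover have "fcoef \<phi> j \<bullet> freq j = 0" for j
  proof (cases "j \<in> F")
    case True
    have "0 = fcoef (\<lambda>x. divergence \<phi> x) (- j)"
      using assms by (simp add: solenoidal_trig_def fcoef_def)
    also have "\<dots> = (\<Sum>k\<in>F. fcoef (\<lambda>x. cas (- k) x *\<^sub>R (2 * pi * (c k \<bullet> freq k))) (- j))"
      unfolding \<phi> divergence_fourier_sum
      by (rule fcoef_sum) (intro sqint_continuous continuous_on_scaleR continuous_on_cas continuous_on_const)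
    also have "\<dots> = 2 * pi * (c j \<bullet> freq j)"
      using True F by (simp only: fcoef_cas) simp
    finally show ?thesis using True by (simp add: fcoef)
  qed (simp add: fcoef)
  ultimately show "solenoidal (fcoef \<phi>)" by (simp add: solenoidal_def)
qed

lemma sqint_solenoidal: "\<phi> \<in> solenoidal_trig \<Longrightarrow> sqint \<phi>"
  using solenoidal_trigD(1) sqint_fourier_sum by metis

lemma l2_le_finite_support:
  fixes a :: "int^3 \<Rightarrow> 'a::real_normed_vector"
  assumes "finite F" "\<And>k. k \<notin> F \<Longrightarrow> a k = 0"
  shows "l2_le a (\<Sum>k\<in>F. (norm (a k))\<^sup>2)"
proof (rule l2_leI)
  fix G :: "(int^3) set" assume "finite G"
  then have "(\<Sum>k\<in>G. (norm (a k))\<^sup>2) = (\<Sum>k\<in>G \<inter> F. (norm (a k))\<^sup>2)"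
    by (intro sum.mono_neutral_right) (use assms(2) in auto)
  also have "\<dots> \<le> (\<Sum>k\<in>F. (norm (a k))\<^sup>2)" by (rule sum_mono2) (use assms(1) in auto)
  finally show "(\<Sum>k\<in>G. (norm (a k))\<^sup>2) \<le> (\<Sum>k\<in>F. (norm (a k))\<^sup>2)" .
qed

lemma solenoidal_sobolev:
  assumes "\<phi> \<in> solenoidal_trig" shows "\<phi> \<in> sobolev m"
proof -
  obtain F where F: "finite F" "\<And>k. k \<notin> F \<Longrightarrow> fcoef \<phi> k = 0" using solenoidal_trigD(1)[OF assms] by blast
  have "l2_le (\<lambda>k. bracket k ^ m *\<^sub>R fcoef \<phi> k) (\<Sum>k\<in>F. (norm (bracket k ^ m *\<^sub>R fcoef \<phi> k))\<^sup>2)"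
    by (rule l2_le_finite_support[OF F(1)]) (simp add: F(2))
  then show ?thesis using sqint_solenoidal[OF assms] sobolev_iff by blast
qed

lemma sobolev_sqint: "u \<in> sobolev m \<Longrightarrow> sqint u"
  by (simp add: sobolev_iff)

lemma sobolev_diff:
  assumes "u \<in> sobolev m" "v \<in> sobolev m" shows "(\<lambda>x. u x - v x) \<in> sobolev m"
proof -
  obtain B C where "l2_le (\<lambda>k. bracket k ^ m *\<^sub>R fcoef u k) B" "l2_le (\<lambda>k. bracket k ^ m *\<^sub>R fcoef v k) C"
    using assms sobolev_iff by blast
  from l2_le_diff[OF this] show ?thesis
    using assms sqint_diff[of u v] by (auto simp: sobolev_iff fcoef_diff scaleR_diff_right)
qed

lemma sobolev_cmult:
  assumes "u \<in> sobolev m" shows "(\<lambda>x. c *\<^sub>R u x) \<in> sobolev m"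
proof -
  obtain B where "l2_le (\<lambda>k. bracket k ^ m *\<^sub>R fcoef u k) B"
    using assms sobolev_iff by blast
  from l2_le_cmult[OF this, of c] have "l2_le (\<lambda>k. bracket k ^ m *\<^sub>R (c *\<^sub>R fcoef u k)) (c\<^sup>2 * B)"
    by (simp only: scaleR_left_commute)
  then show ?thesis
    unfolding sobolev_iff fcoef_cmult using sqint_cmult[of u c] assms by (auto simp only: sobolev_iff)
qed

lemma sobolev_norm_fcoef_cong:
  assumes "u \<in> sobolev m" "v \<in> sobolev m" "\<And>k. norm (fcoef u k) = norm (fcoef v k)"
  shows "sobolev_norm m u = sobolev_norm m v"
proof -
  have "(sobolev_norm m u)\<^sup>2 = (sobolev_norm m v)\<^sup>2"
    by (rule has_sum_unique[OF sobolev_norm_eq[OF assms(1)]]) (use sobolev_norm_eq[OF assms(2)] in \<open>simp add: assms(3)\<close>)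
  then show ?thesis using sobolev_norm_nonneg by (simp add: power2_eq_iff_nonneg)
qed

lemma sobolev_norm_commute:
  assumes "u \<in> sobolev m" "v \<in> sobolev m"
  shows "sobolev_norm m (\<lambda>x. u x - v x) = sobolev_norm m (\<lambda>x. v x - u x)"
  by (rule sobolev_norm_fcoef_cong)
     (use assms in \<open>auto simp: sobolev_diff fcoef_diff sobolev_sqint norm_minus_commute\<close>)

lemma solenoidal_limit:
  assumes "\<And>e. e > 0 \<Longrightarrow> \<exists>\<phi>\<in>solenoidal_trig. \<forall>k. norm (a k - fcoef \<phi> k) \<le> e"
  shows "solenoidal a"
proof -
  have 0: "norm (a 0) \<le> 0 + e" if "e > 0" for e
  proof -
    obtain \<phi> where \<phi>: "\<phi> \<in> solenoidal_trig" "norm (a 0 - fcoef \<phi> 0) \<le> e" using assms[OF \<open>e > 0\<close>] by blast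
    then show ?thesis using solenoidal_trigD(2)[OF \<phi>(1)] by (simp add: solenoidal_def)
  qed
  have k: "\<bar>a k \<bullet> freq k\<bar> \<le> 0 + e" if "e > 0" for e k
  proof -
    have pos: "0 < norm (freq k) + 1" by (simp add: add_nonneg_pos)
    obtain \<phi> where \<phi>: "\<phi> \<in> solenoidal_trig" "norm (a k - fcoef \<phi> k) \<le> e / (norm (freq k) + 1)"
    proof -
      have "e / (norm (freq k) + 1) > 0" using \<open>e > 0\<close> pos by simp
      from assms[OF this] show thesis using that by blast
    qed
    have "a k \<bullet> freq k = (a k - fcoef \<phi> k) \<bullet> freq k"
      using solenoidal_trigD(2)[OF \<phi>(1)] by (simp add: inner_diff_left solenoidal_def)
    then have "\<bar>a k \<bullet> freq k\<bar> \<le> norm (a k - fcoef \<phi> k) * norm (freq k)" using Cauchy_Schwarz_ineq2 by metis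
    also have "\<dots> \<le> e / (norm (freq k) + 1) * (norm (freq k) + 1)"
      using \<phi>(2) that pos by (intro mult_mono) auto
    finally show ?thesis using pos by simp
  qed
  have "norm (a 0) \<le> 0" using 0 by (rule field_le_epsilon)
  moreover have "\<bar>a k \<bullet> freq k\<bar> \<le> 0" for k using k by (rule field_le_epsilon)
  ultimately show ?thesis by (simp add: solenoidal_def)
qed

lemma l2_tail:
  fixes a :: "int^3 \<Rightarrow> 'a::real_normed_vector"
  assumes a: "l2_le a B" and e: "e > 0"
  shows "\<exists>F. finite F \<and> l2_le (\<lambda>k. if k \<in> F then 0 else a k) e"
proof -
  define S where "S = (\<Sum>\<^sub>\<infinity>k. (norm (a k))\<^sup>2)"
  obtain F where F: "finite F" "dist (\<Sum>k\<in>F. (norm (a k))\<^sup>2) S \<le> e"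
    using infsum_finite_approximation[of "\<lambda>k. (norm (a k))\<^sup>2" UNIV e] l2_le_summable(1)[OF a] e by (auto simp: S_def)
  have "l2_le (\<lambda>k. if k \<in> F then 0 else a k) e"
  proof (rule l2_leI)
    fix G :: "(int^3) set" assume G: "finite G"
    have "(\<Sum>k\<in>G. (norm (if k \<in> F then 0 else a k))\<^sup>2) = (\<Sum>k\<in>G - F. (norm (a k))\<^sup>2)"
      using G by (simp add: sum.If_cases if_distrib[of norm] if_distrib[of "\<lambda>x. x\<^sup>2"] Diff_eq)
    also have "\<dots> = (\<Sum>k\<in>(G - F) \<union> F. (norm (a k))\<^sup>2) - (\<Sum>k\<in>F. (norm (a k))\<^sup>2)"
      using G F by (subst sum.union_disjoint) auto
    also have "(\<Sum>k\<in>(G - F) \<union> F. (norm (a k))\<^sup>2) \<le> S"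
      unfolding S_def by (rule finite_sum_le_infsum) (use l2_le_summable(1)[OF a] G F in auto)
    finally show "(\<Sum>k\<in>G. (norm (if k \<in> F then 0 else a k))\<^sup>2) \<le> e" using F(2) by (simp add: dist_real_def)
  qed
  then show ?thesis using F(1) by blast
qed

lemma solenoidal_approx:
  assumes w: "w \<in> sobolev m" and s: "solenoidal (fcoef w)" and e: "e > 0"
  shows "\<exists>\<phi>\<in>solenoidal_trig. sobolev_norm m (\<lambda>x. w x - \<phi> x) < e"
proof -
  define d where "d = (e / 2)\<^sup>2 / (sobolev_const m + 1)"
  have c: "0 < sobolev_const m + 1" using sobolev_const_nonneg[of m] by linarith
  have d: "d > 0" using e c by (simp add: d_def)
  obtain B where B: "l2_le (\<lambda>k. bracket k ^ m *\<^sub>R fcoef w k) B" using w sobolev_iff by blast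
  obtain F where F: "finite F" "l2_le (\<lambda>k. if k \<in> F then 0 else bracket k ^ m *\<^sub>R fcoef w k) d"
    using l2_tail[OF B d] by blast
  define \<phi> where "\<phi> = fourier_sum F (fcoef w)"
  have \<phi>: "\<phi> \<in> solenoidal_trig" unfolding \<phi>_def by (rule fourier_sum_solenoidal[OF F(1) s])
  have "bracket k ^ m *\<^sub>R fcoef (\<lambda>x. w x - \<phi> x) k = (if k \<in> F then 0 else bracket k ^ m *\<^sub>R fcoef w k)" for k
    using fcoef_diff[OF sobolev_sqint[OF w] sqint_solenoidal[OF \<phi>], of k] by (simp add: \<phi>_def fcoef_fourier_sum[OF F(1)])
  then have "(sobolev_norm m (\<lambda>x. w x - \<phi> x))\<^sup>2 \<le> sobolev_const m * d"
    using F(2) by (intro sobolev_norm_upper sqint_diff sobolev_sqint[OF w] sqint_solenoidal[OF \<phi>]) simp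
  also have "\<dots> \<le> (sobolev_const m + 1) * d" using d by (intro mult_right_mono) auto
  also have "\<dots> = (e / 2)\<^sup>2" using c by (simp add: d_def)
  finally have "sobolev_norm m (\<lambda>x. w x - \<phi> x) \<le> e / 2" by (rule power2_le_imp_le) (use e in simp)
  then show ?thesis using \<phi> e by (intro bexI[of _ \<phi>]) auto
qed

lemma fcoef_le_sobolev_norm:
  assumes "u \<in> sobolev m" shows "norm (fcoef u k) \<le> 2 ^ m * sobolev_norm m u"
proof (rule power2_le_imp_le)
  have "(norm (bracket k ^ m *\<^sub>R fcoef u k))\<^sup>2 \<le> 4 ^ m * (sobolev_norm m u)\<^sup>2"
    by (rule l2_le_component[OF sobolev_norm_lower[OF assms]])
  moreover have "(norm (fcoef u k))\<^sup>2 \<le> (norm (bracket k ^ m *\<^sub>R fcoef u k))\<^sup>2"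
  proof (rule power_mono)
    have "1 * norm (fcoef u k) \<le> bracket k ^ m * norm (fcoef u k)" by (intro mult_right_mono one_le_power bracket_ge1) auto
    then show "norm (fcoef u k) \<le> norm (bracket k ^ m *\<^sub>R fcoef u k)" using bracket_pos[of k] by simp
  qed simp
  moreover have "(2 ^ m * sobolev_norm m u)\<^sup>2 = 4 ^ m * (sobolev_norm m u)\<^sup>2"
    by (simp add: power_mult_distrib flip: power_mult) (simp add: power_mult mult.commute[of m])
  ultimately show "(norm (fcoef u k))\<^sup>2 \<le> (2 ^ m * sobolev_norm m u)\<^sup>2" by linarith
qed (simp add: sobolev_norm_nonneg)

text \<open>Convergence in norm implies convergence of each coefficient, which preserves the linear constraints;
conversely the truncated Fourier sums of such a field are solenoidal and converge to it.\<close>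

lemma space_V_iff: "w \<in> space_V \<longleftrightarrow> w \<in> sobolev 1 \<and> solenoidal (fcoef w)"
proof
  assume w: "w \<in> space_V"
  then have w1: "w \<in> sobolev 1" by (simp add: space_V_def)
  have "solenoidal (fcoef w)"
  proof (rule solenoidal_limit)
    fix e :: real assume "e > 0"
    then obtain \<phi> where \<phi>: "\<phi> \<in> solenoidal_trig" "sobolev_norm 1 (\<lambda>x. w x - \<phi> x) < e / 2"
    proof -
      have "e / 2 > 0" using \<open>e > 0\<close> by simp
      then show thesis using that w unfolding space_V_def by blast
    qed
    have "norm (fcoef w k - fcoef \<phi> k) \<le> e" for k
      using fcoef_le_sobolev_norm[OF sobolev_diff[OF w1 solenoidal_sobolev[OF \<phi>(1)]], of k] \<phi>(2)
      by (simp add: fcoef_diff[OF sobolev_sqint[OF w1] sqint_solenoidal[OF \<phi>(1)]])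
    then show "\<exists>\<phi>\<in>solenoidal_trig. \<forall>k. norm (fcoef w k - fcoef \<phi> k) \<le> e" using \<phi>(1) by blast
  qed
  then show "w \<in> sobolev 1 \<and> solenoidal (fcoef w)" using w1 by blast
next
  assume "w \<in> sobolev 1 \<and> solenoidal (fcoef w)"
  then show "w \<in> space_V" unfolding space_V_def using solenoidal_approx by blast
qed

lemma sobolev_0: "sqint u \<Longrightarrow> u \<in> sobolev 0"
  using bessel by (auto simp: sobolev_iff)

lemma sobolev_norm_0: 
  assumes "sqint u" shows "sobolev_norm 0 u = L2_norm u"
proof -
  have "{\<beta> :: nat^3. multi_order \<beta> \<le> 0} = {0}"
    by (auto simp: multi_order_def vec_eq_iff)
  then have "sobolev_weight 0 k = 1" for k by (simp add: sobolev_weight_def freq_power_alt)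
  then have "((\<lambda>k. (norm (fcoef u k))\<^sup>2) has_sum (sobolev_norm 0 u)\<^sup>2) UNIV"
    using sobolev_norm_eq[OF sobolev_0[OF assms]] by simp
  then have "(sobolev_norm 0 u)\<^sup>2 = (L2_norm u)\<^sup>2"
    unfolding L2_norm_sq parseval_norm[OF assms] by (rule infsumI[symmetric])
  moreover have "0 \<le> L2_norm u" by (simp add: L2_norm_def)
  ultimately show ?thesis using sobolev_norm_nonneg[of 0 u] by (simp only: power2_eq_iff_nonneg)
qed

lemma space_H_iff: "w \<in> space_H \<longleftrightarrow> sqint w \<and> solenoidal (fcoef w)"
proof
  assume w: "w \<in> space_H"
  then have w1: "sqint w" by (simp add: space_H_def L2_iff_sqint)
  have "solenoidal (fcoef w)"
  proof (rule solenoidal_limit)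
    fix e :: real assume "e > 0"
    then obtain \<phi> where \<phi>: "\<phi> \<in> solenoidal_trig" "L2_norm (\<lambda>x. w x - \<phi> x) < e"
      using w unfolding space_H_def by blast
    note d = sqint_diff[OF w1 sqint_solenoidal[OF \<phi>(1)]]
    have "norm (fcoef w k - fcoef \<phi> k) \<le> e" for k
      using fcoef_le_sobolev_norm[OF sobolev_0[OF d], of k] \<phi>(2)
      by (simp add: fcoef_diff[OF w1 sqint_solenoidal[OF \<phi>(1)]] sobolev_norm_0[OF d])
    then show "\<exists>\<phi>\<in>solenoidal_trig. \<forall>k. norm (fcoef w k - fcoef \<phi> k) \<le> e" using \<phi>(1) by blast
  qed
  then show "sqint w \<and> solenoidal (fcoef w)" using w1 by blast
next
  assume w: "sqint w \<and> solenoidal (fcoef w)"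
  have "\<exists>\<phi>\<in>solenoidal_trig. L2_norm (\<lambda>x. w x - \<phi> x) < e" if "e > 0" for e
  proof -
    obtain \<phi> where \<phi>: "\<phi> \<in> solenoidal_trig" "sobolev_norm 0 (\<lambda>x. w x - \<phi> x) < e"
      using solenoidal_approx[OF sobolev_0 _ \<open>e > 0\<close>] w by blast
    have "sqint (\<lambda>x. w x - \<phi> x)" by (rule sqint_diff[OF _ sqint_solenoidal[OF \<phi>(1)]]) (use w in blast)
    then have "L2_norm (\<lambda>x. w x - \<phi> x) < e" using sobolev_norm_0 \<phi>(2) by metis
    then show ?thesis using \<phi>(1) by blast
  qed
  then show "w \<in> space_H" unfolding space_H_def using w by (simp only: mem_Collect_eq L2_iff_sqint) blast
qed

lemma space_V_subset_H: "v \<in> space_V \<Longrightarrow> v \<in> space_H"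
  unfolding space_V_iff space_H_iff using sobolev_sqint by blast

lemma solenoidal_V: "\<phi> \<in> solenoidal_trig \<Longrightarrow> \<phi> \<in> space_V"
  by (simp add: space_V_iff solenoidal_sobolev solenoidal_trigD(2))

section \<open>The Leray projection\<close>

text \<open>The coefficientwise projection shows that the projection exists. After that only its defining
orthogonality is used, so the choice of a representative does not matter.\<close>

lemma leray_inner:
  assumes f: "sqint f" and v: "v \<in> space_H"
  shows "L2_inner (leray f) v = L2_inner f v"
proof -
  have "l2_le (\<lambda>k. leray_symbol k (fcoef f k)) (LINT x|torus. (norm (f x))\<^sup>2)"
    by (rule l2_le_dom1[OF bessel[OF f] norm_leray_symbol_le])
  then obtain h where h: "sqint h" "\<And>k. fcoef h k = leray_symbol k (fcoef f k)" using riesz_fischer by blast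
  have "solenoidal (fcoef h)" using solenoidal_scaleR_leray_symbol[of "\<lambda>_. 1" "fcoef f"] by (simp add: solenoidal_def h(2))
  then have hH: "h \<in> space_H" using h by (simp add: space_H_iff)
  have orth: "L2_inner (\<lambda>x. f x - h x) v = 0" if v: "v \<in> space_H" for v
  proof -
    have sv: "sqint v" "solenoidal (fcoef v)" using v by (auto simp: space_H_iff)
    have "fcoef (\<lambda>x. f x - h x) k \<bullet> fcoef v k = 0" for k
      using solenoidal_leray_symbol[OF sv(2), of k] leray_symbol_inner[of k "fcoef f k" "fcoef v k"]
      by (simp add: fcoef_diff[OF f h(1)] h(2) inner_diff_left)
    then have "((\<lambda>k::int^3. 0) has_sum L2_inner (\<lambda>x. f x - h x) v) UNIV"
      unfolding L2_inner_def using parseval_inner[OF sqint_diff[OF f h(1)] sv(1)] by (simp only:)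
    then show ?thesis by (rule has_sum_unique) simp
  qed
  have "\<exists>h. h \<in> space_H \<and> (\<forall>v\<in>space_H. L2_inner (\<lambda>x. f x - h x) v = 0)" using hH orth by blast
  from someI_ex[OF this] have l: "leray f \<in> space_H" "L2_inner (\<lambda>x. f x - leray f x) v = 0"
    using v by (auto simp: leray_def)
  have s: "sqint (leray f)" "sqint v" using l(1) v by (auto simp: space_H_iff)
  have "L2_inner (\<lambda>x. f x - leray f x) v = L2_inner f v - L2_inner (leray f) v"
    unfolding L2_inner_def inner_diff_left
    by (rule Bochner_Integration.integral_diff) (intro sqint_inner f s)+
  then show ?thesis using l(2) by simp
qed

lemma L2_inner_parseval: "sqint f \<Longrightarrow> sqint g \<Longrightarrow> ((\<lambda>k. fcoef f k \<bullet> fcoef g k) has_sum L2_inner f g) UNIV"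
  unfolding L2_inner_def by (rule parseval_inner)

section \<open>Energy coordinates\<close>

text \<open>Coordinates in which the energy norm is the norm of \<open>ell2\<close>.\<close>

definition energy_coord :: "real \<Rightarrow> vfield \<Rightarrow> ell2" where
  "energy_coord \<alpha> w = Abs_ell2 (\<lambda>k. energy_weight \<alpha> k *\<^sub>R fcoef w k)"

definition energy_const :: "real \<Rightarrow> real" where "energy_const \<alpha> = max 1 (2 * pi * \<bar>\<alpha>\<bar>)"

lemma l2_le_energy_weight_fcoef:
  assumes "w \<in> sobolev 1" shows "l2_le (\<lambda>k. energy_weight \<alpha> k *\<^sub>R fcoef w k) ((energy_const \<alpha> * (2 * sobolev_norm 1 w))\<^sup>2)"
proof -
  have "l2_le (\<lambda>k. energy_weight \<alpha> k *\<^sub>R fcoef w k) ((energy_const \<alpha>)\<^sup>2 * (4 ^ 1 * (sobolev_norm 1 w)\<^sup>2))"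
  proof (rule l2_le_dom[OF sobolev_norm_lower[OF assms]])
    fix k
    have "energy_weight \<alpha> k * norm (fcoef w k) \<le> (energy_const \<alpha> * bracket k) * norm (fcoef w k)"
      unfolding energy_const_def by (intro mult_right_mono energy_weight_le_bracket) auto
    then show "norm (energy_weight \<alpha> k *\<^sub>R fcoef w k) \<le> energy_const \<alpha> * norm (bracket k ^ 1 *\<^sub>R fcoef w k)"
      using bracket_pos[of k] energy_weight_pos[of \<alpha> k] by simp
  qed
  then show ?thesis by (simp add: power_mult_distrib)
qed

lemma coef_energy_coord: "w \<in> sobolev 1 \<Longrightarrow> coef (energy_coord \<alpha> w) k = energy_weight \<alpha> k *\<^sub>R fcoef w k"
  unfolding energy_coord_def by (simp add: coef_Abs[OF l2_le_energy_weight_fcoef])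

lemma norm_energy_coord_le: "w \<in> sobolev 1 \<Longrightarrow> norm (energy_coord \<alpha> w) \<le> energy_const \<alpha> * (2 * sobolev_norm 1 w)"
  by (rule norm_ell2_le)
     (use l2_le_energy_weight_fcoef[of w \<alpha>] sobolev_norm_nonneg[of 1 w] in \<open>auto simp: energy_coord_def coef_Abs energy_const_def\<close>)

lemma energy_coord_diff: "w \<in> sobolev 1 \<Longrightarrow> v \<in> sobolev 1 \<Longrightarrow> energy_coord \<alpha> (\<lambda>x. w x - v x) = energy_coord \<alpha> w - energy_coord \<alpha> v"
  by (rule coef_eqI)
     (simp add: coef_energy_coord sobolev_diff coef_simps fcoef_diff[OF sobolev_sqint sobolev_sqint] scaleR_diff_right)

lemma velocity_energy_coord:
  assumes "w \<in> space_V" shows "velocity \<alpha> (energy_coord \<alpha> w) = fcoef w"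
proof
  fix k
  show "velocity \<alpha> (energy_coord \<alpha> w) k = fcoef w k"
    using assms solenoidal_leray_symbol[of "fcoef w" k] energy_weight_pos[of \<alpha> k] by (simp add: space_V_iff velocity_def coef_energy_coord leray_symbol_linear)
qed

lemma energy_coord_inner:
  assumes "w \<in> sobolev 1" "v \<in> sobolev 1"
  shows "((\<lambda>k. (energy_weight \<alpha> k)\<^sup>2 * (fcoef w k \<bullet> fcoef v k)) has_sum (energy_coord \<alpha> w \<bullet> energy_coord \<alpha> v)) UNIV"
proof -
  have s: "(\<lambda>k. coef (energy_coord \<alpha> w) k \<bullet> coef (energy_coord \<alpha> v) k) summable_on UNIV"
    by (rule l2_le_inner[OF l2_le_coef l2_le_coef])
  have eq: "coef (energy_coord \<alpha> w) k \<bullet> coef (energy_coord \<alpha> v) k = (energy_weight \<alpha> k)\<^sup>2 * (fcoef w k \<bullet> fcoef v k)" for k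
    by (simp add: coef_energy_coord[OF assms(1)] coef_energy_coord[OF assms(2)] power2_eq_square)
  show ?thesis using has_sum_infsum[OF s] by (simp only: eq inner_ell2.rep_eq)
qed

lemma laplacian_coeffs:
  assumes w: "w \<in> sobolev 2"
  shows "sqint (laplacian w)" "fcoef (laplacian w) k = - (4 * pi\<^sup>2 * (norm (freq k))\<^sup>2) *\<^sub>R fcoef w k"
proof -
  have sw: "sqint w" by (rule sobolev_sqint[OF w])
  have mo: "multi_order (axis i 2) = 2" for i :: 3 by (simp add: multi_order_def axis_def)
  have B: "\<exists>B. l2_le (\<lambda>k. freq_power (axis i 2) k *\<^sub>R fcoef w k) B" for i
    using w mo[of i] ex_weak_deriv_iff[OF sw] by (auto simp: sobolev_def)
  have s: "sqint (weak_deriv (axis i 2) w)" for i using B[of i] weak_deriv(1)[OF sw] by blast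
  have f: "fcoef (weak_deriv (axis i 2) w) k = deriv_mult (axis i 2) (fcoef w) k" for i using B[of i] weak_deriv(2)[OF sw] by blast
  show "sqint (laplacian w)" unfolding laplacian_def by (rule sqint_sum[OF s])
  have mp: "freq_power (axis i 2) k = (2 * pi * freq k $ i)\<^sup>2" for i
    using exhaust_3[of i] by (auto simp: freq_power_alt axis_def)
  have "deriv_mult (axis i 2) (fcoef w) k = - ((2 * pi * freq k $ i)\<^sup>2) *\<^sub>R fcoef w k" for i
    unfolding deriv_mult_def mo mp by (simp add: numeral_2_eq_2 reflect_def)
  then have "fcoef (laplacian w) k = (\<Sum>i\<in>UNIV. - ((2 * pi * freq k $ i)\<^sup>2) *\<^sub>R fcoef w k)"
    unfolding laplacian_def fcoef_sum[OF s] f by (simp only:)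
  also have "\<dots> = (\<Sum>i\<in>UNIV. - ((2 * pi * freq k $ i)\<^sup>2)) *\<^sub>R fcoef w k"
    by (rule scaleR_sum_left[symmetric])
  also have "(\<Sum>i\<in>UNIV. - ((2 * pi * freq k $ i)\<^sup>2)) = - (4 * pi\<^sup>2 * (norm (freq k))\<^sup>2)"
    unfolding power2_norm_eq_inner inner_vec_def sum_3 by (simp add: power2_eq_square algebra_simps)
  finally show "fcoef (laplacian w) k = - (4 * pi\<^sup>2 * (norm (freq k))\<^sup>2) *\<^sub>R fcoef w k" .
qed

text \<open>The pairing with \<open>(I + \<alpha>\<^sup>2 A) w\<close> is the inner product of energy coordinates.\<close>

lemma stokes_inner:
  assumes w: "w \<in> stokes_domain" and v: "v \<in> space_V"
  shows "L2_inner w v + \<alpha>\<^sup>2 * L2_inner (stokes w) v = energy_coord \<alpha> w \<bullet> energy_coord \<alpha> v"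
proof -
  have w2: "w \<in> sobolev 2" and wV: "w \<in> sobolev 1" using w by (auto simp: stokes_domain_def space_V_iff)
  have v1: "v \<in> sobolev 1" using v unfolding space_V_iff by blast
  then have sv: "sqint v" by (rule sobolev_sqint)
  have sl: "sqint (\<lambda>x. - laplacian w x)" using sqint_cmult[OF laplacian_coeffs(1)[OF w2], of "-1"] by simp
  have fl: "fcoef (\<lambda>x. - laplacian w x) k = (4 * pi\<^sup>2 * (norm (freq k))\<^sup>2) *\<^sub>R fcoef w k" for k
    using fcoef_cmult[of "-1" "laplacian w" k] laplacian_coeffs(2)[OF w2, of k] by simp
  have "((\<lambda>k. (4 * pi\<^sup>2 * (norm (freq k))\<^sup>2) *\<^sub>R fcoef w k \<bullet> fcoef v k) has_sum L2_inner (stokes w) v) UNIV"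
    unfolding stokes_def leray_inner[OF sl space_V_subset_H[OF v]] fl[symmetric]
    by (rule L2_inner_parseval[OF sl sv])
  then have "((\<lambda>k. fcoef w k \<bullet> fcoef v k + \<alpha>\<^sup>2 * ((4 * pi\<^sup>2 * (norm (freq k))\<^sup>2) *\<^sub>R fcoef w k \<bullet> fcoef v k)) has_sum
      (L2_inner w v + \<alpha>\<^sup>2 * L2_inner (stokes w) v)) UNIV"
    by (intro has_sum_add has_sum_cmult_right L2_inner_parseval sobolev_sqint[OF wV] sv)
  moreover have "fcoef w k \<bullet> fcoef v k + \<alpha>\<^sup>2 * ((4 * pi\<^sup>2 * (norm (freq k))\<^sup>2) *\<^sub>R fcoef w k \<bullet> fcoef v k) = (energy_weight \<alpha> k)\<^sup>2 * (fcoef w k \<bullet> fcoef v k)" for k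
    by (simp add: energy_weight_sq algebra_simps)
  ultimately show ?thesis using has_sum_unique[OF _ energy_coord_inner[OF wV v1]] by simp
qed

section \<open>The extended operators\<close>

lemma V_approx_norm: "filterlim (\<lambda>\<phi>. sobolev_norm 1 (\<lambda>x. \<phi> x - w x)) (nhds 0) (V_approx D w)"
  unfolding V_approx_def by (rule filterlim_mono[OF filterlim_filtercomap order_refl inf_le1])

lemma V_approx_in: "\<forall>\<^sub>F \<phi> in V_approx D w. \<phi> \<in> D"
  unfolding V_approx_def by (simp add: eventually_inf_principal)

lemma V_approx_nonbot:
  assumes "w \<in> space_V" "solenoidal_trig \<subseteq> D"
  shows "V_approx D w \<noteq> bot"
proof
  assume "V_approx D w = bot"
  then have "\<forall>\<^sub>F \<phi> in V_approx D w. False" by simp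
  then obtain Q where Q: "eventually Q (nhds (0::real))" "\<And>\<phi>. Q (sobolev_norm 1 (\<lambda>x. \<phi> x - w x)) \<Longrightarrow> \<phi> \<notin> D"
    unfolding V_approx_def eventually_inf_principal eventually_filtercomap by auto
  obtain e where e: "e > 0" "\<And>y. dist y 0 < e \<Longrightarrow> Q y" using Q(1) unfolding eventually_nhds_metric by blast
  obtain \<phi> where \<phi>: "\<phi> \<in> solenoidal_trig" "sobolev_norm 1 (\<lambda>x. w x - \<phi> x) < e"
    using assms(1) e(1) unfolding space_V_def by blast
  have w1: "w \<in> sobolev 1" using assms(1) by (simp add: space_V_def)
  have "sobolev_norm 1 (\<lambda>x. \<phi> x - w x) < e"
    using \<phi>(2) sobolev_norm_commute[OF w1 solenoidal_sobolev[OF \<phi>(1)]] by simp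
  then have "Q (sobolev_norm 1 (\<lambda>x. \<phi> x - w x))"
    by (intro e(2)) (simp add: sobolev_norm_nonneg)
  then show False using Q(2) \<phi>(1) assms(2) by blast
qed

lemma V_approx_energy_coord:
  assumes w: "w \<in> space_V" and D: "D \<subseteq> space_V"
  shows "(energy_coord \<alpha> \<longlongrightarrow> energy_coord \<alpha> w) (V_approx D w)"
proof (rule LIM_zero_cancel, rule tendsto_norm_zero_cancel)
  have w1: "w \<in> sobolev 1" using w by (simp add: space_V_def)
  show "((\<lambda>\<phi>. norm (energy_coord \<alpha> \<phi> - energy_coord \<alpha> w)) \<longlongrightarrow> 0) (V_approx D w)"
  proof (rule tendsto_sandwich[OF _ _ tendsto_const])
    show "\<forall>\<^sub>F \<phi> in V_approx D w. norm (energy_coord \<alpha> \<phi> - energy_coord \<alpha> w) \<le> energy_const \<alpha> * (2 * sobolev_norm 1 (\<lambda>x. \<phi> x - w x))"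
      using V_approx_in
    proof eventually_elim
      case (elim \<phi>)
      then have p1: "\<phi> \<in> sobolev 1" using D by (auto simp: space_V_def)
      show ?case using norm_energy_coord_le[OF sobolev_diff[OF p1 w1]] by (simp add: energy_coord_diff[OF p1 w1])
    qed
    have "((\<lambda>\<phi>. energy_const \<alpha> * (2 * sobolev_norm 1 (\<lambda>x. \<phi> x - w x))) \<longlongrightarrow> energy_const \<alpha> * (2 * 0)) (V_approx D w)"
      by (intro tendsto_mult tendsto_const V_approx_norm)
    then show "((\<lambda>\<phi>. energy_const \<alpha> * (2 * sobolev_norm 1 (\<lambda>x. \<phi> x - w x))) \<longlongrightarrow> 0) (V_approx D w)" by simp
  qed simp
qed

lemma energy_weight_0: "energy_weight 0 k = 1" by (simp add: energy_weight_def)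

lemma L2_inner_energy_coord_0:
  assumes "w \<in> sobolev 1" "v \<in> sobolev 1" shows "L2_inner w v = energy_coord 0 w \<bullet> energy_coord 0 v"
  using has_sum_unique[OF L2_inner_parseval[OF assms[THEN sobolev_sqint]]] energy_coord_inner[OF assms, of 0] by (simp add: energy_weight_0)

text \<open>The pairing is continuous in energy coordinates, so its limit along approximations of \<open>w\<close> is its value at
\<open>w\<close>. The coordinates for \<open>\<alpha> = 0\<close> represent the inner product of \<open>L\<^sup>2\<close>.\<close>

lemma stokes_ext_eq:
  assumes \<alpha>: "\<alpha> \<noteq> 0" and w: "w \<in> space_V" and v: "v \<in> space_V"
  shows "L2_inner w v + \<alpha>\<^sup>2 * stokes_ext w v = energy_coord \<alpha> w \<bullet> energy_coord \<alpha> v"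
proof -
  let ?F = "V_approx stokes_domain w"
  have DV: "stokes_domain \<subseteq> space_V" by (auto simp: stokes_domain_def)
  have SD: "solenoidal_trig \<subseteq> stokes_domain" using solenoidal_sobolev solenoidal_V by (auto simp: stokes_domain_def)
  have v1: "v \<in> sobolev 1" and w1: "w \<in> sobolev 1" using v w by (auto simp: space_V_def)
  have "((\<lambda>\<phi>. (energy_coord \<alpha> \<phi> \<bullet> energy_coord \<alpha> v - energy_coord 0 \<phi> \<bullet> energy_coord 0 v) / \<alpha>\<^sup>2) \<longlongrightarrow>
      (energy_coord \<alpha> w \<bullet> energy_coord \<alpha> v - energy_coord 0 w \<bullet> energy_coord 0 v) / \<alpha>\<^sup>2) ?F"
    using \<alpha> by (intro tendsto_divide tendsto_diff tendsto_inner tendsto_const V_approx_energy_coord[OF w DV]) auto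
  moreover have "\<forall>\<^sub>F \<phi> in ?F. (energy_coord \<alpha> \<phi> \<bullet> energy_coord \<alpha> v - energy_coord 0 \<phi> \<bullet> energy_coord 0 v) / \<alpha>\<^sup>2 = L2_inner (stokes \<phi>) v"
    using V_approx_in
  proof eventually_elim
    case (elim \<phi>)
    have "\<phi> \<in> sobolev 1" using elim DV by (auto simp: space_V_def)
    then show ?case using stokes_inner[OF elim v, of \<alpha>] L2_inner_energy_coord_0[OF _ v1] \<alpha> by (simp add: field_simps)
  qed
  ultimately have "((\<lambda>\<phi>. L2_inner (stokes \<phi>) v) \<longlongrightarrow> (energy_coord \<alpha> w \<bullet> energy_coord \<alpha> v - energy_coord 0 w \<bullet> energy_coord 0 v) / \<alpha>\<^sup>2) ?F"
    by (rule Lim_transform_eventually)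
  then have "stokes_ext w v = (energy_coord \<alpha> w \<bullet> energy_coord \<alpha> v - energy_coord 0 w \<bullet> energy_coord 0 v) / \<alpha>\<^sup>2"
    unfolding stokes_ext_def by (rule tendsto_Lim[OF V_approx_nonbot[OF w SD]])
  then show ?thesis using \<alpha> L2_inner_energy_coord_0[OF w1 v1] by simp
qed

lemma pdiff_component:
  assumes "f differentiable (at x)" shows "pdiff i (\<lambda>x. f x $ j) x = pdiff i f x $ j"
proof -
  obtain f' where f': "(f has_derivative f') (at x)" using assms by (auto simp: differentiable_def)
  have "((\<lambda>x. f x $ j) has_derivative (\<lambda>h. f' h $ j)) (at x)"
    by (rule bounded_linear.has_derivative[OF bounded_linear_vec_nth f'])
  then show ?thesis by (simp add: pdiff_has_derivative pdiff_has_derivative[OF f'])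
qed

lemma fourier_sum_component: "(\<lambda>x. fourier_sum F a x $ j) = fourier_sum F (\<lambda>k. a k $ j)"
  by (simp add: fourier_sum_def fun_eq_iff)

text \<open>For solenoidal \<open>\<phi>\<close> the transport term is a divergence, so its coefficients follow from
  those of the products \<open>\<phi>\<^sub>i \<psi>\<close>.\<close>

lemma transport_coeffs:
  assumes \<phi>: "\<phi> \<in> solenoidal_trig" and \<psi>: "\<psi> \<in> solenoidal_trig"
  shows "sqint (\<lambda>x. \<Sum>i\<in>UNIV. \<phi> x $ i *\<^sub>R pdiff i \<psi> x)"
    and "fcoef (\<lambda>x. \<Sum>i\<in>UNIV. \<phi> x $ i *\<^sub>R pdiff i \<psi> x) k = transport (fcoef \<phi>) (fcoef \<psi>) k"
proof -
  obtain F where F: "finite F" "\<phi> = fourier_sum F (fcoef \<phi>)" using solenoidal_trigD(1)[OF \<phi>] by blast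
  obtain G where G: "finite G" "\<psi> = fourier_sum G (fcoef \<psi>)" using solenoidal_trigD(1)[OF \<psi>] by blast
  have c\<phi>: "periodic_C1 i \<phi>" for i by (subst F(2)) (rule periodic_C1_fourier_sum)
  have c\<psi>: "periodic_C1 i \<psi>" for i by (subst G(2)) (rule periodic_C1_fourier_sum)
  have c\<phi>i: "periodic_C1 j (\<lambda>x. \<phi> x $ i)" for i j
    by (subst F(2)) (simp only: fourier_sum_component periodic_C1_fourier_sum)
  have d: "\<phi> differentiable (at x)" "\<psi> differentiable (at x)" "(\<lambda>x. \<phi> x $ i) differentiable (at x)" for x i
    using c\<phi> c\<psi> c\<phi>i[of i i] by (auto simp: periodic_C1_def)
  have cc: "continuous_on UNIV (pdiff i \<psi>)" for i using c\<psi>[of i] by (simp add: periodic_C1_def)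
  show "sqint (\<lambda>x. \<Sum>i\<in>UNIV. \<phi> x $ i *\<^sub>R pdiff i \<psi> x)"
  proof (rule sqint_continuous, intro continuous_on_sum continuous_on_scaleR)
    fix i :: 3
    show "continuous_on (cbox 0 1) (\<lambda>x. \<phi> x $ i)" by (rule periodic_C1_continuous[OF c\<phi>i])
    show "continuous_on (cbox 0 1) (pdiff i \<psi>)" by (rule continuous_on_subset[OF cc]) simp
  qed
  have p: "periodic_C1 i (\<lambda>x. \<phi> x $ i *\<^sub>R \<psi> x)" for i by (rule periodic_C1_scaleR[OF c\<phi>i c\<psi>])
  have eq: "(\<Sum>i\<in>UNIV. \<phi> x $ i *\<^sub>R pdiff i \<psi> x) = (\<Sum>i\<in>UNIV. pdiff i (\<lambda>x. \<phi> x $ i *\<^sub>R \<psi> x) x)" for x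
  proof -
    have "(\<Sum>i\<in>UNIV. pdiff i (\<lambda>x. \<phi> x $ i *\<^sub>R \<psi> x) x) = divergence \<phi> x *\<^sub>R \<psi> x + (\<Sum>i\<in>UNIV. \<phi> x $ i *\<^sub>R pdiff i \<psi> x)"
      by (simp add: pdiff_scaleR[OF d(3) d(2)] pdiff_component[OF d(1)] sum.distrib divergence_def scaleR_sum_left)
    then show ?thesis using \<phi> by (simp add: solenoidal_trig_def)
  qed
  have s: "sqint (pdiff i (\<lambda>x. \<phi> x $ i *\<^sub>R \<psi> x))" for i
    by (rule sqint_continuous, rule continuous_on_subset[of UNIV]) (use p[of i] in \<open>simp_all add: periodic_C1_def\<close>)
  have sp: "sqint (\<lambda>x. \<phi> x $ i)" "sqint \<psi>" for i
    by (rule sqint_continuous[OF periodic_C1_continuous[OF c\<phi>i]]) (rule sqint_solenoidal[OF \<psi>])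
  have fi: "fcoef (\<lambda>x. \<phi> x $ i) = (\<lambda>j. fcoef \<phi> j $ i)" for i
    by (rule ext) (rule fcoef_linear[OF sqint_solenoidal[OF \<phi>] bounded_linear_vec_nth])
  have "fcoef (\<lambda>x. \<Sum>i\<in>UNIV. \<phi> x $ i *\<^sub>R pdiff i \<psi> x) k = (\<Sum>i\<in>UNIV. - (2 * pi * freq k $ i) *\<^sub>R fcoef (\<lambda>x. \<phi> x $ i *\<^sub>R \<psi> x) (- k))"
    unfolding eq fcoef_sum[OF s] by (simp only: fcoef_pdiff[OF p])
  also have "\<dots> = (\<Sum>i\<in>UNIV. - (2 * pi * freq k $ i) *\<^sub>R prod_coef (\<lambda>j. fcoef \<phi> j $ i) (fcoef \<psi>) (- k))"
    by (simp only: fcoef_prod[OF sp] fi)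
  also have "\<dots> = transport (fcoef \<phi>) (fcoef \<psi>) k"
    by (simp add: transport_def scaleR_sum_right sum_negf mult.assoc)
  finally show "fcoef (\<lambda>x. \<Sum>i\<in>UNIV. \<phi> x $ i *\<^sub>R pdiff i \<psi> x) k = transport (fcoef \<phi>) (fcoef \<psi>) k" .
qed

lemma voigt_energy_coord_inner:
  assumes \<alpha>: "\<alpha> > 0" and w: "w1 \<in> space_V" "w2 \<in> space_V" and v: "v \<in> space_V"
  shows "((\<lambda>k. transport (fcoef w1) (fcoef w2) k \<bullet> fcoef v k) has_sum - (voigt \<alpha> (energy_coord \<alpha> w1) (energy_coord \<alpha> w2) \<bullet> energy_coord \<alpha> v)) UNIV"
proof -
  have v1: "v \<in> sobolev 1" "solenoidal (fcoef v)" using v by (auto simp: space_V_iff)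
  let ?B = "voigt \<alpha> (energy_coord \<alpha> w1) (energy_coord \<alpha> w2)"
  have "(\<lambda>k. coef ?B k \<bullet> coef (energy_coord \<alpha> v) k) summable_on UNIV"
    by (rule l2_le_inner[OF l2_le_coef l2_le_coef])
  then have "((\<lambda>k. - (coef ?B k \<bullet> coef (energy_coord \<alpha> v) k)) has_sum - (?B \<bullet> energy_coord \<alpha> v)) UNIV"
    by (simp only: inner_ell2.rep_eq has_sum_uminus minus_minus has_sum_infsum)
  moreover have "- (coef ?B k \<bullet> coef (energy_coord \<alpha> v) k) = transport (fcoef w1) (fcoef w2) k \<bullet> fcoef v k" for k
    using energy_weight_pos[of \<alpha> k] solenoidal_leray_symbol[OF v1(2), of k]
    by (simp add: coef_voigt[OF \<alpha>] coef_energy_coord[OF v1(1)] voigt_seq_def velocity_energy_coord[OF w(1)] velocity_energy_coord[OF w(2)] leray_symbol_inner)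
  ultimately show ?thesis by simp
qed

lemma advection_inner:
  assumes \<alpha>: "\<alpha> > 0" and \<phi>: "\<phi> \<in> solenoidal_trig" and \<psi>: "\<psi> \<in> solenoidal_trig" and v: "v \<in> space_V"
  shows "L2_inner (advection \<phi> \<psi>) v = - (voigt \<alpha> (energy_coord \<alpha> \<phi>) (energy_coord \<alpha> \<psi>) \<bullet> energy_coord \<alpha> v)"
proof -
  note t = transport_coeffs[OF \<phi> \<psi>]
  have sv: "sqint v" using v unfolding space_V_iff using sobolev_sqint by blast
  have "((\<lambda>k. transport (fcoef \<phi>) (fcoef \<psi>) k \<bullet> fcoef v k) has_sum L2_inner (advection \<phi> \<psi>) v) UNIV"
    unfolding advection_def leray_inner[OF t(1) space_V_subset_H[OF v]] t(2)[symmetric]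
    by (rule L2_inner_parseval[OF t(1) sv])
  then show ?thesis by (rule has_sum_unique[OF _ voigt_energy_coord_inner[OF \<alpha> solenoidal_V[OF \<phi>] solenoidal_V[OF \<psi>] v]])
qed

text \<open>Boundedness of the bilinear map in energy coordinates gives the limit along the product filter.\<close>

lemma advection_ext_eq:
  assumes \<alpha>: "\<alpha> > 0" and w: "w1 \<in> space_V" "w2 \<in> space_V" and v: "v \<in> space_V"
  shows "advection_ext w1 w2 v = - (voigt \<alpha> (energy_coord \<alpha> w1) (energy_coord \<alpha> w2) \<bullet> energy_coord \<alpha> v)"
proof -
  interpret bounded_bilinear "voigt \<alpha>" by (rule bounded_bilinear_voigt[OF \<alpha>])
  let ?F1 = "V_approx solenoidal_trig w1" and ?F2 = "V_approx solenoidal_trig w2"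
  let ?b = "\<lambda>p. - (voigt \<alpha> (energy_coord \<alpha> (fst p)) (energy_coord \<alpha> (snd p)) \<bullet> energy_coord \<alpha> v)"
  have SV: "solenoidal_trig \<subseteq> space_V" using solenoidal_V by blast
  have f1: "((\<lambda>p. energy_coord \<alpha> (fst p)) \<longlongrightarrow> energy_coord \<alpha> w1) (?F1 \<times>\<^sub>F ?F2)"
    by (rule filterlim_compose[OF V_approx_energy_coord[OF w(1) SV] filterlim_fst])
  have f2: "((\<lambda>p. energy_coord \<alpha> (snd p)) \<longlongrightarrow> energy_coord \<alpha> w2) (?F1 \<times>\<^sub>F ?F2)"
    by (rule filterlim_compose[OF V_approx_energy_coord[OF w(2) SV] filterlim_snd])
  have "(?b \<longlongrightarrow> - (voigt \<alpha> (energy_coord \<alpha> w1) (energy_coord \<alpha> w2) \<bullet> energy_coord \<alpha> v)) (?F1 \<times>\<^sub>F ?F2)"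
    by (intro tendsto_minus tendsto_inner tendsto f1 f2 tendsto_const)
  moreover have "\<forall>\<^sub>F p in ?F1 \<times>\<^sub>F ?F2. ?b p = (\<lambda>(\<phi>, \<psi>). L2_inner (advection \<phi> \<psi>) v) p"
  proof -
    have "\<forall>\<^sub>F p in ?F1 \<times>\<^sub>F ?F2. fst p \<in> solenoidal_trig \<and> snd p \<in> solenoidal_trig"
      using eventually_prodI[OF V_approx_in V_approx_in] by simp
    then show ?thesis
      by eventually_elim (auto simp: advection_inner[OF \<alpha> _ _ v])
  qed
  ultimately have "((\<lambda>(\<phi>, \<psi>). L2_inner (advection \<phi> \<psi>) v) \<longlongrightarrow> - (voigt \<alpha> (energy_coord \<alpha> w1) (energy_coord \<alpha> w2) \<bullet> energy_coord \<alpha> v)) (?F1 \<times>\<^sub>F ?F2)"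
    by (rule Lim_transform_eventually)
  moreover have "?F1 \<times>\<^sub>F ?F2 \<noteq> bot"
    using V_approx_nonbot[OF w(1)] V_approx_nonbot[OF w(2)] by (simp add: prod_filter_eq_bot)
  ultimately show ?thesis unfolding advection_ext_def by (intro tendsto_Lim)
qed

section \<open>Energy conservation\<close>

text \<open>\<open>(\<phi> \<cdot> \<nabla>) \<phi> \<cdot> \<phi>\<close> is \<open>\<phi> \<cdot> \<nabla> (|\<phi>|\<^sup>2 / 2)\<close>, and integration by parts moves the gradient to the
divergence of \<open>\<phi>\<close>.\<close>

lemma transport_energy:
  assumes \<phi>: "\<phi> \<in> solenoidal_trig"
  shows "(LINT x|torus. (\<Sum>i\<in>UNIV. \<phi> x $ i *\<^sub>R pdiff i \<phi> x) \<bullet> \<phi> x) = 0"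
proof -
  obtain F where F: "finite F" "\<phi> = fourier_sum F (fcoef \<phi>)" using solenoidal_trigD(1)[OF \<phi>] by blast
  have c: "periodic_C1 i \<phi>" for i by (subst F(2)) (rule periodic_C1_fourier_sum)
  have ci: "periodic_C1 j (\<lambda>x. \<phi> x $ i)" for i j
    by (subst F(2)) (simp only: fourier_sum_component periodic_C1_fourier_sum)
  have d: "\<phi> differentiable (at x)" for x using c[of 1] by (simp add: periodic_C1_def)
  define q where "q x = (1/2) * (\<phi> x \<bullet> \<phi> x)" for x
  have Dq: "(q has_derivative (\<lambda>h. f' h \<bullet> \<phi> x)) (at x)" if "(\<phi> has_derivative f') (at x)" for f' x
  proof -
    have "(q has_derivative (\<lambda>h. (1/2) * (\<phi> x \<bullet> f' h + f' h \<bullet> \<phi> x))) (at x)"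
      unfolding q_def[abs_def] by (intro has_derivative_mult_right has_derivative_inner that)
    then show ?thesis by (simp add: inner_commute)
  qed
  have dq: "q differentiable (at x)" and pq: "pdiff i q x = pdiff i \<phi> x \<bullet> \<phi> x" for i x
  proof -
    obtain f' where f': "(\<phi> has_derivative f') (at x)" using d by (auto simp: differentiable_def)
    show "q differentiable (at x)" using Dq[OF f'] by (auto simp: differentiable_def)
    show "pdiff i q x = pdiff i \<phi> x \<bullet> \<phi> x"
      by (simp add: pdiff_has_derivative[OF Dq[OF f']] pdiff_has_derivative[OF f'])
  qed
  have pq': "pdiff i q = (\<lambda>x. pdiff i \<phi> x \<bullet> \<phi> x)" for i by (rule ext) (rule pq)
  have cq: "periodic_C1 i q" for i
    unfolding periodic_C1_def
  proof (intro conjI allI dq)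
    show "continuous_on UNIV (pdiff i q)"
      unfolding pq' using c[of i] by (intro continuous_on_inner periodic_C1_continuous[OF c]) (simp add: periodic_C1_def)
    show "q (x + axis i 1) = q x" for x using c[of i] by (simp add: q_def periodic_C1_def)
  qed
  have cc: "continuous_on (cbox 0 1) (pdiff i g)" if "periodic_C1 i g" for i and g :: "real^3 \<Rightarrow> real"
    using that by (auto simp: periodic_C1_def intro: continuous_on_subset)
  have int: "integrable torus (\<lambda>x. \<phi> x $ i *\<^sub>R pdiff i q x)" "integrable torus (\<lambda>x. pdiff i (\<lambda>x. \<phi> x $ i) x *\<^sub>R q x)" for i
    by (intro integrable_torus_continuous continuous_on_scaleR cc cq ci periodic_C1_continuous[OF ci] periodic_C1_continuous[OF cq])+
  have "(LINT x|torus. (\<Sum>i\<in>UNIV. \<phi> x $ i *\<^sub>R pdiff i \<phi> x) \<bullet> \<phi> x) = (LINT x|torus. (\<Sum>i\<in>UNIV. \<phi> x $ i *\<^sub>R pdiff i q x))"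
    by (simp add: pq inner_sum_left)
  also have "\<dots> = (\<Sum>i\<in>UNIV. LINT x|torus. \<phi> x $ i *\<^sub>R pdiff i q x)"
    by (rule Bochner_Integration.integral_sum) (rule int)
  also have "\<dots> = (\<Sum>i\<in>UNIV. - (LINT x|torus. pdiff i (\<lambda>x. \<phi> x $ i) x *\<^sub>R q x))"
    using integral_by_parts_torus[OF ci cq] by simp
  also have "\<dots> = - (LINT x|torus. (\<Sum>i\<in>UNIV. pdiff i (\<lambda>x. \<phi> x $ i) x *\<^sub>R q x))"
    unfolding sum_negf by (subst Bochner_Integration.integral_sum) (rule int, rule refl)
  also have "(\<lambda>x. \<Sum>i\<in>UNIV. pdiff i (\<lambda>x. \<phi> x $ i) x *\<^sub>R q x) = (\<lambda>x. divergence \<phi> x * q x)"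
    by (simp add: divergence_def pdiff_component[OF d] sum_distrib_right)
  also have "\<dots> = (\<lambda>x. 0)" using \<phi> by (simp add: solenoidal_trig_def)
  finally show ?thesis by simp
qed

lemma voigt_energy_finite:
  assumes \<alpha>: "\<alpha> > 0" and F: "finite F" and z: "\<And>k. k \<notin> F \<Longrightarrow> coef z k = 0"
  shows "voigt \<alpha> z z \<bullet> z = 0"
proof -
  define a where "a = velocity \<alpha> z"
  have sa: "solenoidal a" unfolding a_def velocity_def[abs_def] by (rule solenoidal_scaleR_leray_symbol)
  define \<phi> where "\<phi> = fourier_sum F a"
  have \<phi>: "\<phi> \<in> solenoidal_trig" unfolding \<phi>_def by (rule fourier_sum_solenoidal[OF F sa])
  have "fcoef \<phi> k = a k" for k
    unfolding \<phi>_def fcoef_fourier_sum[OF F] using z[of k] leray_symbol_linear(2)[of k 0 0] by (auto simp: a_def velocity_def)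
  then have fa: "fcoef \<phi> = a" by auto
  note t = transport_coeffs[OF \<phi> \<phi>]
  have "((\<lambda>k. transport a a k \<bullet> a k) has_sum 0) UNIV"
    using parseval_inner[OF t(1) sqint_solenoidal[OF \<phi>]] by (simp add: t(2) fa transport_energy[OF \<phi>])
  then have "(\<Sum>\<^sub>\<infinity>k. - (transport a a k \<bullet> a k)) = 0"
    by (simp add: infsum_uminus infsumI)
  moreover have "coef (voigt \<alpha> z z) k \<bullet> coef z k = - (transport a a k \<bullet> a k)" for k
    by (simp add: coef_voigt[OF \<alpha>] voigt_seq_def leray_symbol_inner a_def) (simp add: velocity_def)
  ultimately show ?thesis by (simp add: inner_ell2.rep_eq)
qed

text \<open>The identity holds for finitely supported states, where it is a statement about trigonometric polynomials;
these are dense and the expression is continuous.\<close>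

lemma voigt_energy:
  assumes \<alpha>: "\<alpha> > 0" shows "voigt \<alpha> z z \<bullet> z = 0"
proof -
  interpret bounded_bilinear "voigt \<alpha>" by (rule bounded_bilinear_voigt[OF \<alpha>])
  have "\<exists>y. norm (y - z) \<le> e \<and> voigt \<alpha> y y \<bullet> y = 0" if e: "e > 0" for e
  proof -
    obtain F where F: "finite F" "l2_le (\<lambda>k. if k \<in> F then 0 else coef z k) (e\<^sup>2)"
      using l2_tail[OF l2_le_coef, of "e\<^sup>2" z] e by auto
    define y where "y = weighted (\<lambda>k. if k \<in> F then 1 else 0) z"
    have cy: "coef y k = (if k \<in> F then coef z k else 0)" for k
      unfolding y_def by (subst coef_weighted[where c = 1]) auto
    have "norm (y - z) \<le> e"
    proof (rule norm_ell2_le)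
      show "l2_le (coef (y - z)) (e\<^sup>2)"
        by (rule l2_le_dom1[OF F(2)]) (simp add: coef_simps cy)
    qed (use e in simp)
    moreover have "voigt \<alpha> y y \<bullet> y = 0"
      by (rule voigt_energy_finite[OF \<alpha> F(1)]) (simp add: cy)
    ultimately show ?thesis by blast
  qed
  then have "\<forall>n. \<exists>y. norm (y - z) \<le> 1 / real (Suc n) \<and> voigt \<alpha> y y \<bullet> y = 0" by simp
  then obtain y where y: "\<And>n. norm (y n - z) \<le> 1 / real (Suc n)" "\<And>n. voigt \<alpha> (y n) (y n) \<bullet> y n = 0" by metis
  have "(\<lambda>n. 1 / real (Suc n)) \<longlonglongrightarrow> 0" using LIMSEQ_inverse_real_of_nat by (simp add: inverse_eq_divide)
  then have "(\<lambda>n. y n - z) \<longlonglongrightarrow> 0"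
    by (rule Lim_null_comparison[rotated]) (use y(1) in simp)
  then have yz: "y \<longlonglongrightarrow> z" by (rule LIM_zero_cancel)
  have "(\<lambda>n. voigt \<alpha> (y n) (y n) \<bullet> y n) \<longlonglongrightarrow> voigt \<alpha> z z \<bullet> z"
    by (intro tendsto_inner tendsto yz)
  then show ?thesis using y(2) by (simp add: LIMSEQ_const_iff)
qed

section \<open>From energy coordinates back to fields\<close>

text \<open>The states that are energy coordinates of solenoidal fields.\<close>

definition solenoidal_state :: "ell2 \<Rightarrow> bool" where
  "solenoidal_state z \<longleftrightarrow> (\<forall>k. leray_symbol k (coef z k) = coef z k)"

lemma solenoidal_state_energy_coord: "w \<in> space_V \<Longrightarrow> solenoidal_state (energy_coord \<alpha> w)"
  by (simp add: solenoidal_state_def space_V_iff coef_energy_coord leray_symbol_linear solenoidal_leray_symbol)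

lemma solenoidal_state_voigt: "\<alpha> > 0 \<Longrightarrow> solenoidal_state (voigt \<alpha> z y)"
  by (simp add: solenoidal_state_def coef_voigt voigt_seq_def leray_symbol_linear flip: scaleR_minus_left)

lemma solenoidal_state_diff:
  assumes "solenoidal_state z" "solenoidal_state y" shows "solenoidal_state (z - y)"
proof -
  have "leray_symbol k (a - b) = leray_symbol k a - leray_symbol k b" for k a b
    using leray_symbol_linear(1)[of k "a - b" b] by (simp add: algebra_simps)
  then show ?thesis using assms by (simp add: solenoidal_state_def coef_simps)
qed

text \<open>A representative of the field with given energy coordinates; it is determined up to null sets.\<close>

definition field_of :: "real \<Rightarrow> ell2 \<Rightarrow> vfield" where
  "field_of \<alpha> z = (SOME w. sqint w \<and> (\<forall>k. fcoef w k = (1 / energy_weight \<alpha> k) *\<^sub>R coef z k))"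

lemma field_of: "sqint (field_of \<alpha> z)" "fcoef (field_of \<alpha> z) k = (1 / energy_weight \<alpha> k) *\<^sub>R coef z k"
proof -
  have "l2_le (\<lambda>k. (1 / energy_weight \<alpha> k) *\<^sub>R coef z k) ((norm z)\<^sup>2)"
  proof (rule l2_le_dom1[OF l2_le_coef])
    fix k
    have "1 / energy_weight \<alpha> k \<le> 1" using energy_weight_ge1[of \<alpha> k] by simp
    then have "1 / energy_weight \<alpha> k * norm (coef z k) \<le> 1 * norm (coef z k)" by (rule mult_right_mono) simp
    then show "norm ((1 / energy_weight \<alpha> k) *\<^sub>R coef z k) \<le> norm (coef z k)" using energy_weight_pos[of \<alpha> k] by simp
  qed
  then have "\<exists>w. sqint w \<and> (\<forall>k. fcoef w k = (1 / energy_weight \<alpha> k) *\<^sub>R coef z k)" using riesz_fischer by blast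
  from someI_ex[OF this] show "sqint (field_of \<alpha> z)" "fcoef (field_of \<alpha> z) k = (1 / energy_weight \<alpha> k) *\<^sub>R coef z k"
    by (auto simp: field_of_def)
qed

text \<open>The energy coordinate carries one derivative, so a field is in \<open>H\<^sup>n\<^sup>+\<^sup>1\<close> as soon as its
  coordinates have \<open>n\<close> further derivatives.\<close>

lemma sobolev_from_coords:
  assumes \<alpha>: "\<alpha> > 0" and f: "sqint f" "\<And>k. fcoef f k = (1 / energy_weight \<alpha> k) *\<^sub>R c k"
    and c: "l2_le (\<lambda>k. bracket k ^ n *\<^sub>R c k) (r\<^sup>2)" and r: "0 \<le> r"
  shows "f \<in> sobolev (Suc n)" "sobolev_norm (Suc n) f \<le> sqrt (sobolev_const (Suc n)) * bracket_const \<alpha> * r"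
proof -
  have l: "l2_le (\<lambda>k. bracket k ^ Suc n *\<^sub>R fcoef f k) ((bracket_const \<alpha>)\<^sup>2 * r\<^sup>2)"
  proof (rule l2_le_dom[OF c])
    fix k
    have "bracket k * (1 / energy_weight \<alpha> k) \<le> bracket_const \<alpha>"
      using bracket_le_energy_weight[OF \<alpha>, of k] energy_weight_pos[of \<alpha> k] by (simp add: pos_divide_le_eq)
    then have "(bracket k * (1 / energy_weight \<alpha> k)) * (bracket k ^ n * norm (c k)) \<le> bracket_const \<alpha> * (bracket k ^ n * norm (c k))"
      using bracket_pos[of k] by (intro mult_right_mono) auto
    then show "norm (bracket k ^ Suc n *\<^sub>R fcoef f k) \<le> bracket_const \<alpha> * norm (bracket k ^ n *\<^sub>R c k)"
      using bracket_pos[of k] energy_weight_pos[of \<alpha> k] by (simp add: f(2) mult_ac)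
  qed
  then show "f \<in> sobolev (Suc n)" using f(1) sobolev_iff by blast
  have "(sobolev_norm (Suc n) f)\<^sup>2 \<le> sobolev_const (Suc n) * ((bracket_const \<alpha>)\<^sup>2 * r\<^sup>2)"
    by (rule sobolev_norm_upper[OF f(1) l])
  also have "\<dots> = (sqrt (sobolev_const (Suc n)) * bracket_const \<alpha> * r)\<^sup>2"
    using sobolev_const_nonneg[of "Suc n"] by (simp add: power_mult_distrib)
  finally show "sobolev_norm (Suc n) f \<le> sqrt (sobolev_const (Suc n)) * bracket_const \<alpha> * r"
    by (rule power2_le_imp_le) (use r bracket_const_ge1[of \<alpha>] sobolev_const_nonneg[of "Suc n"] in simp)
qed

lemma l2_le_bracket_0: "l2_le (\<lambda>k. bracket k ^ 0 *\<^sub>R coef z k) ((norm z)\<^sup>2)"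
  using l2_le_coef[of z] by simp

lemma field_sobolev_1:
  assumes "\<alpha> > 0" shows "field_of \<alpha> z \<in> sobolev 1"
  using sobolev_from_coords(1)[OF assms field_of l2_le_bracket_0] by simp

lemma field_V:
  assumes "\<alpha> > 0" "solenoidal_state z" shows "field_of \<alpha> z \<in> space_V"
proof -
  have "fcoef (field_of \<alpha> z) = (\<lambda>k. (1 / energy_weight \<alpha> k) *\<^sub>R leray_symbol k (coef z k))"
    using assms(2) by (auto simp: field_of solenoidal_state_def)
  then show ?thesis using field_sobolev_1[OF assms(1)] solenoidal_scaleR_leray_symbol by (simp add: space_V_iff)
qed

lemma energy_coord_field:
  assumes "\<alpha> > 0" shows "energy_coord \<alpha> (field_of \<alpha> z) = z"
  using energy_weight_pos[of \<alpha>] by (intro coef_eqI) (simp add: coef_energy_coord[OF field_sobolev_1[OF assms]] field_of less_imp_neq[symmetric])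

lemma l2_le_bracket_energy_coord:
  assumes "w \<in> sobolev (Suc n)"
  shows "l2_le (\<lambda>k. bracket k ^ n *\<^sub>R coef (energy_coord \<alpha> w) k) ((energy_const \<alpha> * (2 ^ Suc n * sobolev_norm (Suc n) w))\<^sup>2)"
proof -
  have w1: "w \<in> sobolev 1"
  proof -
    have "l2_le (\<lambda>k. bracket k ^ 1 *\<^sub>R fcoef w k) (4 ^ Suc n * (sobolev_norm (Suc n) w)\<^sup>2)"
    proof (rule l2_le_dom1[OF sobolev_norm_lower[OF assms]])
      fix k
      have "bracket k ^ 1 \<le> bracket k ^ Suc n" by (rule power_increasing) (use bracket_ge1 in auto)
      then have "bracket k ^ 1 * norm (fcoef w k) \<le> bracket k ^ Suc n * norm (fcoef w k)" by (rule mult_right_mono) simp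
      then show "norm (bracket k ^ 1 *\<^sub>R fcoef w k) \<le> norm (bracket k ^ Suc n *\<^sub>R fcoef w k)" using bracket_pos[of k] by (simp add: abs_mult)
    qed
    then show ?thesis using sobolev_iff sobolev_sqint[OF assms] by blast
  qed
  have "l2_le (\<lambda>k. bracket k ^ n *\<^sub>R coef (energy_coord \<alpha> w) k) ((energy_const \<alpha>)\<^sup>2 * (4 ^ Suc n * (sobolev_norm (Suc n) w)\<^sup>2))"
  proof (rule l2_le_dom[OF sobolev_norm_lower[OF assms]])
    fix k
    have "energy_weight \<alpha> k * (bracket k ^ n * norm (fcoef w k)) \<le> (energy_const \<alpha> * bracket k) * (bracket k ^ n * norm (fcoef w k))"
      unfolding energy_const_def using bracket_pos[of k] by (intro mult_right_mono energy_weight_le_bracket) auto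
    then show "norm (bracket k ^ n *\<^sub>R coef (energy_coord \<alpha> w) k) \<le> energy_const \<alpha> * norm (bracket k ^ Suc n *\<^sub>R fcoef w k)"
      using bracket_pos[of k] energy_weight_pos[of \<alpha> k] by (simp add: coef_energy_coord[OF w1] abs_mult mult_ac)
  qed
  moreover have "(4::real) ^ Suc n = (2 ^ Suc n)\<^sup>2" by (simp add: power2_eq_square flip: power_mult_distrib)
  ultimately show ?thesis by (simp only: power_mult_distrib)
qed

section \<open>Growth of higher norms\<close>

text \<open>On finitely many frequencies the truncated weight is the full one once \<open>N\<close> is large.\<close>

lemma l2_le_min_limit:
  assumes "\<And>N::nat. l2_le (\<lambda>k. min (bracket k) (real N) ^ n *\<^sub>R c k) B"
  shows "l2_le (\<lambda>k. bracket k ^ n *\<^sub>R c k) B"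
proof (rule l2_leI)
  fix F :: "(int^3) set" assume F: "finite F"
  obtain N :: nat where N: "(\<Sum>k\<in>F. bracket k) \<le> real N" using real_arch_simple by blast
  have "min (bracket k) (real N) = bracket k" if "k \<in> F" for k
    using member_le_sum[OF that _ F, of bracket] N less_imp_le[OF bracket_pos] by force
  then have "(\<Sum>k\<in>F. (norm (bracket k ^ n *\<^sub>R c k))\<^sup>2) = (\<Sum>k\<in>F. (norm (min (bracket k) (real N) ^ n *\<^sub>R c k))\<^sup>2)"
    by (intro sum.cong) auto
  then show "(\<Sum>k\<in>F. (norm (bracket k ^ n *\<^sub>R c k))\<^sup>2) \<le> B" using l2_leD[OF assms F] by simp
qed

lemma min_weight_bounded: "\<bar>min (bracket k) (real N) ^ n\<bar> \<le> real N ^ n"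
  using bracket_pos[of k] by (auto simp: power_abs intro!: power_mono)

lemma min_weight_le: "\<bar>min (bracket k) (real N) ^ n\<bar> \<le> bracket k ^ n"
  using bracket_pos[of k] by (auto simp: power_abs intro!: power_mono)

lemma subadd_min_weight: "subadd_weight (\<lambda>k. min (bracket k) (real N) ^ n) (2 ^ n)"
  by (intro subadd_weight_power subadd_weight_min subadd_weight_bracket) simp

lemma norm_weighted_le:
  assumes "\<And>k. \<bar>w k\<bar> \<le> c" "l2_le (\<lambda>k. w k *\<^sub>R coef z k) (r\<^sup>2)" "0 \<le> r"
  shows "norm (weighted w z) \<le> r"
  by (rule norm_ell2_le) (simp_all only: coef_weighted[OF assms(1), abs_def] assms(2,3))

lemma l2_le_weighted:
  assumes "\<And>k. \<bar>w k\<bar> \<le> c"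
  shows "l2_le (\<lambda>k. w k *\<^sub>R coef z k) ((norm (weighted w z))\<^sup>2)"
  using l2_le_coef[of "weighted w z"] by (simp only: coef_weighted[OF assms, abs_def])

lemma weighted_has_vector_derivative:
  assumes "\<And>k. \<bar>w k\<bar> \<le> c" "(z has_vector_derivative z') (at t)"
  shows "((\<lambda>s. weighted w (z s)) has_vector_derivative weighted w z') (at t)"
  by (rule bounded_linear.has_vector_derivative[OF bounded_linear_weighted[OF assms(1)] assms(2)])

lemma increment_le_both:
  fixes F :: "real \<Rightarrow> 'a::banach"
  assumes F: "\<And>s. (F has_vector_derivative f s) (at s)"
    and le: "\<And>s. \<bar>s\<bar> \<le> T \<Longrightarrow> norm (f s) \<le> K" and ab: "\<bar>a\<bar> \<le> T" "\<bar>b\<bar> \<le> T"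
  shows "norm (F b - F a) \<le> K * \<bar>b - a\<bar>"
proof -
  have *: "norm (F b - F a) \<le> K * (b - a)" if "a \<le> b" "\<bar>a\<bar> \<le> T" "\<bar>b\<bar> \<le> T" for a b
  proof -
    have "norm (F b - F a) \<le> K * b - K * a"
    proof (rule norm_increment_le[OF F])
      show "((\<lambda>s. K * s) has_vector_derivative K) (at s)" for s
        unfolding has_real_derivative_iff_has_vector_derivative[symmetric] by (auto intro!: derivative_eq_intros)
    qed (use le that in auto)
    then show ?thesis by (simp add: right_diff_distrib)
  qed
  show ?thesis
    using *[of a b] *[of b a] ab by (cases "a \<le> b") (auto simp: norm_minus_commute)
qed

text \<open>Let \<open>M\<close> be the maximum over \<open>[-T, T]\<close> of the norm with truncated weight. If \<open>M > B\<close>, the choice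
\<open>R = M / B\<close> bounds the time derivative in this norm by a multiple of \<open>(M B)\<^sup>1\<^sup>/\<^sup>2\<close>. Integration and the inequality
between arithmetic and geometric mean, which absorbs half of \<open>M\<close>, give a bound of \<open>M\<close> that is linear in
\<open>B\<close>, quadratic in \<open>T\<close> and independent of the truncation.\<close>

lemma growth_step:
  assumes \<alpha>: "\<alpha> > 0" and z: "\<And>t. (z has_vector_derivative voigt \<alpha> (z t) (z t)) (at t)"
    and E: "\<And>t. norm (z t) \<le> Y" and Y: "0 \<le> Y"
    and low: "\<And>s. \<bar>s\<bar> \<le> T \<Longrightarrow> l2_le (\<lambda>k. bracket k ^ n *\<^sub>R coef (z s) k) (B\<^sup>2)" and B: "B \<ge> 1"
    and init: "l2_le (\<lambda>k. bracket k ^ Suc n *\<^sub>R coef (z 0) k) (Y\<^sup>2)" and t: "\<bar>t\<bar> \<le> T"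
  shows "l2_le (\<lambda>k. bracket k ^ Suc n *\<^sub>R coef (z t) k) ((2 * Y + (1 + 2 * (2 * bracket_const \<alpha> ^ 6 * conv_const * (2 ^ Suc n)\<^sup>2 * Y\<^sup>2) * T\<^sup>2) * B)\<^sup>2)"
proof (rule l2_le_min_limit)
  fix N :: nat
  define w where "w k = min (bracket k) (real N) ^ Suc n" for k
  define D where "D = 2 * bracket_const \<alpha> ^ 6 * conv_const * (2 ^ Suc n)\<^sup>2 * Y\<^sup>2"
  have D: "0 \<le> D" using bracket_const_ge1[of \<alpha>] conv_const_pos by (simp add: D_def)
  have T: "0 \<le> T" using t by linarith
  have wb: "\<bar>w k\<bar> \<le> real N ^ Suc n" for k unfolding w_def by (rule min_weight_bounded)
  have w0: "0 \<le> w k" for k using bracket_pos[of k] by (simp add: w_def)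
  have wj: "w k / bracket k \<le> bracket k ^ n" for k
  proof -
    have "w k \<le> bracket k ^ Suc n" using min_weight_le[of k N "Suc n"] by (simp add: w_def)
    then show ?thesis using bracket_pos[of k] by (simp add: pos_divide_le_eq mult.commute)
  qed
  let ?Z = "\<lambda>s. norm (weighted w (z s))"
  have cont: "continuous_on {-T..T} ?Z"
    by (intro continuous_on_norm continuous_at_imp_continuous_on ballI has_vector_derivative_continuous[OF weighted_has_vector_derivative[OF wb z]])
  have "\<exists>x\<in>{-T..T}. \<forall>y\<in>{-T..T}. ?Z y \<le> ?Z x"
    by (rule continuous_attains_sup[OF compact_Icc _ cont]) (use T in auto)
  then obtain x where x: "x \<in> {-T..T}" "\<And>y. y \<in> {-T..T} \<Longrightarrow> ?Z y \<le> ?Z x" by blast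
  define M where "M = ?Z x"
  have M0: "0 \<le> M" by (simp add: M_def)
  have ZM: "?Z s \<le> M" if "\<bar>s\<bar> \<le> T" for s using x(2)[of s] that by (auto simp: M_def abs_le_iff)
  have Z0: "?Z 0 \<le> Y"
  proof (rule norm_weighted_le[OF wb])
    show "l2_le (\<lambda>k. w k *\<^sub>R coef (z 0) k) (Y\<^sup>2)"
    proof (rule l2_le_dom1[OF init])
      fix k
      show "norm (w k *\<^sub>R coef (z 0) k) \<le> norm (bracket k ^ Suc n *\<^sub>R coef (z 0) k)"
        using mult_right_mono[OF min_weight_le[of k N "Suc n"], of "norm (coef (z 0) k)"] bracket_pos[of k]
        by (simp add: w_def abs_mult power_abs)
    qed
  qed (rule Y)
  have "M \<le> 2 * Y + (1 + 2 * D * T\<^sup>2) * B"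
  proof (cases "M \<le> B")
    case True
    have "1 * B \<le> (1 + 2 * D * T\<^sup>2) * B" using D B by (intro mult_right_mono) auto
    then show ?thesis using True Y by linarith
  next
    case False
    define R where "R = M / B"
    have R: "R \<ge> 1" using False B by (simp add: R_def)
    have der: "norm (weighted w (voigt \<alpha> (z s) (z s))) \<le> sqrt (2 * D * M * B)" if s: "\<bar>s\<bar> \<le> T" for s
    proof (rule norm_weighted_le[OF wb])
      have l0: "l2_le (\<lambda>k. (w k / bracket k) *\<^sub>R coef (z s) k) (B\<^sup>2)"
      proof (rule l2_le_dom1[OF low[OF s]])
        fix k
        show "norm ((w k / bracket k) *\<^sub>R coef (z s) k) \<le> norm (bracket k ^ n *\<^sub>R coef (z s) k)"
          using mult_right_mono[OF wj[of k], of "norm (coef (z s) k)"] w0[of k] bracket_pos[of k] by simp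
      qed
      have l1: "l2_le (\<lambda>k. w k *\<^sub>R coef (z s) k) (M\<^sup>2)"
        using l2_le_weighted[OF wb, where z = "z s"] by (rule l2_le_mono) (intro power_mono ZM s, simp)
      have "l2_le (\<lambda>k. w k *\<^sub>R voigt_seq \<alpha> (z s) (z s) k)
        (bracket_const \<alpha> ^ 6 * conv_const * (2 ^ Suc n)\<^sup>2 * R * ((B\<^sup>2 + M\<^sup>2 / R\<^sup>2) * (norm (z s))\<^sup>2 + (B\<^sup>2 + M\<^sup>2 / R\<^sup>2) * (norm (z s))\<^sup>2))"
        by (rule l2_le_weighted_voigt_seq[OF \<alpha> _ R l0 l1 l0 l1]) (unfold w_def, rule subadd_min_weight)
      then have "l2_le (\<lambda>k. w k *\<^sub>R voigt_seq \<alpha> (z s) (z s) k) (2 * D * M * B)"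
      proof (rule l2_le_mono)
        have MR: "M\<^sup>2 / R\<^sup>2 = B\<^sup>2" using False B M0 by (simp add: R_def power_divide)
        have "(norm (z s))\<^sup>2 \<le> Y\<^sup>2" by (intro power_mono E) simp
        then have "bracket_const \<alpha> ^ 6 * conv_const * (2 ^ Suc n)\<^sup>2 * R * (4 * B\<^sup>2 * (norm (z s))\<^sup>2) \<le> bracket_const \<alpha> ^ 6 * conv_const * (2 ^ Suc n)\<^sup>2 * R * (4 * B\<^sup>2 * Y\<^sup>2)"
          using bracket_const_ge1[of \<alpha>] conv_const_pos R by (intro mult_left_mono) auto
        also have "\<dots> = 2 * D * (R * B) * B" by (simp add: D_def power2_eq_square)
        also have "R * B = M" using B by (simp add: R_def)
        finally show "bracket_const \<alpha> ^ 6 * conv_const * (2 ^ Suc n)\<^sup>2 * R * ((B\<^sup>2 + M\<^sup>2 / R\<^sup>2) * (norm (z s))\<^sup>2 + (B\<^sup>2 + M\<^sup>2 / R\<^sup>2) * (norm (z s))\<^sup>2) \<le> 2 * D * M * B"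
          unfolding MR by (simp add: algebra_simps)
      qed
      then show "l2_le (\<lambda>k. w k *\<^sub>R coef (voigt \<alpha> (z s) (z s)) k) ((sqrt (2 * D * M * B))\<^sup>2)"
        using D M0 B by (simp add: coef_voigt[OF \<alpha>])
    qed (use D M0 B in simp)
    have "norm (weighted w (z x) - weighted w (z 0)) \<le> sqrt (2 * D * M * B) * \<bar>x - 0\<bar>"
      by (rule increment_le_both[OF weighted_has_vector_derivative[OF wb z] der]) (use x(1) T in auto)
    also have "\<dots> \<le> sqrt (2 * D * M * B) * T" using x(1) D M0 B by (intro mult_left_mono) auto
    also have "\<dots> = sqrt (M * (2 * D * B * T\<^sup>2))" using T by (simp add: real_sqrt_mult mult_ac)
    also have "\<dots> \<le> (M + 2 * D * B * T\<^sup>2) / 2" using M0 D B by (intro arith_geo_mean_sqrt) auto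
    finally have "M - ?Z 0 \<le> (M + 2 * D * B * T\<^sup>2) / 2"
      using norm_triangle_ineq2[of "weighted w (z x)" "weighted w (z 0)"] by (simp add: M_def)
    moreover have "M' \<le> 2 * Y + X" if "M' - Z' \<le> (M' + X) / 2" "Z' \<le> Y" for M' Z' X :: real
      using that by (simp add: field_simps)
    ultimately have "M \<le> 2 * Y + 2 * D * B * T\<^sup>2" using Z0 by blast
    then show ?thesis using B by (simp add: algebra_simps)
  qed
  then have "?Z t \<le> 2 * Y + (1 + 2 * D * T\<^sup>2) * B" using ZM[OF t] by linarith
  then have "(?Z t)\<^sup>2 \<le> (2 * Y + (1 + 2 * D * T\<^sup>2) * B)\<^sup>2" by (rule power_mono) simp
  from l2_le_mono[OF l2_le_weighted[OF wb, where z = "z t"] this]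
  show "l2_le (\<lambda>k. min (bracket k) (real N) ^ Suc n *\<^sub>R coef (z t) k) ((2 * Y + (1 + 2 * (2 * bracket_const \<alpha> ^ 6 * conv_const * (2 ^ Suc n)\<^sup>2 * Y\<^sup>2) * T\<^sup>2) * B)\<^sup>2)"
    by (simp only: w_def D_def)
qed

text \<open>The constants of the recursion in the number of derivatives, where \<open>Y\<close> bounds the initial norms.\<close>

primrec growthC :: "real \<Rightarrow> real \<Rightarrow> nat \<Rightarrow> real" where
  "growthC \<alpha> Y 0 = 1 + Y"
| "growthC \<alpha> Y (Suc n) = 2 * Y + (1 + 2 * (2 * bracket_const \<alpha> ^ 6 * conv_const * (2 ^ Suc n)\<^sup>2 * Y\<^sup>2)) * growthC \<alpha> Y n"

lemma growthC_ge1: "0 \<le> Y \<Longrightarrow> 1 \<le> growthC \<alpha> Y n"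
proof (induction n)
  case (Suc n)
  have "0 \<le> 2 * (2 * bracket_const \<alpha> ^ 6 * conv_const * (2 ^ Suc n)\<^sup>2 * Y\<^sup>2)" using bracket_const_ge1[of \<alpha>] conv_const_pos by simp
  then have "1 * 1 \<le> (1 + 2 * (2 * bracket_const \<alpha> ^ 6 * conv_const * (2 ^ Suc n)\<^sup>2 * Y\<^sup>2)) * growthC \<alpha> Y n"
    using Suc by (intro mult_mono) auto
  then show ?case using Suc by simp
qed simp

lemma polynomial_growth:
  assumes \<alpha>: "\<alpha> > 0" and z: "\<And>t. (z has_vector_derivative voigt \<alpha> (z t) (z t)) (at t)"
    and init: "l2_le (\<lambda>k. bracket k ^ n *\<^sub>R coef (z 0) k) (Y\<^sup>2)" and Y: "0 \<le> Y" and t: "\<bar>t\<bar> \<le> T"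
  shows "l2_le (\<lambda>k. bracket k ^ n *\<^sub>R coef (z t) k) ((growthC \<alpha> Y n * (1 + T) ^ (2 * n))\<^sup>2)"
proof -
  have drop: "l2_le (\<lambda>k. bracket k ^ j *\<^sub>R coef (z 0) k) (Y\<^sup>2)" if "j \<le> n" for j
  proof (rule l2_le_dom1[OF init])
    fix k
    have "bracket k ^ j \<le> bracket k ^ n" by (rule power_increasing[OF that bracket_ge1])
    then show "norm (bracket k ^ j *\<^sub>R coef (z 0) k) \<le> norm (bracket k ^ n *\<^sub>R coef (z 0) k)"
      using bracket_pos[of k] by (simp add: mult_right_mono)
  qed
  have "norm (z 0) \<le> Y" by (rule norm_ell2_le) (use drop[of 0] Y in auto)
  moreover have "norm (z s) = norm (z 0)" for s
    by (rule orthogonal_ode_norm_const[OF z]) (use voigt_energy[OF \<alpha>] in \<open>simp add: inner_commute\<close>)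
  ultimately have E: "norm (z s) \<le> Y" for s by metis
  have "j \<le> n \<Longrightarrow> \<bar>t\<bar> \<le> T \<Longrightarrow> l2_le (\<lambda>k. bracket k ^ j *\<^sub>R coef (z t) k) ((growthC \<alpha> Y j * (1 + T) ^ (2 * j))\<^sup>2)" for j t
  proof (induction j arbitrary: t)
    case 0
    have "(norm (z t))\<^sup>2 \<le> (1 + Y)\<^sup>2" using E[of t] Y by (intro power_mono) auto
    then show ?case using l2_le_mono[OF l2_le_coef[of "z t"]] by simp
  next
    case (Suc j)
    have T: "0 \<le> T" using Suc.prems by linarith
    define c where "c = growthC \<alpha> Y j"
    define D where "D = 2 * (2 * bracket_const \<alpha> ^ 6 * conv_const * (2 ^ Suc j)\<^sup>2 * Y\<^sup>2)"
    have D: "0 \<le> D" using bracket_const_ge1[of \<alpha>] conv_const_pos by (simp add: D_def)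
    have c: "1 \<le> c" unfolding c_def by (rule growthC_ge1[OF Y])
    have p1: "1 \<le> (1 + T) ^ i" for i using T by (simp add: one_le_power)
    have B: "1 \<le> c * (1 + T) ^ (2 * j)" using mult_mono[OF c p1[of "2 * j"]] c by simp
    have "l2_le (\<lambda>k. bracket k ^ Suc j *\<^sub>R coef (z t) k) ((2 * Y + (1 + D * T\<^sup>2) * (c * (1 + T) ^ (2 * j)))\<^sup>2)"
      unfolding D_def
      by (rule growth_step[OF \<alpha> z E Y _ B drop]) (use Suc in \<open>auto simp: c_def\<close>)
    then show ?case
    proof (rule l2_le_mono, intro power_mono)
      have s: "(1 + T) ^ (2 * Suc j) = (1 + T) ^ (2 * j) * (1 + T)\<^sup>2" by (simp add: power2_eq_square mult_ac)
      have "1 + D * T\<^sup>2 \<le> (1 + D) * (1 + T)\<^sup>2"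
      proof -
        have "1 * 1 \<le> (1 + T)\<^sup>2" using p1[of 2] by simp
        moreover have "D * T\<^sup>2 \<le> D * (1 + T)\<^sup>2" using D T by (intro mult_left_mono power_mono) auto
        ultimately show ?thesis by (simp add: distrib_right)
      qed
      then have "(1 + D * T\<^sup>2) * (c * (1 + T) ^ (2 * j)) \<le> ((1 + D) * (1 + T)\<^sup>2) * (c * (1 + T) ^ (2 * j))"
        using c T by (intro mult_right_mono) auto
      also have "\<dots> = (1 + D) * c * (1 + T) ^ (2 * Suc j)" unfolding s by (simp only: mult_ac)
      finally have 1: "(1 + D * T\<^sup>2) * (c * (1 + T) ^ (2 * j)) \<le> (1 + D) * c * (1 + T) ^ (2 * Suc j)" .
      have "2 * Y * 1 \<le> 2 * Y * (1 + T) ^ (2 * Suc j)" using Y by (intro mult_left_mono p1) auto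
      then have "2 * Y + (1 + D * T\<^sup>2) * (c * (1 + T) ^ (2 * j)) \<le> (2 * Y + (1 + D) * c) * (1 + T) ^ (2 * Suc j)"
        using 1 by (simp only: distrib_right mult_1_right)
      then show "2 * Y + (1 + D * T\<^sup>2) * (c * (1 + T) ^ (2 * j)) \<le> growthC \<alpha> Y (Suc j) * (1 + T) ^ (2 * Suc j)"
        by (simp only: growthC.simps D_def c_def)
      show "0 \<le> 2 * Y + (1 + D * T\<^sup>2) * (c * (1 + T) ^ (2 * j))" using Y D c T by simp
    qed
  qed
  from this[OF order_refl t] show ?thesis .
qed

section \<open>Continuous differentiability in higher norms\<close>

lemma zero_derivative_const:
  fixes f :: "real \<Rightarrow> 'a::banach"
  assumes "\<And>t. (f has_vector_derivative 0) (at t)"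
  shows "f t = f 0"
proof -
  have "norm (f t - f 0) \<le> 0 * \<bar>t - 0\<bar>"
    by (rule increment_le_both[OF assms, where T = "\<bar>t\<bar>"]) auto
  then show ?thesis by simp
qed

lemma coef_has_vector_derivative:
  "(z has_vector_derivative z') (at t) \<Longrightarrow> ((\<lambda>s. coef (z s) k) has_vector_derivative coef z' k) (at t)"
  by (rule bounded_linear.has_vector_derivative[OF bounded_linear_coef])

text \<open>The weighted right-hand side is Lipschitz in time, hence has an antiderivative in \<open>ell2\<close>. Comparing
coefficients identifies this antiderivative with the weighted path.\<close>

lemma higher_regularity:
  assumes \<alpha>: "\<alpha> > 0" and z: "\<And>t. (z has_vector_derivative voigt \<alpha> (z t) (z t)) (at t)"
    and init: "l2_le (\<lambda>k. bracket k ^ n *\<^sub>R coef (z 0) k) (Y\<^sup>2)" and Y: "0 \<le> Y"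
  shows "\<exists>Z g. (\<forall>t k. coef (Z t) k = bracket k ^ n *\<^sub>R coef (z t) k) \<and>
     (\<forall>t k. coef (g t) k = bracket k ^ n *\<^sub>R coef (voigt \<alpha> (z t) (z t)) k) \<and>
     (\<forall>t. (Z has_vector_derivative g t) (at t)) \<and> continuous_on UNIV g"
proof -
  have "\<exists>M\<ge>0. \<forall>s. \<bar>s\<bar> \<le> T \<longrightarrow> l2_le (\<lambda>k. bracket k ^ n *\<^sub>R coef (z s) k) (M\<^sup>2)" if "0 \<le> T" for T
    using polynomial_growth[OF \<alpha> z init Y] growthC_ge1[OF Y, of \<alpha> n] that
    by (intro exI[of _ "growthC \<alpha> Y n * (1 + T) ^ (2 * n)"]) auto
  then obtain M where M0: "\<And>T. 0 \<le> T \<Longrightarrow> 0 \<le> M T"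
    and M: "\<And>T s. 0 \<le> T \<Longrightarrow> \<bar>s\<bar> \<le> T \<Longrightarrow> l2_le (\<lambda>k. bracket k ^ n *\<^sub>R coef (z s) k) ((M T)\<^sup>2)" by metis
  define c where "c = 2 * bracket_const \<alpha> ^ 6 * conv_const * (2 ^ n)\<^sup>2"
  have c0: "0 \<le> c" using bracket_const_ge1[of \<alpha>] conv_const_pos by (simp add: c_def)
  have sw: "subadd_weight (\<lambda>k. bracket k ^ n) (2 ^ n)" by (rule subadd_weight_power[OF subadd_weight_bracket])
  have low: "norm x \<le> r" if "l2_le (\<lambda>k. bracket k ^ n *\<^sub>R coef x k) (r\<^sup>2)" "0 \<le> r" for x r
  proof (rule norm_ell2_le[OF _ that(2)])
    show "l2_le (coef x) (r\<^sup>2)"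
    proof (rule l2_le_dom1[OF that(1)])
      fix k
      have "1 * norm (coef x k) \<le> bracket k ^ n * norm (coef x k)" by (intro mult_right_mono one_le_power bracket_ge1) simp
      then show "norm (coef x k) \<le> norm (bracket k ^ n *\<^sub>R coef x k)" using bracket_pos[of k] by simp
    qed
  qed
  \<comment> \<open>\<open>voigt\<close> is bounded for the weighted norm.\<close>
  have bil: "l2_le (\<lambda>k. bracket k ^ n *\<^sub>R coef (voigt \<alpha> x y) k) (2 * c * a\<^sup>2 * b\<^sup>2)"
    if x: "l2_le (\<lambda>k. bracket k ^ n *\<^sub>R coef x k) (a\<^sup>2)" and y: "l2_le (\<lambda>k. bracket k ^ n *\<^sub>R coef y k) (b\<^sup>2)"
      and ab: "0 \<le> a" "0 \<le> b" for x y a b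
  proof -
    have red: "l2_le (\<lambda>k. (bracket k ^ n / bracket k) *\<^sub>R coef x k) (a\<^sup>2)" if "l2_le (\<lambda>k. bracket k ^ n *\<^sub>R coef x k) (a\<^sup>2)" for x a
    proof (rule l2_le_dom1[OF that])
      fix k
      have "bracket k ^ n / bracket k \<le> bracket k ^ n" using bracket_ge1[of k] bracket_pos[of k] by (simp add: divide_le_eq mult_le_cancel_left1)
      from mult_right_mono[OF this, of "norm (coef x k)"]
      show "norm ((bracket k ^ n / bracket k) *\<^sub>R coef x k) \<le> norm (bracket k ^ n *\<^sub>R coef x k)" using bracket_pos[of k] by simp
    qed
    have "l2_le (\<lambda>k. bracket k ^ n *\<^sub>R voigt_seq \<alpha> x y k)
       (bracket_const \<alpha> ^ 6 * conv_const * (2 ^ n)\<^sup>2 * 1 * ((a\<^sup>2 + a\<^sup>2 / 1\<^sup>2) * (norm y)\<^sup>2 + (b\<^sup>2 + b\<^sup>2 / 1\<^sup>2) * (norm x)\<^sup>2))"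
      by (rule l2_le_weighted_voigt_seq[OF \<alpha> sw order_refl red[OF x] x red[OF y] y])
    then have "l2_le (\<lambda>k. bracket k ^ n *\<^sub>R voigt_seq \<alpha> x y k) (2 * c * a\<^sup>2 * b\<^sup>2)"
    proof (rule l2_le_mono)
      have "(norm y)\<^sup>2 \<le> b\<^sup>2" "(norm x)\<^sup>2 \<le> a\<^sup>2" using low[OF x ab(1)] low[OF y ab(2)] by (auto intro: power_mono)
      then have "(a\<^sup>2 + a\<^sup>2 / 1\<^sup>2) * (norm y)\<^sup>2 + (b\<^sup>2 + b\<^sup>2 / 1\<^sup>2) * (norm x)\<^sup>2 \<le> (a\<^sup>2 + a\<^sup>2 / 1\<^sup>2) * b\<^sup>2 + (b\<^sup>2 + b\<^sup>2 / 1\<^sup>2) * a\<^sup>2"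
        by (intro add_mono mult_left_mono) auto
      then have "bracket_const \<alpha> ^ 6 * conv_const * (2 ^ n)\<^sup>2 * 1 * ((a\<^sup>2 + a\<^sup>2 / 1\<^sup>2) * (norm y)\<^sup>2 + (b\<^sup>2 + b\<^sup>2 / 1\<^sup>2) * (norm x)\<^sup>2)
         \<le> bracket_const \<alpha> ^ 6 * conv_const * (2 ^ n)\<^sup>2 * 1 * ((a\<^sup>2 + a\<^sup>2 / 1\<^sup>2) * b\<^sup>2 + (b\<^sup>2 + b\<^sup>2 / 1\<^sup>2) * a\<^sup>2)"
        using bracket_const_ge1[of \<alpha>] conv_const_pos by (intro mult_left_mono) auto
      also have "\<dots> = 2 * c * a\<^sup>2 * b\<^sup>2" by (simp add: c_def algebra_simps)
      finally show "bracket_const \<alpha> ^ 6 * conv_const * (2 ^ n)\<^sup>2 * 1 * ((a\<^sup>2 + a\<^sup>2 / 1\<^sup>2) * (norm y)\<^sup>2 + (b\<^sup>2 + b\<^sup>2 / 1\<^sup>2) * (norm x)\<^sup>2) \<le> 2 * c * a\<^sup>2 * b\<^sup>2" .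
    qed
    then show ?thesis by (simp add: coef_voigt[OF \<alpha>])
  qed
  define Z where "Z t = weighted (\<lambda>k. bracket k ^ n) (z t)" for t
  define g where "g t = weighted (\<lambda>k. bracket k ^ n) (voigt \<alpha> (z t) (z t))" for t
  have cZ: "coef (Z t) k = bracket k ^ n *\<^sub>R coef (z t) k" for t k
    unfolding Z_def by (rule coef_weighted_l2[OF M[OF abs_ge_zero order_refl]])
  have cg: "coef (g t) k = bracket k ^ n *\<^sub>R coef (voigt \<alpha> (z t) (z t)) k" for t k
    unfolding g_def
    by (rule coef_weighted_l2, rule bil[OF M[OF abs_ge_zero order_refl] M[OF abs_ge_zero order_refl] M0[OF abs_ge_zero] M0[OF abs_ge_zero]])
  have contg: "continuous_on UNIV g"
  proof (rule continuous_at_imp_continuous_on, rule ballI)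
    fix t :: real
    define T where "T = \<bar>t\<bar> + 1"
    have T: "0 \<le> T" by (simp add: T_def)
    define m where "m = M T"
    have m0: "0 \<le> m" using M0[OF T] by (simp add: m_def)
    have mm: "l2_le (\<lambda>k. bracket k ^ n *\<^sub>R coef (z s) k) (m\<^sup>2)" if "\<bar>s\<bar> \<le> T" for s
      using M[OF T that] by (simp add: m_def)
    define G where "G = sqrt (2 * c * m\<^sup>2 * m\<^sup>2)"
    have G0: "0 \<le> G" using c0 by (simp add: G_def)
    have G2: "G\<^sup>2 = 2 * c * m\<^sup>2 * m\<^sup>2" using c0 by (simp add: G_def)
    \<comment> \<open>Lipschitz continuity in the weighted norm, through truncated weights.\<close>
    have lipz: "l2_le (\<lambda>k. bracket k ^ n *\<^sub>R coef (z s - z t) k) ((G * \<bar>s - t\<bar>)\<^sup>2)" if s: "\<bar>s\<bar> \<le> T" for s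
    proof (rule l2_le_min_limit)
      fix N :: nat
      let ?w = "\<lambda>k. min (bracket k) (real N) ^ n"
      have wb: "\<bar>?w k\<bar> \<le> real N ^ n" for k by (rule min_weight_bounded)
      have "norm (weighted ?w (voigt \<alpha> (z r) (z r))) \<le> G" if r: "\<bar>r\<bar> \<le> T" for r
      proof (rule norm_weighted_le[OF wb _ G0])
        have b: "l2_le (\<lambda>k. bracket k ^ n *\<^sub>R coef (voigt \<alpha> (z r) (z r)) k) (G\<^sup>2)"
          unfolding G2 by (rule bil[OF mm[OF r] mm[OF r] m0 m0])
        show "l2_le (\<lambda>k. ?w k *\<^sub>R coef (voigt \<alpha> (z r) (z r)) k) (G\<^sup>2)"
        proof (rule l2_le_dom1[OF b])
          fix k
          show "norm (?w k *\<^sub>R coef (voigt \<alpha> (z r) (z r)) k) \<le> norm (bracket k ^ n *\<^sub>R coef (voigt \<alpha> (z r) (z r)) k)"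
            using mult_right_mono[OF min_weight_le[of k N n], of "norm (coef (voigt \<alpha> (z r) (z r)) k)"] bracket_pos[of k]
            by simp
        qed
      qed
      then have "norm (weighted ?w (z s) - weighted ?w (z t)) \<le> G * \<bar>s - t\<bar>"
        by (rule increment_le_both[OF weighted_has_vector_derivative[OF wb z], where T = T]) (use s in \<open>auto simp: T_def\<close>)
      then have "norm (weighted ?w (z s - z t)) \<le> G * \<bar>s - t\<bar>"
        by (simp add: linear_simps(2)[OF bounded_linear_weighted[OF wb]])
      then have "(norm (weighted ?w (z s - z t)))\<^sup>2 \<le> (G * \<bar>s - t\<bar>)\<^sup>2" by (rule power_mono) simp
      from l2_le_mono[OF l2_le_weighted[OF wb] this]
      show "l2_le (\<lambda>k. ?w k *\<^sub>R coef (z s - z t) k) ((G * \<bar>s - t\<bar>)\<^sup>2)" .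
    qed
    have lipg: "norm (g s - g t) \<le> sqrt (8 * c * m\<^sup>2) * G * \<bar>s - t\<bar>" if s: "\<bar>s\<bar> \<le> T" for s
    proof (rule norm_ell2_le)
      interpret bounded_bilinear "voigt \<alpha>" by (rule bounded_bilinear_voigt[OF \<alpha>])
      let ?d = "z s - z t"
      have tT: "\<bar>t\<bar> \<le> T" by (simp add: T_def)
      have "voigt \<alpha> (z s) (z s) - voigt \<alpha> (z t) (z t) = voigt \<alpha> (z s) ?d + voigt \<alpha> ?d (z t)"
        by (simp add: diff_left diff_right)
      then have eq: "coef (g s - g t) k = bracket k ^ n *\<^sub>R coef (voigt \<alpha> (z s) ?d) k + bracket k ^ n *\<^sub>R coef (voigt \<alpha> ?d (z t)) k" for k
        by (simp add: coef_simps cg flip: scaleR_add_right scaleR_diff_right) (metis coef_simps(2) coef_simps(3))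
      have Gs: "0 \<le> G * \<bar>s - t\<bar>" using G0 by simp
      have "l2_le (\<lambda>k. bracket k ^ n *\<^sub>R coef (voigt \<alpha> (z s) ?d) k + bracket k ^ n *\<^sub>R coef (voigt \<alpha> ?d (z t)) k)
         (2 * (2 * c * m\<^sup>2 * (G * \<bar>s - t\<bar>)\<^sup>2) + 2 * (2 * c * (G * \<bar>s - t\<bar>)\<^sup>2 * m\<^sup>2))"
        by (intro l2_le_add bil mm lipz s tT m0 Gs)
      moreover have "2 * (2 * c * m\<^sup>2 * (G * \<bar>s - t\<bar>)\<^sup>2) + 2 * (2 * c * (G * \<bar>s - t\<bar>)\<^sup>2 * m\<^sup>2) = (sqrt (8 * c * m\<^sup>2) * G * \<bar>s - t\<bar>)\<^sup>2"
        using c0 by (simp add: power_mult_distrib)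
      ultimately show "l2_le (coef (g s - g t)) ((sqrt (8 * c * m\<^sup>2) * G * \<bar>s - t\<bar>)\<^sup>2)"
        by (simp only: eq[abs_def])
    qed (use c0 G0 in simp)
    have "((\<lambda>s. g s - g t) \<longlongrightarrow> 0) (at t)"
    proof (rule Lim_null_comparison)
      have "\<forall>\<^sub>F s in at t. dist s t < 1" unfolding eventually_at by (rule exI[of _ 1]) auto
      then show "\<forall>\<^sub>F s in at t. norm (g s - g t) \<le> sqrt (8 * c * m\<^sup>2) * G * \<bar>s - t\<bar>"
        by eventually_elim (rule lipg, auto simp: T_def dist_real_def)
      have "((\<lambda>s. sqrt (8 * c * m\<^sup>2) * G * \<bar>s - t\<bar>) \<longlongrightarrow> sqrt (8 * c * m\<^sup>2) * G * \<bar>t - t\<bar>) (at t)"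
        by (intro tendsto_intros)
      then show "((\<lambda>s. sqrt (8 * c * m\<^sup>2) * G * \<bar>s - t\<bar>) \<longlongrightarrow> 0) (at t)" by simp
    qed
    then show "isCont g t" unfolding isCont_def by (rule LIM_zero_cancel)
  qed
  obtain F where F0: "F 0 = 0" and F: "\<And>t. (F has_vector_derivative g t) (at t)"
    using has_antiderivative[OF contg] by blast
  have "Z t = Z 0 + F t" for t
  proof (rule coef_eqI)
    fix k
    have "((\<lambda>s. bracket k ^ n *\<^sub>R coef (z s) k - coef (F s) k) has_vector_derivative 0) (at s)" for s
    proof -
      have "((\<lambda>s. bracket k ^ n *\<^sub>R coef (z s) k - coef (F s) k) has_vector_derivative
          bracket k ^ n *\<^sub>R coef (voigt \<alpha> (z s) (z s)) k - coef (g s) k) (at s)"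
        by (intro has_vector_derivative_diff bounded_linear.has_vector_derivative[OF bounded_linear_scaleR_right]
            coef_has_vector_derivative z F)
      then show ?thesis by (simp add: cg)
    qed
    from zero_derivative_const[OF this, of t]
    show "coef (Z t) k = coef (Z 0 + F t) k" by (simp add: cZ coef_simps F0 algebra_simps)
  qed
  then have "Z = (\<lambda>t. Z 0 + F t)" by (rule ext)
  moreover have "((\<lambda>t. Z 0 + F t) has_vector_derivative g t) (at t)" for t
    using has_vector_derivative_add[OF has_vector_derivative_const F] by simp
  ultimately have "(Z has_vector_derivative g t) (at t)" for t by metis
  then show ?thesis using cZ cg contg by blast
qed

lemma has_vector_derivative_quotient:
  assumes "(f has_vector_derivative f') (at t)"
  shows "((\<lambda>s. norm ((1 / (s - t)) *\<^sub>R (f s - f t) - f')) \<longlongrightarrow> 0) (at t)"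
proof -
  have "((\<lambda>s. norm (f s - f t - (s - t) *\<^sub>R f') / norm (s - t)) \<longlongrightarrow> 0) (at t)"
    using assms unfolding has_vector_derivative_def has_derivative_iff_norm by blast
  moreover have "\<forall>\<^sub>F s in at t. norm (f s - f t - (s - t) *\<^sub>R f') / norm (s - t) = norm ((1 / (s - t)) *\<^sub>R (f s - f t) - f')"
    using eventually_neq_at_within[of t t UNIV]
  proof eventually_elim
    case (elim s)
    have "(1 / (s - t)) *\<^sub>R (f s - f t) - f' = (1 / (s - t)) *\<^sub>R (f s - f t - (s - t) *\<^sub>R f')"
      using elim by (simp add: scaleR_diff_right)
    then show ?case by simp
  qed
  ultimately show ?thesis by (rule Lim_transform_eventually)
qed

lemma quotient_has_vector_derivative:
  assumes "((\<lambda>s. norm ((1 / (s - t)) *\<^sub>R (f s - f t) - f')) \<longlongrightarrow> 0) (at t)"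
  shows "(f has_vector_derivative f') (at t)"
  unfolding has_vector_derivative_def has_derivative_iff_norm
proof (intro conjI bounded_linear_scaleR_left)
  have "\<forall>\<^sub>F s in at t. norm ((1 / (s - t)) *\<^sub>R (f s - f t) - f') = norm (f s - f t - (s - t) *\<^sub>R f') / norm (s - t)"
    using eventually_neq_at_within[of t t UNIV]
  proof eventually_elim
    case (elim s)
    have "(1 / (s - t)) *\<^sub>R (f s - f t) - f' = (1 / (s - t)) *\<^sub>R (f s - f t - (s - t) *\<^sub>R f')"
      using elim by (simp add: scaleR_diff_right)
    then show ?case by simp
  qed
  then show "((\<lambda>s. norm (f s - f t - (s - t) *\<^sub>R f') / norm (s - t)) \<longlongrightarrow> 0) (at t)"
    by (rule Lim_transform_eventually[OF assms])
qed

lemma field_C1: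
  assumes \<alpha>: "\<alpha> > 0" and z: "\<And>t. (z has_vector_derivative voigt \<alpha> (z t) (z t)) (at t)"
    and init: "l2_le (\<lambda>k. bracket k ^ n *\<^sub>R coef (z 0) k) (Y\<^sup>2)" and Y: "0 \<le> Y" and sz: "\<And>t. solenoidal_state (z t)"
  shows "C1_with_deriv UNIV (sobolev (Suc n) \<inter> space_V) (sobolev_norm (Suc n)) (\<lambda>t. field_of \<alpha> (z t)) (\<lambda>t. field_of \<alpha> (voigt \<alpha> (z t) (z t)))"
proof -
  obtain Z g where cZ: "\<And>t k. coef (Z t) k = bracket k ^ n *\<^sub>R coef (z t) k"
    and cg: "\<And>t k. coef (g t) k = bracket k ^ n *\<^sub>R coef (voigt \<alpha> (z t) (z t)) k"
    and Z: "\<And>t. (Z has_vector_derivative g t) (at t)" and contg: "continuous_on UNIV g"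
    using higher_regularity[OF \<alpha> z init Y] by blast
  let ?u = "\<lambda>t. field_of \<alpha> (z t)" and ?u' = "\<lambda>t. field_of \<alpha> (voigt \<alpha> (z t) (z t))"
  define K where "K = sqrt (sobolev_const (Suc n)) * bracket_const \<alpha>"
  have uS: "?u t \<in> sobolev (Suc n)" for t
    using sobolev_from_coords(1)[OF \<alpha> field_of, of n "z t" "norm (Z t)"] l2_le_coef[of "Z t"] by (simp add: cZ[abs_def])
  have u'S: "?u' t \<in> sobolev (Suc n)" for t
    using sobolev_from_coords(1)[OF \<alpha> field_of, of n "voigt \<alpha> (z t) (z t)" "norm (g t)"] l2_le_coef[of "g t"] by (simp add: cg[abs_def])
  have quot: "sobolev_norm (Suc n) (\<lambda>x. (1 / (s - t)) *\<^sub>R (?u s x - ?u t x) - ?u' t x) \<le> K * norm ((1 / (s - t)) *\<^sub>R (Z s - Z t) - g t)" for s t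
    unfolding K_def
  proof (rule sobolev_from_coords(2)[OF \<alpha>])
    have s1: "sqint (\<lambda>x. ?u s x - ?u t x)" by (intro sqint_diff field_of)
    have s2: "sqint (\<lambda>x. (1 / (s - t)) *\<^sub>R (?u s x - ?u t x))" by (rule sqint_cmult[OF s1])
    show "sqint (\<lambda>x. (1 / (s - t)) *\<^sub>R (?u s x - ?u t x) - ?u' t x)" by (rule sqint_diff[OF s2 field_of(1)])
    show "fcoef (\<lambda>x. (1 / (s - t)) *\<^sub>R (?u s x - ?u t x) - ?u' t x) k = (1 / energy_weight \<alpha> k) *\<^sub>R ((1 / (s - t)) *\<^sub>R (coef (z s) k - coef (z t) k) - coef (voigt \<alpha> (z t) (z t)) k)" for k
      unfolding fcoef_diff[OF s2 field_of(1)] fcoef_cmult fcoef_diff[OF field_of(1) field_of(1)] field_of(2)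
      by (simp only: scaleR_diff_right scaleR_left_commute)
    have "coef ((1 / (s - t)) *\<^sub>R (Z s - Z t) - g t) = (\<lambda>k. bracket k ^ n *\<^sub>R ((1 / (s - t)) *\<^sub>R (coef (z s) k - coef (z t) k) - coef (voigt \<alpha> (z t) (z t)) k))"
      by (rule ext) (simp only: coef_simps cZ cg scaleR_diff_right scaleR_left_commute)
    then show "l2_le (\<lambda>k. bracket k ^ n *\<^sub>R ((1 / (s - t)) *\<^sub>R (coef (z s) k - coef (z t) k) - coef (voigt \<alpha> (z t) (z t)) k)) ((norm ((1 / (s - t)) *\<^sub>R (Z s - Z t) - g t))\<^sup>2)"
      using l2_le_coef by metis
  qed simp
  have cont: "sobolev_norm (Suc n) (\<lambda>x. ?u' s x - ?u' t x) \<le> K * norm (g s - g t)" for s t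
    unfolding K_def
  proof (rule sobolev_from_coords(2)[OF \<alpha>])
    show "sqint (\<lambda>x. ?u' s x - ?u' t x)" by (intro sqint_diff field_of)
    show "fcoef (\<lambda>x. ?u' s x - ?u' t x) k = (1 / energy_weight \<alpha> k) *\<^sub>R (coef (voigt \<alpha> (z s) (z s)) k - coef (voigt \<alpha> (z t) (z t)) k)" for k
      unfolding fcoef_diff[OF field_of(1) field_of(1)] field_of(2) by (simp only: scaleR_diff_right)
    have "coef (g s - g t) = (\<lambda>k. bracket k ^ n *\<^sub>R (coef (voigt \<alpha> (z s) (z s)) k - coef (voigt \<alpha> (z t) (z t)) k))"
      by (rule ext) (simp only: coef_simps cg scaleR_diff_right)
    then show "l2_le (\<lambda>k. bracket k ^ n *\<^sub>R (coef (voigt \<alpha> (z s) (z s)) k - coef (voigt \<alpha> (z t) (z t)) k)) ((norm (g s - g t))\<^sup>2)"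
      using l2_le_coef by metis
  qed simp
  show ?thesis
    unfolding C1_with_deriv_def
  proof (intro ballI conjI)
    fix t :: real
    show "?u t \<in> sobolev (Suc n) \<inter> space_V" using uS field_V[OF \<alpha> sz] by blast
    show "?u' t \<in> sobolev (Suc n) \<inter> space_V" using u'S field_V[OF \<alpha> solenoidal_state_voigt[OF \<alpha>]] by blast
    show "((\<lambda>s. sobolev_norm (Suc n) (\<lambda>x. (1 / (s - t)) *\<^sub>R (?u s x - ?u t x) - ?u' t x)) \<longlongrightarrow> 0) (at t)"
    proof (rule tendsto_sandwich[OF _ _ tendsto_const])
      show "((\<lambda>s. K * norm ((1 / (s - t)) *\<^sub>R (Z s - Z t) - g t)) \<longlongrightarrow> 0) (at t)"
        using tendsto_mult[OF tendsto_const[of K] has_vector_derivative_quotient[OF Z[of t]]] by simp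
    qed (use quot sobolev_norm_nonneg in auto)
    show "((\<lambda>s. sobolev_norm (Suc n) (\<lambda>x. ?u' s x - ?u' t x)) \<longlongrightarrow> 0) (at t)"
    proof (rule tendsto_sandwich[OF _ _ tendsto_const])
      have "isCont g t" using contg by (simp add: continuous_on_eq_continuous_at)
      then have "((\<lambda>s. K * norm (g s - g t)) \<longlongrightarrow> K * norm (g t - g t)) (at t)"
        unfolding isCont_def by (intro tendsto_mult tendsto_const tendsto_norm tendsto_diff)
      then show "((\<lambda>s. K * norm (g s - g t)) \<longlongrightarrow> 0) (at t)" by simp
    qed (use cont sobolev_norm_nonneg in auto)
  qed
qed

section \<open>Equivalence with the ordinary differential equation\<close>

lemma solenoidal_state_preserved:
  assumes \<alpha>: "\<alpha> > 0" and z: "\<And>t. (z has_vector_derivative voigt \<alpha> (z t) (z t)) (at t)" and 0: "solenoidal_state (z 0)"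
  shows "solenoidal_state (z t)"
  unfolding solenoidal_state_def
proof
  fix k
  have bl: "bounded_linear (leray_symbol k)"
    by (rule bounded_linear_intro[where K = 1]) (auto simp: leray_symbol_linear norm_leray_symbol_le)
  have "((\<lambda>s. leray_symbol k (coef (z s) k) - coef (z s) k) has_vector_derivative 0) (at s)" for s
  proof -
    have "((\<lambda>s. leray_symbol k (coef (z s) k) - coef (z s) k) has_vector_derivative
        leray_symbol k (coef (voigt \<alpha> (z s) (z s)) k) - coef (voigt \<alpha> (z s) (z s)) k) (at s)"
      by (intro has_vector_derivative_diff bounded_linear.has_vector_derivative[OF bl] coef_has_vector_derivative z)
    then show ?thesis using solenoidal_state_voigt[OF \<alpha>, of "z s" "z s"] by (simp add: solenoidal_state_def)
  qed
  from zero_derivative_const[OF this, of t] show "leray_symbol k (coef (z t) k) = coef (z t) k"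
    using 0 by (simp add: solenoidal_state_def)
qed

lemma weak_form_eq:
  assumes \<alpha>: "\<alpha> > 0" and u: "u \<in> space_V" and u': "u' \<in> space_V" and v: "v \<in> space_V"
  shows "L2_inner u' v + \<alpha>\<^sup>2 * stokes_ext u' v + advection_ext u u v
    = (energy_coord \<alpha> u' - voigt \<alpha> (energy_coord \<alpha> u) (energy_coord \<alpha> u)) \<bullet> energy_coord \<alpha> v"
  using stokes_ext_eq[OF _ u' v, of \<alpha>] advection_ext_eq[OF \<alpha> u u v] \<alpha> by (simp add: inner_diff_left)

text \<open>The defect is itself the energy coordinate of an admissible test field, and testing with that field
shows that its norm is zero.\<close>

lemma weak_form_imp_ode:
  assumes \<alpha>: "\<alpha> > 0" and u: "u \<in> space_V" and u': "u' \<in> space_V"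
    and eq: "\<And>v. v \<in> space_V \<Longrightarrow> L2_inner u' v + \<alpha>\<^sup>2 * stokes_ext u' v + advection_ext u u v = 0"
  shows "energy_coord \<alpha> u' = voigt \<alpha> (energy_coord \<alpha> u) (energy_coord \<alpha> u)"
proof -
  define d where "d = energy_coord \<alpha> u' - voigt \<alpha> (energy_coord \<alpha> u) (energy_coord \<alpha> u)"
  have "solenoidal_state d" unfolding d_def by (intro solenoidal_state_diff solenoidal_state_energy_coord u' solenoidal_state_voigt \<alpha>)
  then have V: "field_of \<alpha> d \<in> space_V" by (rule field_V[OF \<alpha>])
  have "d \<bullet> d = 0"
    using eq[OF V] weak_form_eq[OF \<alpha> u u' V] by (simp add: d_def[symmetric] energy_coord_field[OF \<alpha>])
  then show ?thesis by (simp add: d_def)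
qed

lemma einterval_UNIV: "einterval (-\<infinity>) \<infinity> = UNIV"
  by (auto simp: einterval_def)

lemma solution_imp_ode:
  assumes \<alpha>: "\<alpha> > 0" and v: "euler_voigt_solution \<alpha> (-\<infinity>) \<infinity> uin v" and uin: "uin \<in> space_V"
  shows "v t \<in> space_V"
    and "((\<lambda>s. energy_coord \<alpha> (v s)) has_vector_derivative voigt \<alpha> (energy_coord \<alpha> (v t)) (energy_coord \<alpha> (v t))) (at t)"
    and "energy_coord \<alpha> (v 0) = energy_coord \<alpha> uin"
proof -
  obtain v' where C: "C1_with_deriv UNIV space_V (sobolev_norm 1) v v'"
    and eq: "\<And>t w. w \<in> space_V \<Longrightarrow> L2_inner (v' t) w + \<alpha>\<^sup>2 * stokes_ext (v' t) w + advection_ext (v t) (v t) w = 0"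
    and ae: "AE x in torus. v 0 x = uin x"
    using v unfolding euler_voigt_solution_def einterval_UNIV by blast
  have V: "v t \<in> space_V" "v' t \<in> space_V" for t using C by (auto simp: C1_with_deriv_def)
  have S: "v t \<in> sobolev 1" "v' t \<in> sobolev 1" for t using V by (auto simp: space_V_iff)
  show "v t \<in> space_V" by (rule V)
  have "((\<lambda>s. norm ((1 / (s - t)) *\<^sub>R (energy_coord \<alpha> (v s) - energy_coord \<alpha> (v t)) - energy_coord \<alpha> (v' t))) \<longlongrightarrow> 0) (at t)"
  proof (rule tendsto_sandwich[OF _ _ tendsto_const])
    let ?N = "\<lambda>s. sobolev_norm 1 (\<lambda>x. (1 / (s - t)) *\<^sub>R (v s x - v t x) - v' t x)"
    have "(?N \<longlongrightarrow> 0) (at t)" using C by (auto simp: C1_with_deriv_def)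
    then have "((\<lambda>s. energy_const \<alpha> * (2 * ?N s)) \<longlongrightarrow> energy_const \<alpha> * (2 * 0)) (at t)"
      by (intro tendsto_mult tendsto_const)
    then show "((\<lambda>s. energy_const \<alpha> * (2 * ?N s)) \<longlongrightarrow> 0) (at t)" by simp
    have "norm ((1 / (s - t)) *\<^sub>R (energy_coord \<alpha> (v s) - energy_coord \<alpha> (v t)) - energy_coord \<alpha> (v' t)) \<le> energy_const \<alpha> * (2 * ?N s)" for s
    proof -
      have d: "(\<lambda>x. v s x - v t x) \<in> sobolev 1" by (rule sobolev_diff[OF S(1) S(1)])
      have c: "(\<lambda>x. (1 / (s - t)) *\<^sub>R (v s x - v t x)) \<in> sobolev 1" by (rule sobolev_cmult[OF d])
      have "energy_coord \<alpha> (\<lambda>x. (1 / (s - t)) *\<^sub>R (v s x - v t x)) = (1 / (s - t)) *\<^sub>R energy_coord \<alpha> (\<lambda>x. v s x - v t x)"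
        by (rule coef_eqI) (simp only: coef_energy_coord[OF c] coef_energy_coord[OF d] coef_simps fcoef_cmult scaleR_left_commute)
      then have "energy_coord \<alpha> (\<lambda>x. (1 / (s - t)) *\<^sub>R (v s x - v t x) - v' t x) = (1 / (s - t)) *\<^sub>R (energy_coord \<alpha> (v s) - energy_coord \<alpha> (v t)) - energy_coord \<alpha> (v' t)"
        by (simp only: energy_coord_diff[OF c S(2)] energy_coord_diff[OF S(1) S(1)])
      then show ?thesis using norm_energy_coord_le[OF sobolev_diff[OF c S(2)], of \<alpha> t] by metis
    qed
    then show "\<forall>\<^sub>F s in at t. norm ((1 / (s - t)) *\<^sub>R (energy_coord \<alpha> (v s) - energy_coord \<alpha> (v t)) - energy_coord \<alpha> (v' t)) \<le> energy_const \<alpha> * (2 * ?N s)"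
      by simp
  qed simp
  then have "((\<lambda>s. energy_coord \<alpha> (v s)) has_vector_derivative energy_coord \<alpha> (v' t)) (at t)"
    by (rule quotient_has_vector_derivative)
  then show "((\<lambda>s. energy_coord \<alpha> (v s)) has_vector_derivative voigt \<alpha> (energy_coord \<alpha> (v t)) (energy_coord \<alpha> (v t))) (at t)"
    using weak_form_imp_ode[OF \<alpha> V eq] by metis
  have "fcoef (v 0) k = fcoef uin k" for k
  proof (rule fcoef_AE_cong[OF ae])
    have "sqint (v 0)" "sqint uin" using S(1)[of 0] uin unfolding space_V_iff using sobolev_sqint by blast+
    then show "v 0 \<in> borel_measurable torus" "uin \<in> borel_measurable torus" by (auto simp: sqint_def)
  qed
  then show "energy_coord \<alpha> (v 0) = energy_coord \<alpha> uin" by (simp add: energy_coord_def)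
qed

text \<open>Equality holds for \<open>n = 1\<close> and \<open>n = 2\<close>; from there on the right-hand side grows geometrically.\<close>

lemma growth_exponent_ge: "2 * real n \<le> growth_exponent (Suc n)"
proof -
  have *: "2 * real (j + 2) \<le> 5 * (3/2) ^ j - 1" for j
  proof (induction j)
    case (Suc j)
    have "1 \<le> (3/2 :: real) ^ j" by (rule one_le_power) simp
    then show ?case using Suc by simp
  qed simp
  consider "n = 0" | "n = 1" | j where "n = j + 2"
    by (metis One_nat_def Suc_1 add.commute add_2_eq_Suc not0_implies_Suc)
  then show ?thesis
  proof cases
    case 3
    then show ?thesis using *[of j] by (simp add: growth_exponent_def)
  qed (simp_all add: growth_exponent_def)
qed

theorem theorem3p1:
  fixes m :: nat
  assumes "m \<ge> 1"
  shows "\<exists>C :: real \<Rightarrow> real \<Rightarrow> real. \<forall>\<alpha>>0. \<forall>uin \<in> sobolev m \<inter> space_V.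
    \<exists>u. euler_voigt_solution \<alpha> (-\<infinity>) \<infinity> uin u \<and> C1_Hm_V m UNIV u \<and>
      (\<forall>v. euler_voigt_solution \<alpha> (-\<infinity>) \<infinity> uin v \<and> C1_Hm_V m UNIV v \<longrightarrow>
         (\<forall>t. AE x in torus. v t x = u t x)) \<and>
      (\<forall>t. sobolev_norm m (u t)
         \<le> C \<alpha> (sobolev_norm m uin) * (1 + \<bar>t\<bar>) powr growth_exponent m)"
proof -
  obtain n where n: "m = Suc n" using assms by (metis Suc_le_D One_nat_def)
  define Yr where "Yr \<alpha> r = energy_const \<alpha> * (2 ^ Suc n * r)" for \<alpha> r
  define C where "C \<alpha> r = sqrt (sobolev_const (Suc n)) * bracket_const \<alpha> * growthC \<alpha> (Yr \<alpha> r) n" for \<alpha> r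
  show ?thesis
  proof (intro exI[of _ C] allI impI ballI)
    fix \<alpha> :: real and uin
    assume \<alpha>: "\<alpha> > 0" and uin: "uin \<in> sobolev m \<inter> space_V"
    have V: "uin \<in> space_V" and S: "uin \<in> sobolev (Suc n)" using uin n by auto
    have S1: "uin \<in> sobolev 1" using V by (simp add: space_V_iff)
    define Y where "Y = Yr \<alpha> (sobolev_norm m uin)"
    have Y0: "0 \<le> Y" using sobolev_norm_nonneg[of m uin] by (simp add: Y_def Yr_def energy_const_def)
    obtain z where z0: "z 0 = energy_coord \<alpha> uin" and z: "\<And>t. (z has_vector_derivative voigt \<alpha> (z t) (z t)) (at t)"
      using quadratic_ode_global[OF bounded_bilinear_voigt[OF \<alpha>] voigt_energy[OF \<alpha>]] by blast
    have init: "l2_le (\<lambda>k. bracket k ^ n *\<^sub>R coef (z 0) k) (Y\<^sup>2)"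
      using l2_le_bracket_energy_coord[OF S, of \<alpha>] by (simp only: z0 Y_def Yr_def n)
    have sz: "solenoidal_state (z t)" for t by (rule solenoidal_state_preserved[OF \<alpha> z]) (simp only: z0 solenoidal_state_energy_coord[OF V])
    define u where "u t = field_of \<alpha> (z t)" for t
    define u' where "u' t = field_of \<alpha> (voigt \<alpha> (z t) (z t))" for t
    have uV: "u t \<in> space_V" "u' t \<in> space_V" for t
      unfolding u_def u'_def by (intro field_V \<alpha> sz solenoidal_state_voigt)+
    have "C1_with_deriv UNIV (sobolev (Suc n) \<inter> space_V) (sobolev_norm (Suc n)) u u'"
      unfolding u_def u'_def by (rule field_C1[OF \<alpha> z init Y0 sz])
    then have C1: "C1_Hm_V m UNIV u" unfolding C1_Hm_V_def n by blast
    have "C1_with_deriv UNIV (sobolev (Suc 0) \<inter> space_V) (sobolev_norm (Suc 0)) u u'"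
      unfolding u_def u'_def by (rule field_C1[OF \<alpha> z l2_le_bracket_0 norm_ge_zero sz])
    then have C1V: "C1_with_deriv UNIV space_V (sobolev_norm 1) u u'"
      by (simp add: C1_with_deriv_def)
    have weak: "L2_inner (u' t) v + \<alpha>\<^sup>2 * stokes_ext (u' t) v + advection_ext (u t) (u t) v = 0" if "v \<in> space_V" for t v
      unfolding weak_form_eq[OF \<alpha> uV that] by (simp add: u_def u'_def energy_coord_field[OF \<alpha>])
    have "fcoef (u 0) k = fcoef uin k" for k
      using energy_weight_pos[of \<alpha> k] by (simp add: u_def field_of z0 coef_energy_coord[OF S1])
    then have init_ae: "AE x in torus. u 0 x = uin x"
      by (intro fcoef_eq_imp_AE_eq sobolev_sqint[OF S1]) (simp_all add: u_def field_of)
    have solenoidal: "euler_voigt_solution \<alpha> (-\<infinity>) \<infinity> uin u"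
      unfolding euler_voigt_solution_def einterval_UNIV using C1V weak init_ae by (intro conjI exI[of _ u']) auto
    have uniq: "AE x in torus. v t x = u t x" if v: "euler_voigt_solution \<alpha> (-\<infinity>) \<infinity> uin v" for v t
    proof -
      have eq: "energy_coord \<alpha> (v t) = z t"
        by (rule quadratic_ode_unique[OF bounded_bilinear_voigt[OF \<alpha>] voigt_energy[OF \<alpha>] solution_imp_ode(2)[OF \<alpha> v V] z])
           (simp add: z0 solution_imp_ode(3)[OF \<alpha> v V])
      have v1: "v t \<in> sobolev 1" using solution_imp_ode(1)[OF \<alpha> v V] by (simp add: space_V_iff)
      have "fcoef (v t) k = fcoef (u t) k" for k
        using coef_energy_coord[OF v1, of \<alpha> k] energy_weight_pos[of \<alpha> k] by (simp add: eq u_def field_of)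
      then show ?thesis
        by (intro fcoef_eq_imp_AE_eq sobolev_sqint[OF v1]) (simp_all add: u_def field_of)
    qed
    have bound: "sobolev_norm m (u t) \<le> C \<alpha> (sobolev_norm m uin) * (1 + \<bar>t\<bar>) powr growth_exponent m" for t
    proof -
      define G where "G = growthC \<alpha> Y n"
      have G1: "1 \<le> G" unfolding G_def by (rule growthC_ge1[OF Y0])
      have "sobolev_norm (Suc n) (u t) \<le> sqrt (sobolev_const (Suc n)) * bracket_const \<alpha> * (G * (1 + \<bar>t\<bar>) ^ (2 * n))"
        unfolding u_def G_def
        by (rule sobolev_from_coords(2)[OF \<alpha> field_of polynomial_growth[OF \<alpha> z init Y0 order_refl]])
           (use G1 in \<open>simp add: G_def\<close>)
      also have "\<dots> \<le> sqrt (sobolev_const (Suc n)) * bracket_const \<alpha> * (G * (1 + \<bar>t\<bar>) powr growth_exponent m)"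
      proof (intro mult_left_mono)
        have "(1 + \<bar>t\<bar>) ^ (2 * n) = (1 + \<bar>t\<bar>) powr (2 * real n)"
          by (subst powr_realpow[symmetric]) auto
        also have "\<dots> \<le> (1 + \<bar>t\<bar>) powr growth_exponent m"
          unfolding n by (rule powr_mono[OF growth_exponent_ge]) simp
        finally show "(1 + \<bar>t\<bar>) ^ (2 * n) \<le> (1 + \<bar>t\<bar>) powr growth_exponent m" .
      qed (use G1 bracket_const_ge1[of \<alpha>] sobolev_const_nonneg[of "Suc n"] in auto)
      finally show ?thesis by (simp add: C_def G_def Y_def n mult.assoc)
    qed
    show "\<exists>u. euler_voigt_solution \<alpha> (-\<infinity>) \<infinity> uin u \<and> C1_Hm_V m UNIV u \<and>
      (\<forall>v. euler_voigt_solution \<alpha> (-\<infinity>) \<infinity> uin v \<and> C1_Hm_V m UNIV v \<longrightarrow>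
         (\<forall>t. AE x in torus. v t x = u t x)) \<and>
      (\<forall>t. sobolev_norm m (u t) \<le> C \<alpha> (sobolev_norm m uin) * (1 + \<bar>t\<bar>) powr growth_exponent m)"
      using solenoidal C1 uniq bound by blast
  qed
qed

end
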